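(* Let $n\geq 2$ be an integer, $\rho>1$, and let $(p_r)_{r\geq1}$ satisfy $p_r>0$, $\sum_{r\geq1}p_r=1$ and $C_1\rho^{-r}\leq p_r\leq C_2\rho^{-r}$ for some constants $C_1,C_2>0$. Assume the spectral dimension $\mathrm{d}=2\frac{\log n}{\log\rho}$ satisfies $\mathrm{d}<1$. Let $e\in\mathbb{R}$ be such that $\eta(e)>0$ and such that for every $z\in\mathbb{C}$ with $\mathrm{Im}\, z>0$, $$\lim_{\varepsilon\downarrow0}\int_{\mathbb{R}}\mathrm{Im}\,(t-e-\varepsilon z)^{-1}\eta(t)\,dt=\pi\eta(e).$$ Then the rescaled eigenvalue point process $\xi_k^{\omega,e}=\sum_{i=1}^{|B_k|}\delta\big(|B_k|(e_i^{\omega,k}-e)\big)$ converges, as $k\to\infty$, to a Poisson point process on $\mathbb{R}$ with intensity $\eta(e)\mathcal{L}$, where $\mathcal{L}$ is Lebesgue measure. That is, for any disjoint bounded Borel sets $A_1,\dots,A_m\subset\mathbb{R}$ and any $r_1,\dots,r_m\in\{0,1,2,\dots\}$, $$\lim_{k\to\infty}\mathbb{P}\{\xi_k^{\omega,e}(A_1)=r_1,\dots,\xi_k^{\omega,e}(A_m)=r_m\}=\prod_{s=1}^m e^{-\eta(e)\mathcal{L}(A_s)}\frac{(\eta(e)\mathcal{L}(A_s))^{r_s}}{r_s!}.$$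
   Context: Hierarchical Anderson model. Let $\mathbb{X}=\{0,1,2,\dots\}$. For $x\in\mathbb{X}$ and $r\geq0$ let $q(x,n^r)$ be the quotient of the division of $x$ by $n^r$, and define the metric $d(x,y)=\min\{r: q(x,n^r)=q(y,n^r)\}$; closed balls are $B(x,r)=\{y: d(x,y)\leq r\}$ (each has $n^r$ points). For $r\geq1$ let $E_r$ be the operator on $\ell^2(\mathbb{X})$ given by $(E_r\psi)(x)=n^{-r}\sum_{d(y,x)\leq r}\psi(y)$ (orthogonal projection onto functions constant on balls of radius $r$). The hierarchical Laplacian is $\Delta=\sum_{r\geq1}p_rE_r$. Let $(\omega(x))_{x\in\mathbb{X}}$ be i.i.d. real random variables with a bounded probability density $\gamma$, on the product probability space $(\Omega,\mathcal{F},\mathbb{P})$, and let $V_\omega$ be multiplication by $\omega(x)$. Set $H_\omega=\Delta+V_\omega$ (self-adjoint on $\{\psi:\sum_x|\psi(x)|^2(1+|\omega(x)|^2)<\infty\}$). Fix $x_0\in\mathbb{X}$, let $B_k=B(x_0,k)$, so $|B_k|=n^k$, and let $H_k^\omega=\sum_{s=1}^kp_sE_s+V_\omega$; the subspace $\ell^2(B_k)$ of functions vanishing outside $B_k$ is invariant under $H_k^\omega$, and $e_1^{\omega,k}\leq\dots\leq e^{\omega,k}_{|B_k|}$ denote the eigenvalues of $H_k^\omega$ restricted to $\ell^2(B_k)$. The averaged spectral measure $\mu^{av}$ is the Borel probability measure with $\int f\,d\mu^{av}=\mathbb{E}\langle\delta_{x_0},f(H_\omega)\delta_{x_0}\rangle$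 for continuous $f$ vanishing at infinity; it is absolutely continuous with respect to Lebesgue measure with a bounded density $\eta$ ($\|\eta\|_\infty\leq\|\gamma\|_\infty$). *)

theory Defs
  imports "HOL-Probability.Probability" "HOL-Computational_Algebra.Polynomial_Factorial"
    "Jordan_Normal_Form.Char_Poly"
begin

text \<open>Hierarchical structure on X = nat with branching number n.
  d(x,y) <= r  iff  x div n^r = y div n^r, so the closed ball is:\<close>
definition hball :: "nat \<Rightarrow> nat \<Rightarrow> nat \<Rightarrow> nat set" where
  "hball n x r = {y. y div n ^ r = x div n ^ r}"

definition hE :: "nat \<Rightarrow> nat \<Rightarrow> (nat \<Rightarrow> complex) \<Rightarrow> nat \<Rightarrow> complex" where
  "hE n r \<psi> x = (\<Sum>y\<in>hball n x r. \<psi> y) / of_nat (n ^ r)"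

definition hH :: "nat \<Rightarrow> (nat \<Rightarrow> real) \<Rightarrow> (nat \<Rightarrow> real) \<Rightarrow> (nat \<Rightarrow> complex) \<Rightarrow> nat \<Rightarrow> complex" where
  "hH n p \<omega> \<psi> x = (\<Sum>r. complex_of_real (p (Suc r)) * hE n (Suc r) \<psi> x) + complex_of_real (\<omega> x) * \<psi> x"

definition hdom :: "(nat \<Rightarrow> real) \<Rightarrow> (nat \<Rightarrow> complex) set" where
  "hdom \<omega> = {\<psi>. summable (\<lambda>x. (cmod (\<psi> x))\<^sup>2 * (1 + (\<omega> x)\<^sup>2))}"

text \<open>Diagonal resolvent matrix element  < delta_x0, (H_omega - z)^{-1} delta_x0 >,
  i.e. psi(x0) where psi is the (unique) element of the domain with (H_omega - z) psi = delta_x0.\<close>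
definition hresolvent :: "nat \<Rightarrow> (nat \<Rightarrow> real) \<Rightarrow> nat \<Rightarrow> (nat \<Rightarrow> real) \<Rightarrow> complex \<Rightarrow> complex" where
  "hresolvent n p x0 \<omega> z = (THE c. \<exists>\<psi>\<in>hdom \<omega>.
      (\<forall>x. hH n p \<omega> \<psi> x - z * \<psi> x = (if x = x0 then 1 else 0)) \<and> c = \<psi> x0)"

text \<open>Matrix of H_k^omega restricted to l^2(B_k), B_k = B(x0,k) = {c n^k + i | i < n^k},
  c = x0 div n^k; row/column index i corresponds to the point c n^k + i.\<close>
definition hHk_mat :: "nat \<Rightarrow> (nat \<Rightarrow> real) \<Rightarrow> nat \<Rightarrow> nat \<Rightarrow> (nat \<Rightarrow> real) \<Rightarrow> real mat" where
  "hHk_mat n p x0 k \<omega> = (let c = x0 div n ^ k in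
     mat (n ^ k) (n ^ k) (\<lambda>(i, j).
       (\<Sum>s\<in>{1..k}. p s / real n ^ s *
          (if (c * n ^ k + i) div n ^ s = (c * n ^ k + j) div n ^ s then 1 else 0))
       + (if i = j then \<omega> (c * n ^ k + i) else 0)))"

definition hxi :: "nat \<Rightarrow> (nat \<Rightarrow> real) \<Rightarrow> nat \<Rightarrow> real \<Rightarrow> nat \<Rightarrow> (nat \<Rightarrow> real) \<Rightarrow> real set \<Rightarrow> nat" where
  "hxi n p x0 e k \<omega> A =
     size (filter_mset (\<lambda>t. real (n ^ k) * (t - e) \<in> A) (proots (char_poly (hHk_mat n p x0 k \<omega>))))"

end

theory Submission
  imports Defs
begin

text \<open>
  Keep only the levels \<open>s \<le> l\<close> of the hierarchical Laplacian on \<open>B\<^sub>k\<close>, where \<open>l = \<lceil>\<alpha> k\<rceil>\<close>.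
  The operator splits into independent, identically distributed blocks of size \<open>n\<^sup>l\<close>, and it differs
  from the full one by a perturbation of norm \<open>O(\<rho>\<^sup>-\<^sup>l)\<close>. Since \<open>n\<^sup>2 < \<rho>\<close>, \<open>\<alpha> < 1\<close> can be chosen so
  that this is \<open>o(|B\<^sub>k|\<^sup>-\<^sup>2)\<close>. By Weyl's inequality and the Wegner estimate the two rescaled counting
  functions of an interval are then close in \<open>L\<^sup>1\<close>, and approximation extends this to Borel sets.

  A block contributes to a bounded window with probability \<open>O(1/b)\<close>, \<open>b\<close> being the number of blocks,
  and contributes twice with probability \<open>O(1/b\<^sup>2)\<close> by Minami's estimate. Hence the law of a block agrees
  with that of a Poisson vector of intensity \<open>1/b\<close> up to \<open>o(1/b)\<close>, and Le Cam's replacement argument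
  gives the Poisson limit once the expected counts converge. The Poisson transform of the density of
  states of a block differs from that of \<open>\<eta>\<close> by a resolvent comparison error that vanishes even at the
  scale \<open>1/|B\<^sub>k|\<close>. The hypothesis at \<open>e\<close> thus identifies the limiting Poisson transform as the constant
  \<open>\<pi> \<eta>(e)\<close>, and inverting it shows that the expected counts converge to \<open>\<eta>(e) \<L>(A)\<close>.
\<close>

section \<open>Finite symmetric operators\<close>

lemma underdetermined_system_nontrivial_solution:
  fixes m :: "'t \<Rightarrow> 'i \<Rightarrow> 'a::field"
  assumes T: "finite T" and S: "finite S" and less: "card T < card S"
  shows "\<exists>c. (\<exists>i\<in>S. c i \<noteq> 0) \<and> (\<forall>t\<in>T. (\<Sum>i\<in>S. m t i * c i) = 0)"
proof -
  define N where "N = card S"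
  obtain s where s: "bij_betw s {0..<N} S"
    using ex_bij_betw_nat_finite[OF S] by (auto simp: N_def)
  obtain t where t: "bij_betw t {0..<card T} T"
    using ex_bij_betw_nat_finite[OF T] by blast
  define A where "A = mat N N (\<lambda>(j, k). if j < card T then m (t j) (s k) else 0)"
  have A: "A \<in> carrier_mat N N" "transpose_mat A \<in> carrier_mat N N" by (auto simp: A_def)
  have "transpose_mat A *\<^sub>v unit_vec N (card T) = 0\<^sub>v N"
    using less by (intro eq_vecI) (auto simp: A_def N_def)
  then have "det (transpose_mat A) = 0"
    using less unfolding det_0_iff_vec_prod_zero_field[OF A(2)]
    by (intro exI[of _ "unit_vec N (card T)"]) (auto simp: N_def)
  then obtain v where v: "v \<in> carrier_vec N" "v \<noteq> 0\<^sub>v N" "A *\<^sub>v v = 0\<^sub>v N"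
    unfolding det_transpose[OF A(1)] det_0_iff_vec_prod_zero_field[OF A(1)] by blast
  define c where "c i = v $ (the_inv_into {0..<N} s i)" for i
  have c: "c (s k) = v $ k" if "k < N" for k
    using that s by (simp add: c_def the_inv_into_f_f bij_betw_def)
  obtain k where "k < N" "v $ k \<noteq> 0"
    using v(1,2) by (metis carrier_vecD eq_vecI index_zero_vec(1) index_zero_vec(2))
  moreover from this have "s k \<in> S" using s by (auto simp: bij_betw_def)
  ultimately have "\<exists>i\<in>S. c i \<noteq> 0" using c by metis
  moreover have "(\<Sum>i\<in>S. m r i * c i) = 0" if r: "r \<in> T" for r
  proof -
    have "r \<in> t ` {0..<card T}" using r t by (simp add: bij_betw_def)
    then obtain j where j: "j < card T" "r = t j" by auto
    have "(\<Sum>i\<in>S. m r i * c i) = (\<Sum>k=0..<N. m r (s k) * c (s k))"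
      by (rule sum.reindex_bij_betw[OF s, symmetric])
    also have "\<dots> = (A *\<^sub>v v) $ j"
      using j v(1) less by (simp add: A_def N_def scalar_prod_def c)
    finally show ?thesis using v(3) j less by (simp add: N_def)
  qed
  ultimately show ?thesis by blast
qed

definition dot :: "'i set \<Rightarrow> ('i \<Rightarrow> real) \<Rightarrow> ('i \<Rightarrow> real) \<Rightarrow> real" where
  "dot S u v = (\<Sum>x\<in>S. u x * v x)"

lemma dot_commute: "dot S u v = dot S v u"
  by (simp add: dot_def mult.commute)

lemma dot_cong: "(\<And>x. x \<in> S \<Longrightarrow> u x = u' x) \<Longrightarrow> (\<And>x. x \<in> S \<Longrightarrow> v x = v' x) \<Longrightarrow> dot S u v = dot S u' v'"
  by (simp add: dot_def)

lemma dot_add_left: "dot S (\<lambda>x. u x + v x) f = dot S u f + dot S v f"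
  by (simp add: dot_def ring_distribs sum.distrib)

lemma dot_scale_left: "dot S (\<lambda>x. c * v x) f = c * dot S v f"
  by (simp add: dot_def sum_distrib_left mult.assoc)

lemma dot_add_right: "dot S f (\<lambda>x. u x + v x) = dot S f u + dot S f v"
  by (simp add: dot_commute[of S f] dot_add_left)

lemma dot_scale_right: "dot S f (\<lambda>x. c * v x) = c * dot S f v"
  by (simp add: dot_commute[of S f] dot_scale_left)

lemma dot_diff_right: "dot S f (\<lambda>x. u x - v x) = dot S f u - dot S f v"
  by (simp add: dot_def algebra_simps sum_subtractf)

lemma dot_sum_right: "dot S f (\<lambda>x. \<Sum>i\<in>I. v i x) = (\<Sum>i\<in>I. dot S f (v i))"
  unfolding dot_def sum_distrib_left by (rule sum.swap)

lemma dot_self_nonneg: "dot S v v \<ge> 0"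
  by (simp add: dot_def sum_nonneg)

lemma dot_self_eq_0_iff: "finite S \<Longrightarrow> dot S v v = 0 \<longleftrightarrow> (\<forall>x\<in>S. v x = 0)"
  by (simp add: dot_def sum_nonneg_eq_0_iff)

lemma dot_delta: "finite S \<Longrightarrow> x \<in> S \<Longrightarrow> dot S f (\<lambda>y. if y = x then c else 0) = f x * c"
  by (simp add: dot_def if_distrib[of "\<lambda>t. _ * t"] cong: if_cong)

definition L2_norm :: "'i set \<Rightarrow> ('i \<Rightarrow> 'a::real_normed_vector) \<Rightarrow> real" where
  "L2_norm S \<psi> = L2_set (\<lambda>x. norm (\<psi> x)) S"

lemma L2_norm_nonneg [simp]: "L2_norm S \<psi> \<ge> 0"
  by (simp add: L2_norm_def)

lemma L2_norm_power2: "(L2_norm S \<psi>)\<^sup>2 = (\<Sum>x\<in>S. (norm (\<psi> x))\<^sup>2)"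
  by (simp add: L2_norm_def L2_set_def sum_nonneg)

lemma L2_norm_power2_dot: "(L2_norm S v)\<^sup>2 = dot S v v"
  unfolding L2_norm_power2 dot_def by (simp add: power2_eq_square)

lemma L2_norm_cong: "(\<And>x. x \<in> S \<Longrightarrow> norm (\<psi> x) = norm (\<phi> x)) \<Longrightarrow> L2_norm S \<psi> = L2_norm S \<phi>"
  unfolding L2_norm_def by (rule L2_set_cong) auto

lemma L2_norm_triangle: "L2_norm S (\<lambda>x. \<psi> x + \<phi> x) \<le> L2_norm S \<psi> + L2_norm S \<phi>"
proof -
  have "L2_norm S (\<lambda>x. \<psi> x + \<phi> x) \<le> L2_set (\<lambda>x. norm (\<psi> x) + norm (\<phi> x)) S"
    unfolding L2_norm_def by (rule L2_set_mono) (auto simp: norm_triangle_ineq)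
  also have "\<dots> \<le> L2_norm S \<psi> + L2_norm S \<phi>" unfolding L2_norm_def by (rule L2_set_triangle_ineq)
  finally show ?thesis .
qed

lemma L2_norm_minus: "L2_norm S (\<lambda>x. - \<psi> x) = L2_norm S \<psi>"
  by (simp add: L2_norm_def)

lemma L2_norm_mult: "L2_norm S (\<lambda>x. c * \<psi> x) = norm c * L2_norm S \<psi>" for c :: "'a::real_normed_div_algebra"
  unfolding L2_norm_def by (simp add: norm_mult L2_set_right_distrib)

lemma L2_norm_zero [simp]: "L2_norm S (\<lambda>_. 0) = 0"
  by (simp add: L2_norm_def L2_set_def)

lemma norm_le_L2_norm: "finite S \<Longrightarrow> x \<in> S \<Longrightarrow> norm (\<psi> x) \<le> L2_norm S \<psi>"
  unfolding L2_norm_def by (rule member_le_L2_set)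

lemma L2_norm_mono_set: "finite S \<Longrightarrow> T \<subseteq> S \<Longrightarrow> L2_norm T \<psi> \<le> L2_norm S \<psi>"
  unfolding L2_norm_def L2_set_def by (auto intro: sum_mono2)

lemma L2_norm_le_cmult:
  assumes "\<And>x. x \<in> S \<Longrightarrow> norm (\<psi> x) \<le> c * norm (\<phi> x)" "c \<ge> 0"
  shows "L2_norm S \<psi> \<le> c * L2_norm S \<phi>"
proof -
  have "L2_norm S \<psi> \<le> L2_set (\<lambda>x. c * norm (\<phi> x)) S"
    unfolding L2_norm_def using assms by (intro L2_set_mono) auto
  then show ?thesis using assms(2) by (simp add: L2_norm_def L2_set_right_distrib)
qed

lemma L2_norm_le_0_imp_eq_0: "finite S \<Longrightarrow> L2_norm S \<psi> \<le> 0 \<Longrightarrow> x \<in> S \<Longrightarrow> \<psi> x = 0"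
  using norm_le_L2_norm[of S x \<psi>] by (metis norm_le_zero_iff order.trans)

lemma L2_norm_delta: "finite S \<Longrightarrow> x \<in> S \<Longrightarrow> L2_norm S (\<lambda>y. if y = x then c else 0) = norm c"
  by (simp add: L2_norm_def L2_set_def if_distrib[of norm] if_distrib[of "\<lambda>t. t\<^sup>2"] cong: if_cong)

lemma weighted_Cauchy_Schwarz:
  fixes b f :: "'i \<Rightarrow> real"
  assumes "\<And>y. y \<in> S \<Longrightarrow> b y \<ge> 0"
  shows "(\<Sum>y\<in>S. b y * f y)\<^sup>2 \<le> (\<Sum>y\<in>S. b y) * (\<Sum>y\<in>S. b y * (f y)\<^sup>2)"
proof -
  have "(\<Sum>y\<in>S. b y * f y) = (\<Sum>y\<in>S. sqrt (b y) * (sqrt (b y) * f y))"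
    using assms by (intro sum.cong) (auto simp: mult.assoc[symmetric])
  also have "\<dots>\<^sup>2 \<le> (\<Sum>y\<in>S. (sqrt (b y))\<^sup>2) * (\<Sum>y\<in>S. (sqrt (b y) * f y)\<^sup>2)"
    by (rule Cauchy_Schwarz_ineq_sum)
  also have "\<dots> = (\<Sum>y\<in>S. b y) * (\<Sum>y\<in>S. b y * (f y)\<^sup>2)"
    using assms by (simp add: power_mult_distrib)
  finally show ?thesis .
qed

lemma Schur_test:
  fixes b :: "'i \<Rightarrow> 'i \<Rightarrow> real" and \<psi> :: "'i \<Rightarrow> 'a::real_normed_vector"
  assumes sym: "\<And>x y. x \<in> S \<Longrightarrow> y \<in> S \<Longrightarrow> b x y = b y x"
    and row: "\<And>x. x \<in> S \<Longrightarrow> (\<Sum>y\<in>S. \<bar>b x y\<bar>) \<le> d" and d: "d \<ge> 0"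
  shows "L2_norm S (\<lambda>x. \<Sum>y\<in>S. b x y *\<^sub>R \<psi> y) \<le> d * L2_norm S \<psi>"
proof -
  have "(L2_norm S (\<lambda>x. \<Sum>y\<in>S. b x y *\<^sub>R \<psi> y))\<^sup>2 \<le> (\<Sum>x\<in>S. d * (\<Sum>y\<in>S. \<bar>b x y\<bar> * (norm (\<psi> y))\<^sup>2))"
    unfolding L2_norm_power2
  proof (rule sum_mono)
    fix x assume x: "x \<in> S"
    have "(norm (\<Sum>y\<in>S. b x y *\<^sub>R \<psi> y))\<^sup>2 \<le> (\<Sum>y\<in>S. \<bar>b x y\<bar> * norm (\<psi> y))\<^sup>2"
      by (intro power_mono order.trans[OF norm_sum]) auto
    also have "\<dots> \<le> (\<Sum>y\<in>S. \<bar>b x y\<bar>) * (\<Sum>y\<in>S. \<bar>b x y\<bar> * (norm (\<psi> y))\<^sup>2)"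
      by (rule weighted_Cauchy_Schwarz) simp
    also have "\<dots> \<le> d * (\<Sum>y\<in>S. \<bar>b x y\<bar> * (norm (\<psi> y))\<^sup>2)"
      using row[OF x] by (intro mult_right_mono sum_nonneg) auto
    finally show "(norm (\<Sum>y\<in>S. b x y *\<^sub>R \<psi> y))\<^sup>2 \<le> d * (\<Sum>y\<in>S. \<bar>b x y\<bar> * (norm (\<psi> y))\<^sup>2)" .
  qed
  also have "\<dots> = d * (\<Sum>y\<in>S. (\<Sum>x\<in>S. \<bar>b x y\<bar>) * (norm (\<psi> y))\<^sup>2)"
    by (simp add: sum_distrib_left sum_distrib_right mult.assoc) (rule sum.swap)
  also have "\<dots> \<le> d * (\<Sum>y\<in>S. d * (norm (\<psi> y))\<^sup>2)"
  proof (intro mult_left_mono sum_mono mult_right_mono)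
    fix y assume y: "y \<in> S"
    have "(\<Sum>x\<in>S. \<bar>b x y\<bar>) = (\<Sum>x\<in>S. \<bar>b y x\<bar>)" using sym[OF _ y] by simp
    then show "(\<Sum>x\<in>S. \<bar>b x y\<bar>) \<le> d" using row[OF y] by simp
  qed (use d in auto)
  also have "\<dots> = (d * L2_norm S \<psi>)\<^sup>2"
    unfolding power_mult_distrib L2_norm_power2 sum_distrib_left by (simp add: power2_eq_square mult.assoc)
  finally show ?thesis using d by (simp add: power2_le_iff_abs_le)
qed

definition schroedinger ::
    "'i set \<Rightarrow> ('i \<Rightarrow> 'i \<Rightarrow> real) \<Rightarrow> ('i \<Rightarrow> real) \<Rightarrow> ('i \<Rightarrow> 'a::real_vector) \<Rightarrow> 'i \<Rightarrow> 'a" where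
  "schroedinger S a w \<psi> x = (\<Sum>y\<in>S. a x y *\<^sub>R \<psi> y) + w x *\<^sub>R \<psi> x"

lemma schroedinger_add: "schroedinger S a w (\<lambda>y. \<psi> y + \<phi> y) x = schroedinger S a w \<psi> x + schroedinger S a w \<phi> x"
  by (simp add: schroedinger_def algebra_simps sum.distrib)

lemma schroedinger_diff: "schroedinger S a w (\<lambda>y. \<psi> y - \<phi> y) x = schroedinger S a w \<psi> x - schroedinger S a w \<phi> x"
  by (simp add: schroedinger_def algebra_simps sum_subtractf)

lemma schroedinger_mult:
  fixes c :: "'a::real_algebra"
  shows "schroedinger S a w (\<lambda>y. c * \<psi> y) x = c * schroedinger S a w \<psi> x"
  by (simp add: schroedinger_def algebra_simps sum_distrib_left)

lemma schroedinger_sum: "schroedinger S a w (\<lambda>y. \<Sum>i\<in>I. \<psi> i y) x = (\<Sum>i\<in>I. schroedinger S a w (\<psi> i) x)"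
  unfolding schroedinger_def scaleR_sum_right sum.distrib by (subst sum.swap) rule

lemma schroedinger_of_real:
  "schroedinger S a w (\<lambda>y. of_real (u y)) x = (of_real (schroedinger S a w u x) :: 'a::real_algebra_1)"
  by (simp add: schroedinger_def scaleR_conv_of_real)

lemma schroedinger_cong:
  "(\<And>y. y \<in> S \<Longrightarrow> \<psi> y = \<phi> y) \<Longrightarrow> x \<in> S \<Longrightarrow> schroedinger S a w \<psi> x = schroedinger S a w \<phi> x"
  by (simp add: schroedinger_def cong: sum.cong)

lemma linear_coefficient_nonpos:
  fixes R P :: real
  assumes "\<And>t. t > 0 \<Longrightarrow> 2 * t * R + t * t * P \<le> 0"
  shows "R \<le> 0"
proof (rule ccontr)
  assume "\<not> R \<le> 0"
  define t where "t = R / (\<bar>P\<bar> + 1)"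
  have t: "t > 0" using \<open>\<not> R \<le> 0\<close> by (simp add: t_def)
  have "t * (- P) \<le> t * (\<bar>P\<bar> + 1)" using t by (intro mult_left_mono) auto
  also have "\<dots> = R" by (simp add: t_def)
  finally have "0 < 2 * R + t * P" using \<open>\<not> R \<le> 0\<close> by linarith
  then have "0 < t * (2 * R + t * P)" using t by simp
  with assms[OF t] show False by (simp add: algebra_simps)
qed

locale symmetric_kernel =
  fixes S :: "'i set" and a :: "'i \<Rightarrow> 'i \<Rightarrow> real"
  assumes fin: "finite S" and sym: "x \<in> S \<Longrightarrow> y \<in> S \<Longrightarrow> a x y = a y x"
begin

lemma schroedinger_self_adjoint: "dot S v (schroedinger S a w u) = dot S (schroedinger S a w v) u"
proof -
  have "(\<Sum>x\<in>S. v x * (\<Sum>y\<in>S. a x y * u y)) = (\<Sum>x\<in>S. \<Sum>y\<in>S. v x * a x y * u y)"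
    by (simp add: sum_distrib_left ac_simps)
  also have "\<dots> = (\<Sum>y\<in>S. \<Sum>x\<in>S. v x * a x y * u y)" by (rule sum.swap)
  also have "\<dots> = (\<Sum>y\<in>S. (\<Sum>x\<in>S. a y x * v x) * u y)"
    unfolding sum_distrib_right by (intro sum.cong refl) (use sym in \<open>simp add: mult.commute\<close>)
  finally show ?thesis by (simp add: dot_def schroedinger_def ring_distribs sum.distrib ac_simps)
qed

lemma quadratic_form_add_scale:
  "dot S (\<lambda>x. v x + t * r x) (schroedinger S a w (\<lambda>x. v x + t * r x)) =
    dot S v (schroedinger S a w v) + 2 * t * dot S r (schroedinger S a w v) + t * t * dot S r (schroedinger S a w r)"
proof -
  have "schroedinger S a w (\<lambda>x. v x + t * r x) = (\<lambda>x. schroedinger S a w v x + t * schroedinger S a w r x)"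
    by (simp add: fun_eq_iff schroedinger_add schroedinger_mult)
  then show ?thesis
    using schroedinger_self_adjoint[of v w r]
    by (simp add: dot_add_left dot_add_right dot_scale_left dot_scale_right
        dot_commute[of S "schroedinger S a w v" r] algebra_simps)
qed

lemma compact_unit_sphere_orthogonal:
  "compact {v. (\<forall>x. x \<notin> S \<longrightarrow> v x = 0) \<and> dot S v v = 1 \<and> (\<forall>i\<in>T. dot S (u i) v = 0)}" (is "compact ?C")
proof -
  define K where "K = PiE UNIV (\<lambda>x. if x \<in> S then {-1..1::real} else {0})"
  define C where "C = {v. dot S v v = 1 \<and> (\<forall>i\<in>T. dot S (u i) v = 0)}"
  have "compactin (product_topology (\<lambda>_. euclidean) UNIV) K"
    unfolding K_def compactin_PiE by auto
  then have "compact K" by (simp add: euclidean_product_topology)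
  moreover have "closed C"
    unfolding C_def Ball_def dot_def
    by (intro closed_Collect_conj closed_Collect_all closed_Collect_imp closed_Collect_eq)
      (auto intro!: continuous_intros continuous_on_subset[OF continuous_on_product_coordinates])
  ultimately have "compact (K \<inter> C)" by (rule compact_Int_closed)
  moreover have "?C = K \<inter> C"
  proof -
    have "v x \<in> {-1..1}" if "dot S v v = 1" "x \<in> S" for v x
    proof -
      have "(v x)\<^sup>2 \<le> dot S v v"
        unfolding dot_def power2_eq_square using that fin by (intro member_le_sum) auto
      then show ?thesis using that by (simp add: abs_square_le_1 abs_le_iff minus_le_iff)
    qed
    then show ?thesis unfolding K_def C_def PiE_iff by (auto 0 3 split: if_split_asm)
  qed
  ultimately show ?thesis by simp
qed

lemma obtain_normalized_orthogonal:
  assumes y: "\<And>i. i \<in> T \<Longrightarrow> dot S (u i) y = 0" "dot S y y \<noteq> 0"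
  obtains v where "\<And>x. x \<notin> S \<Longrightarrow> v x = 0" "dot S v v = 1" "\<And>i. i \<in> T \<Longrightarrow> dot S (u i) v = 0"
    "dot S y (schroedinger S a w y) = dot S v (schroedinger S a w v) * dot S y y"
proof
  define c where "c = 1 / sqrt (dot S y y)"
  let ?v = "\<lambda>x. if x \<in> S then c * y x else 0"
  have c: "c * c * dot S y y = 1"
    using y(2) dot_self_nonneg[of S y] by (simp add: c_def)
  have v: "dot S f ?v = c * dot S f y" for f
    unfolding dot_scale_right[symmetric] by (rule dot_cong) auto
  show "dot S ?v ?v = 1" using c by (simp add: v dot_commute[of S ?v] mult.assoc)
  show "dot S (u i) ?v = 0" if "i \<in> T" for i using y(1)[OF that] by (simp add: v)
  have "dot S ?v (schroedinger S a w ?v) = dot S (\<lambda>x. c * y x) (\<lambda>x. c * schroedinger S a w y x)"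
    using schroedinger_mult[of S a w c y] by (intro dot_cong) (auto simp: cong: schroedinger_cong)
  then show "dot S y (schroedinger S a w y) = dot S ?v (schroedinger S a w ?v) * dot S y y"
    using c by (simp add: dot_scale_left dot_scale_right ac_simps)
qed simp

lemma Rayleigh_maximizer:
  assumes T: "finite T" "card T < card S"
  obtains v where "dot S v v = 1" "\<And>i. i \<in> T \<Longrightarrow> dot S (u i) v = 0"
    "\<And>y. (\<And>i. i \<in> T \<Longrightarrow> dot S (u i) y = 0) \<Longrightarrow>
      dot S y (schroedinger S a w y) \<le> dot S v (schroedinger S a w v) * dot S y y"
proof -
  define Q where "Q v = dot S v (schroedinger S a w v)" for v
  define C where "C = {v. (\<forall>x. x \<notin> S \<longrightarrow> v x = 0) \<and> dot S v v = 1 \<and> (\<forall>i\<in>T. dot S (u i) v = 0)}"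
  have normalized: "\<exists>v\<in>C. Q y = Q v * dot S y y"
    if y: "\<And>i. i \<in> T \<Longrightarrow> dot S (u i) y = 0" "dot S y y \<noteq> 0" for y
  proof -
    obtain v where "\<And>x. x \<notin> S \<Longrightarrow> v x = 0" "dot S v v = 1" "\<And>i. i \<in> T \<Longrightarrow> dot S (u i) v = 0"
      "Q y = Q v * dot S y y" unfolding Q_def using obtain_normalized_orthogonal[where T = T and u = u, OF y] by metis
    then show ?thesis by (auto simp: C_def intro!: bexI[of _ v])
  qed
  have "compact C" unfolding C_def by (rule compact_unit_sphere_orthogonal)
  moreover have "C \<noteq> {}"
  proof -
    obtain c where "\<exists>i\<in>S. c i \<noteq> 0" "\<forall>t\<in>T. (\<Sum>i\<in>S. u t i * c i) = 0"
      using underdetermined_system_nontrivial_solution[OF T(1) fin T(2), of u] by blast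
    then show ?thesis using normalized[of c] by (auto simp: dot_self_eq_0_iff[OF fin] dot_def[of S "u _"])
  qed
  moreover have "continuous_on C Q"
    unfolding Q_def dot_def schroedinger_def
    by (auto intro!: continuous_intros continuous_on_subset[OF continuous_on_product_coordinates])
  ultimately obtain v where v: "v \<in> C" and max: "\<And>y. y \<in> C \<Longrightarrow> Q y \<le> Q v"
    using continuous_attains_sup by metis
  have "Q y \<le> Q v * dot S y y" if y: "\<And>i. i \<in> T \<Longrightarrow> dot S (u i) y = 0" for y
  proof (cases "dot S y y = 0")
    case True
    then have "Q y = 0" using fin by (simp add: Q_def dot_def[of S y "schroedinger S a w y"] dot_self_eq_0_iff)
    then show ?thesis using True by simp
  next
    case False
    then obtain v' where "v' \<in> C" "Q y = Q v' * dot S y y" using normalized[OF y] by blast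
    then show ?thesis using mult_right_mono[OF max dot_self_nonneg] by metis
  qed
  then show thesis using that[of v] v by (simp add: C_def Q_def)
qed

text \<open>A constrained maximizer of the Rayleigh quotient is a critical point, and as the constraints
  are eigenvectors the residual \<open>H v - \<lambda> v\<close> is itself an admissible direction.\<close>
lemma eigenvector_orthogonal_to_eigenvectors:
  assumes T: "finite T" "card T < card S"
    and eig: "\<And>i x. i \<in> T \<Longrightarrow> x \<in> S \<Longrightarrow> schroedinger S a w (u i) x = e i * u i x"
  obtains v l where "dot S v v = 1" "\<And>i. i \<in> T \<Longrightarrow> dot S (u i) v = 0"
    "\<And>x. x \<in> S \<Longrightarrow> schroedinger S a w v x = l * v x"
proof -
  let ?H = "schroedinger S a w"
  obtain v where v: "dot S v v = 1" "\<And>i. i \<in> T \<Longrightarrow> dot S (u i) v = 0"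
    and max: "\<And>y. (\<And>i. i \<in> T \<Longrightarrow> dot S (u i) y = 0) \<Longrightarrow> dot S y (?H y) \<le> dot S v (?H v) * dot S y y"
    using Rayleigh_maximizer[OF T, of u w] by metis
  define l where "l = dot S v (?H v)"
  define r where "r x = ?H v x - l * v x" for x
  have r_orth: "dot S (u i) r = 0" if i: "i \<in> T" for i
  proof -
    have "dot S (u i) (?H v) = dot S (\<lambda>x. e i * u i x) v"
      unfolding schroedinger_self_adjoint using eig[OF i] by (intro dot_cong) auto
    then show ?thesis
      using v(2)[OF i] by (simp add: r_def[abs_def] dot_diff_right dot_scale_right dot_scale_left)
  qed
  have Hv: "dot S r (?H v) = dot S r r + l * dot S r v"
    by (simp add: r_def[of _] dot_add_right[symmetric] dot_scale_right[symmetric])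
  have "2 * t * dot S r r + t * t * (dot S r (?H r) - l * dot S r r) \<le> 0" for t
  proof -
    let ?y = "\<lambda>x. v x + t * r x"
    have "dot S ?y (?H ?y) = l + 2 * t * dot S r (?H v) + t * t * dot S r (?H r)"
      unfolding l_def by (rule quadratic_form_add_scale)
    moreover have "dot S ?y ?y = 1 + 2 * t * dot S r v + t * t * dot S r r"
      using v(1) by (simp add: dot_add_left dot_add_right dot_scale_left dot_scale_right
          dot_commute[of S v r] algebra_simps)
    moreover have "dot S ?y (?H ?y) \<le> l * dot S ?y ?y"
      unfolding l_def using v(2) r_orth by (intro max) (simp add: dot_add_right dot_scale_right)
    ultimately show ?thesis by (simp add: Hv algebra_simps)
  qed
  then have "dot S r r = 0"
    using linear_coefficient_nonpos[of "dot S r r"] dot_self_nonneg[of S r] by (metis order.antisym)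
  then have "\<forall>x\<in>S. r x = 0" by (simp add: dot_self_eq_0_iff[OF fin])
  then show thesis using v by (intro that[of v l]) (auto simp: r_def)
qed

lemma orthonormal_eigenvectors:
  "m \<le> card S \<Longrightarrow> \<exists>u e. (\<forall>i<m. \<forall>j<m. dot S (u i) (u j) = of_bool (i = j)) \<and>
     (\<forall>i<m. \<forall>x\<in>S. schroedinger S a w (u i) x = e i * u i x)"
proof (induction m)
  case 0
  then show ?case by simp
next
  case (Suc m)
  then obtain u e where ue: "\<forall>i<m. \<forall>j<m. dot S (u i) (u j) = of_bool (i = j)"
     "\<forall>i<m. \<forall>x\<in>S. schroedinger S a w (u i) x = e i * u i x"
    using Suc_leD by blast
  obtain v l where v: "dot S v v = 1" "\<And>i. i \<in> {..<m} \<Longrightarrow> dot S (u i) v = 0"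
      "\<And>x. x \<in> S \<Longrightarrow> schroedinger S a w v x = l * v x"
    using eigenvector_orthogonal_to_eigenvectors[of "{..<m}" w u e] Suc.prems ue(2) by auto
  have "dot S v (u i) = 0" if "i < m" for i using v(2)[of i] that by (simp add: dot_commute)
  then show ?case
    using ue v by (intro exI[of _ "u(m := v)"] exI[of _ "e(m := l)"]) (auto simp: less_Suc_eq)
qed

end

lemma orthonormal_imp_complete:
  assumes S: "finite S" and orth: "\<And>i j. i < card S \<Longrightarrow> j < card S \<Longrightarrow> dot S (u i) (u j) = of_bool (i = j)"
    and xy: "x \<in> S" "y \<in> S"
  shows "(\<Sum>i<card S. u i x * u i y) = of_bool (x = y)"
proof -
  define N where "N = card S"
  obtain s where s: "bij_betw s {0..<N} S"
    using ex_bij_betw_nat_finite[OF S] by (auto simp: N_def)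
  define U where "U = mat N N (\<lambda>(i, k). u i (s k))"
  have U: "U \<in> carrier_mat N N" "transpose_mat U \<in> carrier_mat N N" by (auto simp: U_def)
  have "U * transpose_mat U = 1\<^sub>m N"
  proof (rule eq_matI)
    fix i j assume "i < dim_row (1\<^sub>m N)" "j < dim_col (1\<^sub>m N)"
    moreover have "(\<Sum>k=0..<N. u i (s k) * u j (s k)) = dot S (u i) (u j)"
      unfolding dot_def by (rule sum.reindex_bij_betw[OF s])
    ultimately show "(U * transpose_mat U) $$ (i, j) = 1\<^sub>m N $$ (i, j)"
      using orth by (simp add: U_def scalar_prod_def N_def)
  qed (use U in auto)
  then have UU: "transpose_mat U * U = 1\<^sub>m N"
    using mat_mult_left_right_inverse U by blast
  have "x \<in> s ` {0..<N}" "y \<in> s ` {0..<N}" using s xy by (simp_all add: bij_betw_def)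
  then obtain j k where jk: "j < N" "k < N" "x = s j" "y = s k" by auto
  then have "(\<Sum>i<N. u i x * u i y) = (transpose_mat U * U) $$ (j, k)"
    by (simp add: U_def scalar_prod_def atLeast0LessThan)
  also have "\<dots> = of_bool (x = y)"
    using jk s unfolding UU by (auto simp: bij_betw_def inj_on_eq_iff)
  finally show ?thesis by (simp add: N_def)
qed

definition eigensystem ::
    "'i set \<Rightarrow> ('i \<Rightarrow> 'i \<Rightarrow> real) \<Rightarrow> ('i \<Rightarrow> real) \<Rightarrow> (nat \<Rightarrow> 'i \<Rightarrow> real) \<Rightarrow> (nat \<Rightarrow> real) \<Rightarrow> bool" where
  "eigensystem S a w u e \<longleftrightarrow>
    (\<forall>i<card S. \<forall>j<card S. dot S (u i) (u j) = of_bool (i = j)) \<and>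
    (\<forall>i<card S. \<forall>x\<in>S. schroedinger S a w (u i) x = e i * u i x)"

lemma eigensystem_orthonormal:
  "eigensystem S a w u e \<Longrightarrow> i < card S \<Longrightarrow> j < card S \<Longrightarrow> dot S (u i) (u j) = of_bool (i = j)"
  by (simp add: eigensystem_def)

lemma eigensystem_eigenvector:
  "eigensystem S a w u e \<Longrightarrow> i < card S \<Longrightarrow> x \<in> S \<Longrightarrow> schroedinger S a w (u i) x = e i * u i x"
  by (simp add: eigensystem_def)

context symmetric_kernel
begin

theorem spectral_theorem: "\<exists>u e. eigensystem S a w u e"
  unfolding eigensystem_def using orthonormal_eigenvectors[of "card S" w] by simp

lemma eigensystem_complete:
  assumes "eigensystem S a w u e" "x \<in> S" "y \<in> S"
  shows "(\<Sum>i<card S. u i x * u i y) = of_bool (x = y)"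
  using eigensystem_orthonormal[OF assms(1)] assms(2,3) by (intro orthonormal_imp_complete fin)

lemma eigensystem_expansion:
  assumes ue: "eigensystem S a w u e" and x: "x \<in> S"
  shows "v x = (\<Sum>i<card S. dot S (u i) v * u i x)"
proof -
  have "(\<Sum>i<card S. dot S (u i) v * u i x) = (\<Sum>i<card S. \<Sum>y\<in>S. v y * (u i x * u i y))"
    unfolding dot_def sum_distrib_right by (intro sum.cong refl) (simp add: ac_simps)
  also have "\<dots> = (\<Sum>y\<in>S. v y * (\<Sum>i<card S. u i x * u i y))"
    unfolding sum_distrib_left by (rule sum.swap)
  also have "\<dots> = (\<Sum>y\<in>S. if y = x then v x else 0)"
    using eigensystem_complete[OF ue x] by (intro sum.cong refl) auto
  also have "\<dots> = v x" using fin x by simp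
  finally show ?thesis by simp
qed

lemma Parseval:
  assumes "eigensystem S a w u e"
  shows "(L2_norm S v)\<^sup>2 = (\<Sum>i<card S. (dot S (u i) v)\<^sup>2)"
proof -
  have "(L2_norm S v)\<^sup>2 = dot S v (\<lambda>x. \<Sum>i<card S. dot S (u i) v * u i x)"
    unfolding L2_norm_power2_dot using eigensystem_expansion[OF assms, of _ v] by (intro dot_cong) auto
  also have "\<dots> = (\<Sum>i<card S. (dot S (u i) v)\<^sup>2)"
    by (simp add: dot_sum_right dot_scale_right dot_commute[of S v] power2_eq_square)
  finally show ?thesis .
qed

lemma L2_norm_residual:
  assumes "eigensystem S a w u e"
  shows "(L2_norm S (\<lambda>x. schroedinger S a w v x - E * v x))\<^sup>2 = (\<Sum>i<card S. ((e i - E) * dot S (u i) v)\<^sup>2)"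
proof -
  have "dot S (u i) (\<lambda>x. schroedinger S a w v x - E * v x) = (e i - E) * dot S (u i) v" if "i < card S" for i
  proof -
    have "dot S (u i) (schroedinger S a w v) = dot S (\<lambda>x. e i * u i x) v"
      unfolding schroedinger_self_adjoint using eigensystem_eigenvector[OF assms that] by (intro dot_cong) auto
    then show ?thesis by (simp add: dot_diff_right dot_scale_left dot_scale_right algebra_simps)
  qed
  then show ?thesis by (simp add: Parseval[OF assms])
qed

lemma L2_norm_residual_le:
  assumes ue: "eigensystem S a w u e" and r: "r \<ge> 0"
    and v: "\<And>i. i < card S \<Longrightarrow> \<bar>e i - E\<bar> > r \<Longrightarrow> dot S (u i) v = 0"
  shows "L2_norm S (\<lambda>x. schroedinger S a w v x - E * v x) \<le> r * L2_norm S v"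
proof -
  have "(L2_norm S (\<lambda>x. schroedinger S a w v x - E * v x))\<^sup>2 \<le> (\<Sum>i<card S. r\<^sup>2 * (dot S (u i) v)\<^sup>2)"
    unfolding L2_norm_residual[OF ue]
  proof (rule sum_mono)
    fix i assume i: "i \<in> {..<card S}"
    show "((e i - E) * dot S (u i) v)\<^sup>2 \<le> r\<^sup>2 * (dot S (u i) v)\<^sup>2"
    proof (cases "\<bar>e i - E\<bar> \<le> r")
      case True
      then have "(e i - E)\<^sup>2 \<le> r\<^sup>2" using r by (simp add: abs_le_square_iff[symmetric])
      then show ?thesis by (simp add: power_mult_distrib mult_right_mono)
    qed (use v[of i] i in simp)
  qed
  also have "\<dots> = (r * L2_norm S v)\<^sup>2"
    by (simp add: Parseval[OF ue, of v] power_mult_distrib sum_distrib_left)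
  finally show ?thesis using r by (simp add: power2_le_iff_abs_le)
qed

lemma L2_norm_residual_gt:
  assumes ue: "eigensystem S a w u e" and r: "r \<ge> 0"
    and v: "\<And>i. i < card S \<Longrightarrow> \<bar>e i - E\<bar> \<le> r \<Longrightarrow> dot S (u i) v = 0" and nz: "\<exists>x\<in>S. v x \<noteq> 0"
  shows "L2_norm S (\<lambda>x. schroedinger S a w v x - E * v x) > r * L2_norm S v"
proof -
  have coefficient_le: "r\<^sup>2 * (dot S (u i) v)\<^sup>2 \<le> ((e i - E) * dot S (u i) v)\<^sup>2"
    and less: "dot S (u i) v \<noteq> 0 \<Longrightarrow> r\<^sup>2 * (dot S (u i) v)\<^sup>2 < ((e i - E) * dot S (u i) v)\<^sup>2"
    if i: "i < card S" for i
  proof -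
    show *: "r\<^sup>2 * (dot S (u i) v)\<^sup>2 < ((e i - E) * dot S (u i) v)\<^sup>2" if nz: "dot S (u i) v \<noteq> 0"
    proof -
      have "\<bar>r\<bar> < \<bar>e i - E\<bar>" using v[OF i] nz r by force
      then have "r\<^sup>2 < (e i - E)\<^sup>2" using power_strict_mono[of "\<bar>r\<bar>" "\<bar>e i - E\<bar>" 2] by simp
      then show ?thesis using nz by (simp add: power_mult_distrib mult_strict_right_mono)
    qed
    show "r\<^sup>2 * (dot S (u i) v)\<^sup>2 \<le> ((e i - E) * dot S (u i) v)\<^sup>2"
      by (cases "dot S (u i) v = 0") (use * in auto)
  qed
  have "\<exists>i<card S. dot S (u i) v \<noteq> 0"
  proof (rule ccontr)
    assume "\<not> ?thesis"
    then have "v x = 0" if "x \<in> S" for x using eigensystem_expansion[OF ue that, of v] by simp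
    then show False using nz by blast
  qed
  then have "(\<Sum>i<card S. r\<^sup>2 * (dot S (u i) v)\<^sup>2) < (\<Sum>i<card S. ((e i - E) * dot S (u i) v)\<^sup>2)"
    using coefficient_le less by (intro sum_strict_mono_ex1) auto
  then have "(r * L2_norm S v)\<^sup>2 < (L2_norm S (\<lambda>x. schroedinger S a w v x - E * v x))\<^sup>2"
    by (simp add: L2_norm_residual[OF ue] Parseval[OF ue, of v] power_mult_distrib sum_distrib_left)
  then show ?thesis by (rule power_less_imp_less_base) simp
qed

end

section \<open>Green functions\<close>

definition green ::
    "'i set \<Rightarrow> ('i \<Rightarrow> 'i \<Rightarrow> real) \<Rightarrow> ('i \<Rightarrow> real) \<Rightarrow> complex \<Rightarrow> 'i \<Rightarrow> 'i \<Rightarrow> complex" where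
  "green S a w z x = (SOME \<psi>. (\<forall>y\<in>S. schroedinger S a w \<psi> y - z * \<psi> y = (if y = x then 1 else 0)) \<and>
     (\<forall>y. y \<notin> S \<longrightarrow> \<psi> y = 0))"

context symmetric_kernel
begin

lemma Im_quadratic_form:
  "Im (\<Sum>x\<in>S. cnj (\<psi> x) * (schroedinger S a w \<psi> x - z * \<psi> x)) = - Im z * (L2_norm S \<psi>)\<^sup>2"
proof -
  define Q where "Q = (\<Sum>x\<in>S. \<Sum>y\<in>S. cnj (\<psi> x) * (of_real (a x y) * \<psi> y))"
  have "cnj Q = (\<Sum>x\<in>S. \<Sum>y\<in>S. cnj (\<psi> y) * (of_real (a y x) * \<psi> x))"
    unfolding Q_def using sym by (auto simp: ac_simps intro!: sum.cong)
  also have "\<dots> = Q" unfolding Q_def by (rule sum.swap)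
  finally have Q: "Im Q = 0" by (metis Reals_cnj_iff complex_is_Real_iff)
  have sq: "cnj u * (c * u) = c * of_real ((cmod u)\<^sup>2)" for u c
    unfolding complex_norm_square by (simp add: ac_simps)
  have "(\<Sum>x\<in>S. cnj (\<psi> x) * (schroedinger S a w \<psi> x - z * \<psi> x)) =
      Q + (\<Sum>x\<in>S. (of_real (w x) - z) * of_real ((cmod (\<psi> x))\<^sup>2))"
    unfolding Q_def schroedinger_def scaleR_conv_of_real
    by (simp add: ring_distribs sum.distrib sum_subtractf sum_distrib_left sq left_diff_distrib)
  then show ?thesis using Q by (simp add: L2_norm_power2 sum_distrib_left)
qed

lemma L2_norm_schroedinger_minus_ge:
  assumes "Im z > 0"
  shows "Im z * L2_norm S \<psi> \<le> L2_norm S (\<lambda>x. schroedinger S a w \<psi> x - z * \<psi> x)"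
proof -
  let ?p = "\<lambda>x. schroedinger S a w \<psi> x - z * \<psi> x"
  have "Im z * (L2_norm S \<psi>)\<^sup>2 \<le> cmod (\<Sum>x\<in>S. cnj (\<psi> x) * ?p x)"
    using abs_Im_le_cmod[of "\<Sum>x\<in>S. cnj (\<psi> x) * ?p x"] unfolding Im_quadratic_form by simp
  also have "\<dots> \<le> (\<Sum>x\<in>S. \<bar>cmod (\<psi> x)\<bar> * \<bar>cmod (?p x)\<bar>)"
    by (rule order.trans[OF norm_sum]) (simp add: norm_mult)
  also have "\<dots> \<le> L2_norm S \<psi> * L2_norm S ?p" unfolding L2_norm_def by (rule L2_set_mult_ineq)
  finally have "L2_norm S \<psi> * (Im z * L2_norm S \<psi>) \<le> L2_norm S \<psi> * L2_norm S ?p"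
    by (simp add: power2_eq_square ac_simps)
  then show ?thesis by (cases "L2_norm S \<psi> = 0") (auto simp: mult_le_cancel_left less_le)
qed

lemma eigensystem_resolvent:
  fixes u :: "nat \<Rightarrow> 'i \<Rightarrow> real"
  assumes ue: "eigensystem S a w u e" and z: "Im z > 0" and x: "x \<in> S" and y: "y \<in> S"
  defines "\<psi> \<equiv> \<lambda>y. \<Sum>i<card S. of_real (u i x * u i y) / (of_real (e i) - z)"
  shows "schroedinger S a w \<psi> y - z * \<psi> y = (if y = x then 1 else 0)"
proof -
  have nz: "of_real s - z \<noteq> 0" for s using z by (auto simp: complex_eq_iff)
  define c where "c i = of_real (u i x) / (of_real (e i) - z)" for i
  have Hu: "schroedinger S a w (\<lambda>y. of_real (u i y)) y = complex_of_real (e i * u i y)" if "i < card S" for i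
    unfolding schroedinger_of_real using eigensystem_eigenvector[OF ue that y] by simp
  have \<psi>: "\<psi> = (\<lambda>y. \<Sum>i<card S. c i * of_real (u i y))" by (simp add: \<psi>_def c_def)
  have "schroedinger S a w \<psi> y = (\<Sum>i<card S. c i * of_real (e i * u i y))"
    unfolding \<psi> schroedinger_sum schroedinger_mult using Hu by simp
  then have "schroedinger S a w \<psi> y - z * \<psi> y = (\<Sum>i<card S. c i * (of_real (e i) - z) * of_real (u i y))"
    by (simp add: \<psi> sum_distrib_left algebra_simps flip: sum_subtractf)
  also have "\<dots> = of_real (\<Sum>i<card S. u i x * u i y)" using nz by (simp add: c_def)
  also have "\<dots> = (if y = x then 1 else 0)" using eigensystem_complete[OF ue x y] by auto
  finally show ?thesis .
qed

lemma green_eq: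
  assumes z: "Im z > 0" and x: "x \<in> S"
  shows "y \<in> S \<Longrightarrow> schroedinger S a w (green S a w z x) y - z * green S a w z x y = (if y = x then 1 else 0)"
    and "y \<notin> S \<Longrightarrow> green S a w z x y = 0"
proof -
  obtain u e where ue: "eigensystem S a w u e" using spectral_theorem by blast
  define \<psi> where "\<psi> = (\<lambda>y. \<Sum>i<card S. complex_of_real (u i x * u i y) / (of_real (e i) - z))"
  have "schroedinger S a w \<psi> y - z * \<psi> y = (if y = x then 1 else 0)" if "y \<in> S" for y
    unfolding \<psi>_def by (rule eigensystem_resolvent[OF ue z x that])
  moreover have "schroedinger S a w (\<lambda>y. if y \<in> S then \<psi> y else 0) y = schroedinger S a w \<psi> y" if "y \<in> S" for y
    using that by (intro schroedinger_cong) auto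
  ultimately have "\<exists>\<psi>. (\<forall>y\<in>S. schroedinger S a w \<psi> y - z * \<psi> y = (if y = x then 1 else 0)) \<and> (\<forall>y. y \<notin> S \<longrightarrow> \<psi> y = 0)"
    by (intro exI[of _ "\<lambda>y. if y \<in> S then \<psi> y else 0"]) auto
  from someI_ex[OF this, folded green_def]
  show "y \<in> S \<Longrightarrow> schroedinger S a w (green S a w z x) y - z * green S a w z x y = (if y = x then 1 else 0)"
    and "y \<notin> S \<Longrightarrow> green S a w z x y = 0" by auto
qed

lemma green_stability:
  assumes "Im z > 0" "x \<in> S"
    and perturbed_eq: "\<And>y. y \<in> S \<Longrightarrow> schroedinger S a w \<psi> y - z * \<psi> y = (if y = x then 1 else 0) + r y"
  shows "L2_norm S (\<lambda>y. \<psi> y - green S a w z x y) \<le> L2_norm S r / Im z"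
proof -
  let ?d = "\<lambda>y. \<psi> y - green S a w z x y"
  have "Im z * L2_norm S ?d \<le> L2_norm S (\<lambda>y. schroedinger S a w ?d y - z * ?d y)"
    by (rule L2_norm_schroedinger_minus_ge) fact
  also have "\<dots> = L2_norm S r"
  proof (rule L2_norm_cong)
    fix y assume y: "y \<in> S"
    have "schroedinger S a w ?d y - z * ?d y = r y"
      using perturbed_eq[OF y] green_eq(1)[OF assms(1,2) y, of w] by (simp add: schroedinger_diff algebra_simps)
    then show "cmod (schroedinger S a w ?d y - z * ?d y) = cmod (r y)" by simp
  qed
  finally show ?thesis using assms(1) by (simp add: field_simps)
qed

lemma green_unique:
  assumes "Im z > 0" "x \<in> S" "y \<in> S"
    and "\<And>y. y \<in> S \<Longrightarrow> schroedinger S a w \<psi> y - z * \<psi> y = (if y = x then 1 else 0)"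
  shows "green S a w z x y = \<psi> y"
proof -
  have "L2_norm S (\<lambda>y. \<psi> y - green S a w z x y) \<le> L2_norm S (\<lambda>_. 0 :: complex) / Im z"
    using assms by (intro green_stability) auto
  then have "L2_norm S (\<lambda>y. \<psi> y - green S a w z x y) \<le> 0" by simp
  from L2_norm_le_0_imp_eq_0[OF fin this assms(3)] show ?thesis by simp
qed

lemma green_eigensystem:
  assumes "eigensystem S a w u e" "Im z > 0" "x \<in> S" "y \<in> S"
  shows "green S a w z x y = (\<Sum>i<card S. of_real (u i x * u i y) / (of_real (e i) - z))"
  using assms by (intro green_unique eigensystem_resolvent) auto

lemma L2_norm_green_le:
  assumes "Im z > 0" "x \<in> S"
  shows "L2_norm S (green S a w z x) \<le> 1 / Im z"
proof -
  have "Im z * L2_norm S (green S a w z x) \<le>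
      L2_norm S (\<lambda>y. schroedinger S a w (green S a w z x) y - z * green S a w z x y)"
    by (rule L2_norm_schroedinger_minus_ge) fact
  also have "\<dots> = L2_norm S (\<lambda>y. if y = x then 1 else 0 :: complex)"
    using green_eq(1)[OF assms] by (intro L2_norm_cong) auto
  also have "\<dots> = 1" using L2_norm_delta[OF fin assms(2), of "1 :: complex"] by simp
  finally show ?thesis using assms(1) by (simp add: field_simps)
qed

lemma norm_green_le:
  assumes "Im z > 0" "x \<in> S"
  shows "cmod (green S a w z x y) \<le> 1 / Im z"
proof (cases "y \<in> S")
  case True
  then show ?thesis using norm_le_L2_norm[OF fin True] L2_norm_green_le[OF assms] order.trans by blast
next
  case False
  then show ?thesis using green_eq(2)[OF assms False] assms by simp
qed

lemma green_lipschitz: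
  assumes z: "Im z > 0" and x: "x \<in> S" and y: "y \<in> S" and d: "\<And>v. v \<in> S \<Longrightarrow> \<bar>w v - w' v\<bar> \<le> d"
  shows "cmod (green S a w z x y - green S a w' z x y) \<le> d / (Im z)\<^sup>2"
proof -
  let ?g = "green S a w z x"
  have d0: "d \<ge> 0" using d[OF x] by linarith
  have "L2_norm S (\<lambda>y. ?g y - green S a w' z x y) \<le> L2_norm S (\<lambda>y. (w' y - w y) *\<^sub>R ?g y) / Im z"
  proof (rule green_stability[OF z x])
    fix v assume v: "v \<in> S"
    show "schroedinger S a w' ?g v - z * ?g v = (if v = x then 1 else 0) + (w' v - w v) *\<^sub>R ?g v"
      using green_eq(1)[OF z x v, of w] by (simp add: schroedinger_def algebra_simps)
  qed
  also have "\<dots> \<le> (d * L2_norm S ?g) / Im z"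
    using d z d0 by (intro divide_right_mono L2_norm_le_cmult)
      (auto simp: abs_minus_commute intro!: mult_right_mono)
  also have "\<dots> \<le> (d * (1 / Im z)) / Im z"
    using z d0 L2_norm_green_le[OF z x] by (intro divide_right_mono mult_left_mono) auto
  finally show ?thesis using norm_le_L2_norm[OF fin y, of "\<lambda>y. ?g y - green S a w' z x y"]
    by (simp add: power2_eq_square)
qed

lemma continuous_on_green:
  assumes z: "Im z > 0" and x: "x \<in> S" and y: "y \<in> S"
  shows "continuous_on UNIV (\<lambda>w. green S a w z x y)"
  unfolding continuous_on_def
proof
  fix w :: "'i \<Rightarrow> real"
  define g where "g = (\<lambda>w'. (\<Sum>v\<in>S. \<bar>w' v - w v\<bar>) / (Im z)\<^sup>2)"
  have coord: "((\<lambda>w'. w' v) \<longlongrightarrow> w v) (at w within UNIV)" for v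
    using continuous_on_product_coordinates[of v] unfolding continuous_on_def by blast
  have "(g \<longlongrightarrow> (\<Sum>v\<in>S. \<bar>w v - w v\<bar>) / (Im z)\<^sup>2) (at w within UNIV)"
    unfolding g_def using z by (intro tendsto_intros coord) auto
  then have g_null: "(g \<longlongrightarrow> 0) (at w within UNIV)" by simp
  have "norm (green S a w' z x y - green S a w z x y) \<le> g w'" for w'
    unfolding g_def
  proof (rule green_lipschitz[OF z x y])
    fix v assume "v \<in> S"
    then show "\<bar>w' v - w v\<bar> \<le> (\<Sum>v\<in>S. \<bar>w' v - w v\<bar>)" using fin by (intro member_le_sum) auto
  qed
  then have "((\<lambda>w'. green S a w' z x y - green S a w z x y) \<longlongrightarrow> 0) (at w within UNIV)"
    by (intro Lim_null_comparison[OF _ g_null] always_eventually) auto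
  then show "((\<lambda>w. green S a w z x y) \<longlongrightarrow> green S a w z x y) (at w within UNIV)"
    by (simp add: LIM_zero_iff)
qed

lemma Im_green_pos:
  assumes z: "Im z > 0" and x: "x \<in> S"
  shows "Im (green S a w z x x) > 0"
proof -
  let ?g = "green S a w z x"
  have "(\<Sum>y\<in>S. cnj (?g y) * (schroedinger S a w ?g y - z * ?g y)) = (\<Sum>y\<in>S. if y = x then cnj (?g x) else 0)"
    using green_eq(1)[OF z x] by (intro sum.cong) auto
  also have "\<dots> = cnj (?g x)" using fin x by simp
  finally have Im_green_eq: "Im (?g x) = Im z * (L2_norm S ?g)\<^sup>2" using Im_quadratic_form[of ?g w z] by simp
  have "L2_norm S ?g \<noteq> 0"
  proof
    assume "L2_norm S ?g = 0"
    then have "?g v = 0" if "v \<in> S" for v using L2_norm_le_0_imp_eq_0[OF fin _ that, of ?g] by simp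
    then have "schroedinger S a w ?g x - z * ?g x = 0" using x by (simp add: schroedinger_def)
    then show False using green_eq(1)[OF z x x, of w] by simp
  qed
  then show ?thesis using Im_green_eq z by simp
qed

text \<open>As \<open>(H + v \<delta>\<^sub>x - z) g = \<delta>\<^sub>x\<close> means \<open>(H - z) g = (1 - v g\<^sub>x) \<delta>\<^sub>x\<close>, the two Green functions are proportional.\<close>
lemma green_rank_one:
  assumes z: "Im z > 0" and x: "x \<in> S"
  shows "green S a (w(x := v)) z x x = 1 / (of_real v + 1 / green S a (w(x := 0)) z x x)"
proof -
  let ?g = "green S a (w(x := v)) z x" and ?h = "green S a (w(x := 0)) z x"
  have g_nonzero: "?g x \<noteq> 0" using Im_green_pos[OF z x, of "w(x := v)"] by (metis less_irrefl zero_complex.sel(2))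
  define c where "c = 1 - of_real v * ?g x"
  have rank_one_eq: "schroedinger S a (w(x := 0)) ?g y - z * ?g y = (if y = x then c else 0)" if "y \<in> S" for y
    using green_eq(1)[OF z x that, of "w(x := v)"]
    by (auto simp: schroedinger_def c_def scaleR_conv_of_real algebra_simps)
  have "c \<noteq> 0"
  proof
    assume "c = 0"
    then have "Im z * L2_norm S ?g \<le> L2_norm S (\<lambda>_. 0 :: complex)"
      using L2_norm_schroedinger_minus_ge[OF z, of ?g "w(x := 0)"] rank_one_eq
      by (metis (no_types, lifting) L2_norm_cong)
    then have "L2_norm S ?g \<le> 0" using z by (simp add: mult_le_0_iff)
    then show False using L2_norm_le_0_imp_eq_0[OF fin _ x] g_nonzero by blast
  qed
  have "?h x = 1 / c * ?g x"
  proof (rule green_unique[OF z x x, where \<psi> = "\<lambda>y. 1 / c * ?g y"])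
    fix y assume y: "y \<in> S"
    have "schroedinger S a (w(x := 0)) (\<lambda>y. 1 / c * ?g y) y - z * (1 / c * ?g y) =
        1 / c * (schroedinger S a (w(x := 0)) ?g y - z * ?g y)"
      unfolding schroedinger_mult by (simp add: algebra_simps)
    then show "schroedinger S a (w(x := 0)) (\<lambda>y. 1 / c * ?g y) y - z * (1 / c * ?g y) = (if y = x then 1 else 0)"
      unfolding rank_one_eq[OF y] using \<open>c \<noteq> 0\<close> by simp
  qed
  then have "?g x / ?h x = c" using g_nonzero \<open>c \<noteq> 0\<close> by simp
  then have "?g x * (of_real v + 1 / ?h x) = 1" by (simp add: c_def algebra_simps)
  then show ?thesis
    by (metis mult_zero_right nonzero_eq_divide_eq zero_neq_one)
qed

end

lemma green_equivariant:
  assumes S: "symmetric_kernel S a'" and T: "symmetric_kernel T a" and f: "bij_betw f T S"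
    and ker: "\<And>x y. x \<in> T \<Longrightarrow> y \<in> T \<Longrightarrow> a' (f x) (f y) = a x y"
    and z: "Im z > 0" and xy: "x \<in> T" "y \<in> T"
  shows "green S a' w z (f x) (f y) = green T a (\<lambda>i. w (f i)) z x y"
proof -
  interpret S: symmetric_kernel S a' by fact
  interpret T: symmetric_kernel T a by fact
  let ?g = "green S a' w z (f x)"
  have "green T a (\<lambda>i. w (f i)) z x y = ?g (f y)"
  proof (rule T.green_unique[OF z xy])
    fix v assume v: "v \<in> T"
    have "(\<Sum>u\<in>S. a' (f v) u *\<^sub>R ?g u) = (\<Sum>u\<in>T. a' (f v) (f u) *\<^sub>R ?g (f u))"
      by (rule sum.reindex_bij_betw[OF f, symmetric])
    also have "\<dots> = (\<Sum>u\<in>T. a v u *\<^sub>R ?g (f u))" using ker v by (intro sum.cong) auto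
    finally have "schroedinger T a (\<lambda>i. w (f i)) (\<lambda>u. ?g (f u)) v = schroedinger S a' w ?g (f v)"
      by (simp add: schroedinger_def)
    moreover have "f x \<in> S" "f v \<in> S" "f v = f x \<longleftrightarrow> v = x"
      using f v xy by (auto simp: bij_betw_def inj_on_eq_iff)
    ultimately show "schroedinger T a (\<lambda>i. w (f i)) (\<lambda>u. ?g (f u)) v - z * ?g (f v) = (if v = x then 1 else 0)"
      using S.green_eq(1)[OF z, of "f x" "f v" w] by simp
  qed
  then show ?thesis by simp
qed

section \<open>Eigenvalue counts\<close>

definition schroedinger_mat :: "nat \<Rightarrow> (nat \<Rightarrow> nat \<Rightarrow> real) \<Rightarrow> (nat \<Rightarrow> real) \<Rightarrow> real mat" where
  "schroedinger_mat N a w = mat N N (\<lambda>(i, j). a i j + (if i = j then w i else 0))"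

lemma schroedinger_mat_carrier [simp]: "schroedinger_mat N a w \<in> carrier_mat N N"
  and schroedinger_mat_dim [simp]: "dim_row (schroedinger_mat N a w) = N" "dim_col (schroedinger_mat N a w) = N"
  by (simp_all add: schroedinger_mat_def)

lemma char_poly_schroedinger_mat_nonzero: "char_poly (schroedinger_mat N a w) \<noteq> 0"
  using degree_monic_char_poly[OF schroedinger_mat_carrier[of N a w]] by auto

lemma schroedinger_mat_mult_vec:
  fixes N x :: nat
  assumes "x < N"
  shows "(\<Sum>y<N. (a x y + (if x = y then w x else 0)) * v y) = schroedinger {..<N} a w v x"
proof -
  have "(\<Sum>y<N. (a x y + (if x = y then w x else 0)) * v y) =
      (\<Sum>y<N. a x y * v y) + (\<Sum>y<N. if x = y then w x * v x else 0)"
    unfolding sum.distrib[symmetric] by (intro sum.cong) (auto simp: algebra_simps)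
  then show ?thesis using assms by (simp add: schroedinger_def)
qed

definition eig_count :: "nat \<Rightarrow> (nat \<Rightarrow> nat \<Rightarrow> real) \<Rightarrow> (nat \<Rightarrow> real) \<Rightarrow> real set \<Rightarrow> nat" where
  "eig_count N a w A = size (filter_mset (\<lambda>t. t \<in> A) (proots (char_poly (schroedinger_mat N a w))))"

lemma eig_count_empty [simp]: "eig_count N a w {} = 0"
  by (simp add: eig_count_def)

lemma eig_count_mono:
  assumes "A \<subseteq> B"
  shows "eig_count N a w A \<le> eig_count N a w B"
proof -
  have "size {#t \<in># m. t \<in> A#} \<le> size {#t \<in># m. t \<in> B#}" for m
    using assms by (induction m) (auto intro: le_SucI)
  then show ?thesis by (simp add: eig_count_def)
qed

lemma eig_count_Un:
  assumes "A \<inter> B = {}"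
  shows "eig_count N a w (A \<union> B) = eig_count N a w A + eig_count N a w B"
proof -
  have "size {#t \<in># m. t \<in> A \<union> B#} = size {#t \<in># m. t \<in> A#} + size {#t \<in># m. t \<in> B#}" for m
    using assms by (induction m) auto
  then show ?thesis by (simp add: eig_count_def)
qed

lemma eig_count_UN:
  assumes "finite T" "disjoint_family_on A T"
  shows "eig_count N a w (\<Union>s\<in>T. A s) = (\<Sum>s\<in>T. eig_count N a w (A s))"
  using assms
proof (induction T rule: finite_induct)
  case (insert t T)
  then have "A t \<inter> A s = {}" if "s \<in> T" for s
    using that by (intro disjoint_family_onD[OF insert.prems]) auto
  then have "A t \<inter> (\<Union>s\<in>T. A s) = {}" by blast
  then show ?case
    using insert disjoint_family_on_mono[OF subset_insertI insert.prems] by (simp add: eig_count_Un)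
qed simp

lemma eig_count_cong:
  assumes "\<And>i j. i < N \<Longrightarrow> j < N \<Longrightarrow> a i j = a' i j" "\<And>i. i < N \<Longrightarrow> w i = w' i"
  shows "eig_count N a w A = eig_count N a' w' A"
proof -
  have "schroedinger_mat N a w = schroedinger_mat N a' w'"
    unfolding schroedinger_mat_def using assms by (intro eq_matI) auto
  then show ?thesis by (simp add: eig_count_def)
qed

lemma char_poly_schroedinger_mat_block:
  assumes "\<And>i j. i < P \<Longrightarrow> P \<le> j \<Longrightarrow> j < P + L \<Longrightarrow> a i j = 0 \<and> a j i = 0"
  shows "char_poly (schroedinger_mat (P + L) a w) =
    char_poly (schroedinger_mat P a w) *
    char_poly (schroedinger_mat L (\<lambda>i j. a (P + i) (P + j)) (\<lambda>i. w (P + i)))"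
proof -
  let ?A = "char_poly_matrix (schroedinger_mat P a w)"
  let ?D = "char_poly_matrix (schroedinger_mat L (\<lambda>i j. a (P + i) (P + j)) (\<lambda>i. w (P + i)))"
  let ?B = "four_block_mat ?A (0\<^sub>m P L) (0\<^sub>m L P) ?D"
  have A: "?A \<in> carrier_mat P P" and D: "?D \<in> carrier_mat L L" by simp_all
  have "char_poly_matrix (schroedinger_mat (P + L) a w) = ?B"
  proof (rule eq_matI)
    fix i j assume "i < dim_row ?B" "j < dim_col ?B"
    then have ij: "i < P + L" "j < P + L" using A D by auto
    have "a i j = 0" if "i < P \<longleftrightarrow> \<not> j < P" using that assms[of i j] assms[of j i] ij by auto
    then show "char_poly_matrix (schroedinger_mat (P + L) a w) $$ (i, j) = ?B $$ (i, j)"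
      using ij A D by (auto simp: char_poly_matrix_def schroedinger_mat_def)
  qed (use A D in \<open>auto simp: char_poly_matrix_def\<close>)
  then show ?thesis unfolding char_poly_def
    using det_four_block_mat_lower_left_zero[OF A _ refl D, of "0\<^sub>m P L"] by simp
qed

lemma eig_count_block:
  assumes "\<And>i j. i < P \<Longrightarrow> P \<le> j \<Longrightarrow> j < P + L \<Longrightarrow> a i j = 0 \<and> a j i = 0"
  shows "eig_count (P + L) a w A =
    eig_count P a w A + eig_count L (\<lambda>i j. a (P + i) (P + j)) (\<lambda>i. w (P + i)) A"
proof -
  have char_poly_split: "char_poly (schroedinger_mat (P + L) a w) = char_poly (schroedinger_mat P a w) *
      char_poly (schroedinger_mat L (\<lambda>i j. a (P + i) (P + j)) (\<lambda>i. w (P + i)))"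
    by (rule char_poly_schroedinger_mat_block) (use assms in blast)
  show ?thesis unfolding eig_count_def char_poly_split by (simp add: proots_mult char_poly_schroedinger_mat_nonzero)
qed

lemma obtain_orthogonal_to_families:
  fixes u u' :: "nat \<Rightarrow> nat \<Rightarrow> real"
  assumes J: "J \<subseteq> {..<N}" "finite J'" "finite C" and card: "card J' + card C < card J"
  obtains v where "\<exists>x<N. v x \<noteq> 0" "\<And>i. i < N \<Longrightarrow> i \<notin> J \<Longrightarrow> dot {..<N} (u i) v = 0"
    "\<And>i. i \<in> J' \<Longrightarrow> dot {..<N} (u' i) v = 0" "\<And>g. g \<in> C \<Longrightarrow> dot {..<N} g v = 0"
proof -
  define T where "T = (u ` ({..<N} - J) \<union> u' ` J') \<union> C"
  have fin: "finite J" using J(1) finite_subset by auto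
  have "card T \<le> (N - card J) + card J' + card C"
    using card_image_le[of "{..<N} - J" u] card_image_le[OF J(2), of u'] card_Diff_subset[OF fin J(1)]
      card_Un_le[of "u ` ({..<N} - J)" "u' ` J'"] card_Un_le[of "u ` ({..<N} - J) \<union> u' ` J'" C]
    unfolding T_def by simp
  moreover have "card J \<le> N" using card_mono[OF _ J(1)] by simp
  ultimately have "card T < card {..<N}" using card by simp
  moreover have "finite T" using J by (simp add: T_def)
  ultimately obtain v where "\<exists>x\<in>{..<N}. v x \<noteq> 0" "\<forall>g\<in>T. (\<Sum>x<N. g x * v x) = 0"
    using underdetermined_system_nontrivial_solution[of T "{..<N}" "\<lambda>g. g"] by blast
  then show thesis by (intro that[of v]) (auto simp: T_def dot_def)
qed

locale matrix_kernel = symmetric_kernel "{..<N}" a for N :: nat and a :: "nat \<Rightarrow> nat \<Rightarrow> real"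
begin

lemma similar_mat_eigensystem:
  assumes ue: "eigensystem {..<N} a w u e"
  shows "similar_mat (schroedinger_mat N a w) (mat N N (\<lambda>(i, j). if i = j then e i else 0))"
proof -
  define U where "U = mat N N (\<lambda>(i, x). u i x)"
  define D where "D = mat N N (\<lambda>(i, j). if i = j then e i else 0)"
  have U: "U \<in> carrier_mat N N" "transpose_mat U \<in> carrier_mat N N" by (auto simp: U_def)
  have D: "D \<in> carrier_mat N N" by (auto simp: D_def)
  have UU: "U * transpose_mat U = 1\<^sub>m N"
    using eigensystem_orthonormal[OF ue]
    by (intro eq_matI) (auto simp: U_def scalar_prod_def dot_def atLeast0LessThan)
  then have UU': "transpose_mat U * U = 1\<^sub>m N" using mat_mult_left_right_inverse U by blast
  have AU: "schroedinger_mat N a w * transpose_mat U = transpose_mat U * D"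
  proof (rule eq_matI)
    fix x i assume "x < dim_row (transpose_mat U * D)" "i < dim_col (transpose_mat U * D)"
    then have xi: "x < N" "i < N" using U D by auto
    have "(schroedinger_mat N a w * transpose_mat U) $$ (x, i) = schroedinger {..<N} a w (u i) x"
      using xi by (simp add: schroedinger_mat_def U_def scalar_prod_def atLeast0LessThan
          schroedinger_mat_mult_vec[symmetric])
    also have "\<dots> = (\<Sum>j<N. if j = i then u j x * e i else 0)"
      using eigensystem_eigenvector[OF ue] xi by simp
    also have "\<dots> = (\<Sum>j<N. u j x * (if j = i then e j else 0))" by (intro sum.cong) auto
    also have "\<dots> = (transpose_mat U * D) $$ (x, i)"
      using xi by (simp add: D_def U_def scalar_prod_def atLeast0LessThan)
    finally show "(schroedinger_mat N a w * transpose_mat U) $$ (x, i) = (transpose_mat U * D) $$ (x, i)" .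
  qed (use U D in auto)
  have "schroedinger_mat N a w = schroedinger_mat N a w * (transpose_mat U * U)" unfolding UU' by simp
  also have "\<dots> = transpose_mat U * D * U"
    using assoc_mult_mat[OF schroedinger_mat_carrier U(2) U(1)] AU by metis
  finally have "similar_mat_wit (schroedinger_mat N a w) D (transpose_mat U) U"
    using U D UU UU' by (intro similar_mat_witI) auto
  then show ?thesis unfolding D_def by (auto simp: similar_mat_def)
qed

lemma char_poly_eigensystem:
  assumes "eigensystem {..<N} a w u e"
  shows "char_poly (schroedinger_mat N a w) = (\<Prod>i<N. [:- e i, 1:])"
proof -
  let ?D = "mat N N (\<lambda>(i, j). if i = j then e i else 0)"
  have "char_poly (schroedinger_mat N a w) = char_poly ?D"
    by (rule char_poly_similar[OF similar_mat_eigensystem[OF assms]])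
  also have "\<dots> = (\<Prod>a\<leftarrow>diag_mat ?D. [:- a, 1:])"
    by (rule char_poly_upper_triangular[of _ N]) auto
  also have "diag_mat ?D = map e [0..<N]" by (auto simp: diag_mat_def)
  also have "(\<Prod>a\<leftarrow>map e [0..<N]. [:- a, 1:]) = (\<Prod>i<N. [:- e i, 1:])"
    by (simp add: prod.distinct_set_conv_list[symmetric] comp_def atLeast0LessThan)
  finally show ?thesis .
qed

lemma eig_count_eigensystem:
  assumes "eigensystem {..<N} a w u e"
  shows "eig_count N a w A = card {i. i < N \<and> e i \<in> A}"
proof -
  have "proots (char_poly (schroedinger_mat N a w)) = (\<Sum>i<N. {#e i#})"
    unfolding char_poly_eigensystem[OF assms] by (simp add: proots_prod)
  also have "\<dots> = image_mset e (mset_set {..<N})"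
    by (induction N) (simp_all add: lessThan_Suc)
  finally have "eig_count N a w A = card {i \<in> {..<N}. e i \<in> A}"
    unfolding eig_count_def by (simp add: filter_mset_image_mset)
  then show ?thesis by simp
qed

lemma eig_count_le: "eig_count N a w A \<le> N"
proof -
  obtain u e where "eigensystem {..<N} a w u e" using spectral_theorem by blast
  then have "eig_count N a w A \<le> card {..<N}"
    unfolding eig_count_eigensystem[OF \<open>eigensystem {..<N} a w u e\<close>] by (intro card_mono) auto
  then show ?thesis by simp
qed

text \<open>If the claim failed, dimension counting would give a nonzero vector in the spectral subspace of
  the first operator that satisfies the constraints and is orthogonal to that of the second one.\<close>
lemma eig_count_compare:
  fixes C :: "(nat \<Rightarrow> real) set"
  assumes a': "matrix_kernel N a'" and C: "finite C" and d: "d \<ge> 0"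
    and close: "\<And>v. (\<forall>g\<in>C. dot {..<N} g v = 0) \<Longrightarrow>
      L2_norm {..<N} (\<lambda>x. schroedinger {..<N} a' w' v x - schroedinger {..<N} a w v x) \<le> d * L2_norm {..<N} v"
  shows "eig_count N a w {p..q} \<le> eig_count N a' w' {p - d..q + d} + card C"
proof (cases "p \<le> q", rule ccontr)
  let ?S = "{..<N}" and ?H = "schroedinger {..<N} a w" and ?H' = "schroedinger {..<N} a' w'"
  interpret K': matrix_kernel N a' by (fact a')
  assume pq: "p \<le> q"
  define E where "E = (p + q) / 2"
  define r where "r = (q - p) / 2"
  have r: "r \<ge> 0" using pq by (simp add: r_def)
  have Icc_iff: "t \<in> {p..q} \<longleftrightarrow> \<bar>t - E\<bar> \<le> r" "t \<in> {p - d..q + d} \<longleftrightarrow> \<bar>t - E\<bar> \<le> r + d" for t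
    by (auto simp: E_def r_def abs_le_iff field_simps)
  obtain u e where ue: "eigensystem ?S a w u e" using spectral_theorem by blast
  obtain u' e' where ue': "eigensystem ?S a' w' u' e'" using K'.spectral_theorem by blast
  define J where "J = {i. i < N \<and> \<bar>e i - E\<bar> \<le> r}"
  define J' where "J' = {i. i < N \<and> \<bar>e' i - E\<bar> \<le> r + d}"
  have J: "J \<subseteq> ?S" "finite J'" by (auto simp: J_def J'_def)
  assume "\<not> eig_count N a w {p..q} \<le> eig_count N a' w' {p - d..q + d} + card C"
  then have "card J' + card C < card J"
    unfolding eig_count_eigensystem[OF ue] K'.eig_count_eigensystem[OF ue'] Icc_iff J_def J'_def by simp
  then obtain v where nz: "\<exists>x<N. v x \<noteq> 0"
    and v: "\<And>i. i < N \<Longrightarrow> i \<notin> J \<Longrightarrow> dot ?S (u i) v = 0" "\<And>i. i \<in> J' \<Longrightarrow> dot ?S (u' i) v = 0"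
      "\<And>g. g \<in> C \<Longrightarrow> dot ?S g v = 0"
    using obtain_orthogonal_to_families[OF J C, of u u'] by metis
  have "(r + d) * L2_norm ?S v < L2_norm ?S (\<lambda>x. ?H' v x - E * v x)"
    using r d nz by (intro K'.L2_norm_residual_gt[OF ue'] v(2)) (auto simp: J'_def)
  also have "\<dots> = L2_norm ?S (\<lambda>x. (?H v x - E * v x) + (?H' v x - ?H v x))"
    by (intro L2_norm_cong) auto
  also have "\<dots> \<le> L2_norm ?S (\<lambda>x. ?H v x - E * v x) + L2_norm ?S (\<lambda>x. ?H' v x - ?H v x)"
    by (rule L2_norm_triangle)
  also have "\<dots> \<le> r * L2_norm ?S v + d * L2_norm ?S v"
    using r v by (intro add_mono L2_norm_residual_le[OF ue] close) (auto simp: J_def)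
  finally show False by (simp add: algebra_simps)
qed simp

lemma eig_count_Weyl:
  assumes a': "matrix_kernel N a'" and d: "d \<ge> 0"
    and row: "\<And>x. x < N \<Longrightarrow> (\<Sum>y<N. \<bar>a' x y - a x y\<bar>) + \<bar>w' x - w x\<bar> \<le> d"
  shows "eig_count N a w {p..q} \<le> eig_count N a' w' {p - d..q + d}"
proof -
  interpret K': matrix_kernel N a' by (fact a')
  define b where "b x y = a' x y - a x y + (if y = x then w' x - w x else 0)" for x y
  have "L2_norm {..<N} (\<lambda>x. schroedinger {..<N} a' w' v x - schroedinger {..<N} a w v x) \<le> d * L2_norm {..<N} v"
    for v :: "nat \<Rightarrow> real"
  proof -
    have "schroedinger {..<N} a' w' v x - schroedinger {..<N} a w v x = (\<Sum>y<N. b x y *\<^sub>R v y)" if "x < N" for x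
    proof -
      have "(\<Sum>y<N. b x y *\<^sub>R v y) = (\<Sum>y<N. (a' x y - a x y) * v y) + (\<Sum>y<N. if y = x then (w' x - w x) * v x else 0)"
        unfolding sum.distrib[symmetric] by (intro sum.cong) (auto simp: b_def algebra_simps)
      then show ?thesis using that by (simp add: schroedinger_def algebra_simps sum_subtractf)
    qed
    then have "L2_norm {..<N} (\<lambda>x. schroedinger {..<N} a' w' v x - schroedinger {..<N} a w v x) =
        L2_norm {..<N} (\<lambda>x. \<Sum>y<N. b x y *\<^sub>R v y)"
      by (intro L2_norm_cong) auto
    also have "\<dots> \<le> d * L2_norm {..<N} v"
    proof (rule Schur_test)
      show "b x y = b y x" if "x \<in> {..<N}" "y \<in> {..<N}" for x y
        using sym[OF that] K'.sym[OF that] by (auto simp: b_def)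
      show "(\<Sum>y<N. \<bar>b x y\<bar>) \<le> d" if "x \<in> {..<N}" for x
      proof -
        have "(\<Sum>y<N. \<bar>b x y\<bar>) \<le> (\<Sum>y<N. \<bar>a' x y - a x y\<bar> + (if y = x then \<bar>w' x - w x\<bar> else 0))"
          by (intro sum_mono) (auto simp: b_def)
        also have "\<dots> = (\<Sum>y<N. \<bar>a' x y - a x y\<bar>) + \<bar>w' x - w x\<bar>"
          using that by (simp add: sum.distrib)
        also have "\<dots> \<le> d" using row that by simp
        finally show ?thesis .
      qed
    qed (rule d)
    finally show ?thesis .
  qed
  then show ?thesis using eig_count_compare[OF a' finite.emptyI d, of w' w p q] by simp
qed

lemma eig_count_rank_one: "eig_count N a w {p..q} \<le> eig_count N a (w(k := t)) {p..q} + 1"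
proof -
  define g where "g = (\<lambda>x. if x = k then 1 else 0 :: real)"
  have "eig_count N a w {p..q} \<le> eig_count N a (w(k := t)) {p - 0..q + 0} + card {g}"
  proof (rule eig_count_compare)
    fix v :: "nat \<Rightarrow> real"
    assume "\<forall>g\<in>{g}. dot {..<N} g v = 0"
    then have "v k = 0" if "k < N" using that dot_delta[of "{..<N}" k v 1] by (simp add: g_def dot_commute)
    then have "L2_norm {..<N} (\<lambda>x. schroedinger {..<N} a (w(k := t)) v x - schroedinger {..<N} a w v x) =
        L2_norm {..<N} (\<lambda>_. 0 :: real)"
      by (intro L2_norm_cong) (auto simp: schroedinger_def)
    then show "L2_norm {..<N} (\<lambda>x. schroedinger {..<N} a (w(k := t)) v x - schroedinger {..<N} a w v x)
        \<le> 0 * L2_norm {..<N} v" by simp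
  qed (unfold_locales, auto)
  then show ?thesis by simp
qed

lemma eig_count_Icc_enlarge:
  obtains d where "d > 0" "eig_count N a w {p - d..q + d} \<le> eig_count N a w {p..q}"
proof -
  obtain u e where ue: "eigensystem {..<N} a w u e" using spectral_theorem by blast
  have "\<forall>\<^sub>F d in at_right 0. \<forall>i\<in>{..<N}. e i \<in> {p - d..q + d} \<longrightarrow> e i \<in> {p..q}"
  proof (intro eventually_ball_finite ballI)
    fix i
    show "\<forall>\<^sub>F d in at_right 0. e i \<in> {p - d..q + d} \<longrightarrow> e i \<in> {p..q}"
    proof (cases "e i \<in> {p..q}")
      case False
      then have "\<forall>\<^sub>F d in at_right 0. d < max (p - e i) (e i - q)"
        by (intro eventually_at_rightI[of _ "max (p - e i) (e i - q)"]) auto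
      then show ?thesis by eventually_elim auto
    qed auto
  qed auto
  with eventually_at_right_less[of "0::real"]
  have "\<forall>\<^sub>F d in at_right 0. 0 < d \<and> (\<forall>i\<in>{..<N}. e i \<in> {p - d..q + d} \<longrightarrow> e i \<in> {p..q})"
    by eventually_elim auto
  from eventually_happens'[OF trivial_limit_at_right_real this]
  obtain d where d: "0 < d" "\<forall>i\<in>{..<N}. e i \<in> {p - d..q + d} \<longrightarrow> e i \<in> {p..q}" by blast
  have "eig_count N a w {p - d..q + d} \<le> eig_count N a w {p..q}"
    unfolding eig_count_eigensystem[OF ue] using d(2) by (intro card_mono) auto
  with d(1) show thesis by (rule that)
qed

lemma closed_eig_count_ge: "closed {w. m \<le> eig_count N a w {p..q}}"
  unfolding closed_sequential_limits
proof (intro allI impI, elim conjE)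
  fix X :: "nat \<Rightarrow> nat \<Rightarrow> real" and w
  assume X: "\<forall>j. X j \<in> {w. m \<le> eig_count N a w {p..q}}" "X \<longlonglongrightarrow> w"
  obtain d where d: "d > 0" "eig_count N a w {p - d..q + d} \<le> eig_count N a w {p..q}"
    using eig_count_Icc_enlarge by blast
  have "\<forall>\<^sub>F j in sequentially. \<forall>x\<in>{..<N}. \<bar>w x - X j x\<bar> < d"
  proof (intro eventually_ball_finite ballI)
    fix x
    have "isCont (\<lambda>w. w x) w"
      using continuous_on_product_coordinates[of x] continuous_on_eq_continuous_at[OF open_UNIV] by blast
    then have "(\<lambda>j. X j x) \<longlonglongrightarrow> w x" using X(2) by (rule isCont_tendsto_compose)
    from tendstoD[OF this d(1)] show "\<forall>\<^sub>F j in sequentially. \<bar>w x - X j x\<bar> < d"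
      by eventually_elim (simp add: dist_real_def abs_minus_commute)
  qed simp
  from eventually_happens'[OF sequentially_bot this]
  obtain j where j: "\<forall>x\<in>{..<N}. \<bar>w x - X j x\<bar> < d" by blast
  have "m \<le> eig_count N a (X j) {p..q}" using X(1) by simp
  also have "\<dots> \<le> eig_count N a w {p - d..q + d}"
    using j d(1) by (intro eig_count_Weyl matrix_kernel_axioms) (auto intro: less_imp_le)
  also have "\<dots> \<le> eig_count N a w {p..q}" by (rule d(2))
  finally show "w \<in> {w. m \<le> eig_count N a w {p..q}}" by simp
qed

lemma trace_green:
  assumes ue: "eigensystem {..<N} a w u e" and z: "Im z > 0"
  shows "(\<Sum>x<N. green {..<N} a w z x x) = (\<Sum>i<N. 1 / (of_real (e i) - z))"
proof -
  have "(\<Sum>x<N. green {..<N} a w z x x) = (\<Sum>x<N. \<Sum>i<N. of_real (u i x * u i x) / (of_real (e i) - z))"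
    by (intro sum.cong refl) (simp add: green_eigensystem[OF ue z])
  also have "\<dots> = (\<Sum>i<N. of_real (dot {..<N} (u i) (u i)) / (of_real (e i) - z))"
    unfolding dot_def of_real_sum sum_divide_distrib by (rule sum.swap)
  also have "\<dots> = (\<Sum>i<N. 1 / (of_real (e i) - z))"
    by (intro sum.cong refl) (simp add: eigensystem_orthonormal[OF ue])
  finally show ?thesis .
qed

end

definition eigval :: "nat \<Rightarrow> (nat \<Rightarrow> nat \<Rightarrow> real) \<Rightarrow> (nat \<Rightarrow> real) \<Rightarrow> nat \<Rightarrow> real" where
  "eigval N a w = (SOME e. \<exists>u. eigensystem {..<N} a w u e)"

lemma (in matrix_kernel) eigensystem_eigval: "\<exists>u. eigensystem {..<N} a w u (eigval N a w)"
proof -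
  have "\<exists>e. \<exists>u. eigensystem {..<N} a w u e" using spectral_theorem by blast
  then show ?thesis unfolding eigval_def by (rule someI_ex)
qed

section \<open>The Poisson kernel\<close>

definition poisson_kernel :: "real \<Rightarrow> real \<Rightarrow> real \<Rightarrow> real" where
  "poisson_kernel y x t = y / ((t - x)\<^sup>2 + y\<^sup>2)"

lemma poisson_kernel_nonneg: "y > 0 \<Longrightarrow> poisson_kernel y x t \<ge> 0"
  by (simp add: poisson_kernel_def)

lemma poisson_kernel_commute: "poisson_kernel y x t = poisson_kernel y t x"
  by (simp add: poisson_kernel_def power2_commute)

lemma Im_resolvent_kernel: "Im (1 / (complex_of_real t - Complex x y)) = poisson_kernel y x t"
  by (simp add: poisson_kernel_def Im_divide power2_eq_square)

lemma measurable_poisson_kernel [measurable (raw)]: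
  assumes [measurable]: "f \<in> borel_measurable M" "g \<in> borel_measurable M"
  shows "(\<lambda>w. poisson_kernel y (f w) (g w)) \<in> borel_measurable M"
  unfolding poisson_kernel_def by measurable

lemma Im_cauchy_transform:
  fixes f :: "real \<Rightarrow> real"
  assumes f [measurable]: "integrable lborel f" and y: "y > 0"
  shows "Im (\<integral>t. complex_of_real (f t) / (complex_of_real t - Complex E y) \<partial>lborel) = (\<integral>t. poisson_kernel y E t * f t \<partial>lborel)"
proof -
  let ?F = "\<lambda>t. complex_of_real (f t) / (complex_of_real t - Complex E y)"
  have int: "integrable lborel ?F"
  proof (rule Bochner_Integration.integrable_bound[where f = "\<lambda>t. f t / y"])
    show "integrable lborel (\<lambda>t. f t / y)" using f by simp
    have "cmod (?F t) \<le> \<bar>f t\<bar> / y" for t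
    proof -
      have "y \<le> cmod (complex_of_real t - Complex E y)"
        using abs_Im_le_cmod[of "complex_of_real t - Complex E y"] y by simp
      then show ?thesis using y by (simp add: norm_divide frac_le)
    qed
    then show "AE t in lborel. norm (?F t) \<le> norm (f t / y)" using y by simp
  qed (use f in measurable)
  have Im: "Im (?F t) = poisson_kernel y E t * f t" for t
  proof -
    have "Im (of_real r * u) = Im u * r" for r u by simp
    moreover have "?F t = of_real (f t) * (1 / (complex_of_real t - Complex E y))" by simp
    ultimately show ?thesis by (simp only: Im_resolvent_kernel)
  qed
  have "Im (\<integral>t. ?F t \<partial>lborel) = (\<integral>t. Im (?F t) \<partial>lborel)" by (rule integral_Im[symmetric, OF int])
  then show ?thesis unfolding Im .
qed

lemma poisson_kernel_ge:
  assumes y: "y > 0" and t: "\<bar>t - x\<bar> \<le> y"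
  shows "1 \<le> 2 * y * poisson_kernel y x t"
proof -
  have "(t - x)\<^sup>2 \<le> y\<^sup>2" using t y by (simp add: abs_le_square_iff[symmetric])
  moreover have "(t - x)\<^sup>2 + y\<^sup>2 > 0" using y by (simp add: add_nonneg_pos)
  ultimately show ?thesis unfolding poisson_kernel_def by (simp add: field_simps power2_eq_square)
qed

lemma poisson_kernel_scale:
  assumes "N > 0"
  shows "poisson_kernel (y / N) (e + x / N) t = N * poisson_kernel y x (N * (t - e))"
proof -
  have "(t - (e + x / N))\<^sup>2 + (y / N)\<^sup>2 = ((N * (t - e) - x)\<^sup>2 + y\<^sup>2) / N\<^sup>2"
    using assms by (simp add: field_simps power2_eq_square)
  then show ?thesis using assms by (simp add: poisson_kernel_def power2_eq_square)
qed

lemma has_real_derivative_poisson_kernel: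
  assumes "y > 0"
  shows "((\<lambda>x. arctan ((x - t) / y)) has_real_derivative poisson_kernel y x t) (at x)"
proof -
  have "inverse (1 + ((x - t) / y)\<^sup>2) * (1 / y) = poisson_kernel y x t"
    using assms by (simp add: poisson_kernel_def field_simps power2_eq_square)
  then show ?thesis by (auto intro!: derivative_eq_intros simp: divide_inverse)
qed

lemma nn_integral_poisson_kernel_le:
  assumes y: "y > 0"
  shows "(\<integral>\<^sup>+x. ennreal (poisson_kernel y x t) \<partial>lborel) \<le> ennreal pi"
proof -
  let ?f = "\<lambda>x. ennreal (poisson_kernel y x t)"
  have "filterlim (\<lambda>x. (x - t) / y) at_top at_top"
    using filterlim_at_top_mult_tendsto_pos[OF tendsto_const[of "1 / y"] _ filterlim_tendsto_add_at_top[OF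
        tendsto_const[of "- t"] filterlim_ident]] y by simp
  then have "((\<lambda>x. arctan ((x - t) / y)) \<longlongrightarrow> pi / 2) at_top"
    by (rule filterlim_compose[OF tendsto_arctan_at_top])
  then have right: "(\<integral>\<^sup>+x. ?f x * indicator {t..} x \<partial>lborel) = ennreal (pi / 2)"
    using y has_real_derivative_poisson_kernel[OF y]
    by (subst nn_integral_FTC_atLeast[where F = "\<lambda>x. arctan ((x - t) / y)" and T = "pi / 2"])
      (auto simp: poisson_kernel_nonneg)
  have "(\<integral>\<^sup>+x. ?f x * indicator {..t} x \<partial>lborel) =
      (\<integral>\<^sup>+x. ?f (2 * t + (- 1) * x) * indicator {..t} (2 * t + (- 1) * x) \<partial>lborel)"
    by (subst nn_integral_real_affine[of _ "- 1" "2 * t"]) auto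
  also have "\<dots> = (\<integral>\<^sup>+x. ?f x * indicator {t..} x \<partial>lborel)"
    by (intro nn_integral_cong)
      (auto split: split_indicator simp: poisson_kernel_def power2_commute[of t])
  finally have left: "(\<integral>\<^sup>+x. ?f x * indicator {..t} x \<partial>lborel) = ennreal (pi / 2)" unfolding right .
  have "(\<integral>\<^sup>+x. ?f x \<partial>lborel) \<le> (\<integral>\<^sup>+x. ?f x * indicator {t..} x + ?f x * indicator {..t} x \<partial>lborel)"
    by (intro nn_integral_mono) (auto split: split_indicator)
  also have "\<dots> = ennreal (pi / 2) + ennreal (pi / 2)"
    by (subst nn_integral_add) (auto simp: left right)
  also have "\<dots> = ennreal pi" by (simp flip: ennreal_plus)
  finally show ?thesis .
qed

definition poisson_mass :: "real \<Rightarrow> real \<Rightarrow> real \<Rightarrow> real \<Rightarrow> real" where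
  "poisson_mass y a b t = arctan ((b - t) / y) - arctan ((a - t) / y)"

lemma measurable_poisson_mass [measurable]: "poisson_mass y a b \<in> borel_measurable borel"
  unfolding poisson_mass_def by measurable

lemma poisson_mass_le_pi: "poisson_mass y a b t \<le> pi"
  unfolding poisson_mass_def using arctan_ubound[of "(b - t) / y"] arctan_lbound[of "(a - t) / y"] by linarith

lemma poisson_mass_nonneg: "y > 0 \<Longrightarrow> a \<le> b \<Longrightarrow> poisson_mass y a b t \<ge> 0"
  by (simp add: poisson_mass_def arctan_le_iff divide_right_mono)

lemma nn_integral_poisson_kernel_Icc:
  assumes "y > 0" "a \<le> b"
  shows "(\<integral>\<^sup>+x. ennreal (poisson_kernel y x t) * indicator {a..b} x \<partial>lborel) = ennreal (poisson_mass y a b t)"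
  unfolding poisson_mass_def
  by (rule nn_integral_FTC_Icc) (use assms in \<open>auto simp: poisson_kernel_nonneg has_real_derivative_poisson_kernel\<close>)

lemma nn_integral_poisson_mass:
  assumes \<nu>: "sigma_finite_measure \<nu>" and sets [measurable_cong]: "sets \<nu> = sets borel" and "y > 0" "a \<le> b"
  shows "(\<integral>\<^sup>+t. ennreal (poisson_mass y a b t) \<partial>\<nu>) =
    (\<integral>\<^sup>+x. (\<integral>\<^sup>+t. ennreal (poisson_kernel y x t) \<partial>\<nu>) * indicator {a..b} x \<partial>lborel)"
proof -
  interpret sigma_finite_measure \<nu> by fact
  interpret pair_sigma_finite \<nu> lborel ..
  have "(\<integral>\<^sup>+t. ennreal (poisson_mass y a b t) \<partial>\<nu>) =
      (\<integral>\<^sup>+t. (\<integral>\<^sup>+x. ennreal (poisson_kernel y x t) * indicator {a..b} x \<partial>lborel) \<partial>\<nu>)"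
    using assms by (simp add: nn_integral_poisson_kernel_Icc)
  also have "\<dots> = (\<integral>\<^sup>+x. (\<integral>\<^sup>+t. ennreal (poisson_kernel y x t) * indicator {a..b} x \<partial>\<nu>) \<partial>lborel)"
    by (rule Fubini'[symmetric]) measurable
  also have "\<dots> = (\<integral>\<^sup>+x. (\<integral>\<^sup>+t. ennreal (poisson_kernel y x t) \<partial>\<nu>) * indicator {a..b} x \<partial>lborel)"
    by (intro nn_integral_cong nn_integral_multc) measurable
  finally show ?thesis .
qed

lemma nn_integral_poisson_mass_lborel_le:
  assumes "y > 0" "a \<le> b"
  shows "(\<integral>\<^sup>+t. ennreal (poisson_mass y a b t) \<partial>lborel) \<le> ennreal (pi * (b - a))"
proof -
  have "(\<integral>\<^sup>+t. ennreal (poisson_mass y a b t) \<partial>lborel) =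
      (\<integral>\<^sup>+x. (\<integral>\<^sup>+t. ennreal (poisson_kernel y t x) \<partial>lborel) * indicator {a..b} x \<partial>lborel)"
    using assms by (subst nn_integral_poisson_mass) (auto simp: sigma_finite_lborel poisson_kernel_commute[of y])
  also have "\<dots> \<le> (\<integral>\<^sup>+x. ennreal pi * indicator {a..b} x \<partial>lborel)"
    using assms by (intro nn_integral_mono mult_right_mono nn_integral_poisson_kernel_le) auto
  also have "\<dots> = ennreal (pi * (b - a))"
    using assms by (simp add: nn_integral_cmult_indicator ennreal_mult)
  finally show ?thesis .
qed

lemma tendsto_arctan_scaled: "(\<lambda>j. arctan (c / (1 / real (Suc j)))) \<longlonglongrightarrow> sgn c * (pi / 2)"
proof -
  have pos: "(\<lambda>j. arctan (c * real (Suc j))) \<longlonglongrightarrow> pi / 2" if "c > 0" for c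
    using that by (intro filterlim_compose[OF tendsto_arctan_at_top]
        filterlim_tendsto_pos_mult_at_top[OF tendsto_const]
        filterlim_compose[OF filterlim_real_sequentially filterlim_Suc])
  consider "c > 0" | "c = 0" | "c < 0" by linarith
  then show ?thesis
  proof cases
    case 3
    then show ?thesis using tendsto_minus[OF pos[of "- c"]] by (simp add: arctan_minus)
  qed (use pos in auto)
qed

lemma tendsto_poisson_mass:
  assumes "a \<le> b" "t \<noteq> a" "t \<noteq> b"
  shows "(\<lambda>j. poisson_mass (1 / real (Suc j)) a b t) \<longlonglongrightarrow> pi * indicator {a..b} t"
proof -
  have "(\<lambda>j. poisson_mass (1 / real (Suc j)) a b t) \<longlonglongrightarrow> sgn (b - t) * (pi / 2) - sgn (a - t) * (pi / 2)"
    unfolding poisson_mass_def by (intro tendsto_diff tendsto_arctan_scaled)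
  also have "sgn (b - t) * (pi / 2) - sgn (a - t) * (pi / 2) = pi * indicator {a..b} t"
    using assms by (auto split: split_indicator simp: sgn_if)
  finally show ?thesis .
qed

lemma poisson_mass_L1_tendsto:
  assumes ab: "a \<le> b"
  shows "(\<lambda>j. \<integral>\<^sup>+t. ennreal \<bar>poisson_mass (1 / real (Suc j)) a b t - pi * indicator {a..b} t\<bar> \<partial>lborel) \<longlonglongrightarrow> 0"
proof -
  have "(\<lambda>j. \<integral>\<^sup>+t. ennreal (norm (poisson_mass (1 / real (Suc j)) a b t - pi * indicator {a..b} t)) \<partial>lborel) \<longlonglongrightarrow> 0"
  proof (rule Scheffe_lemma2)
    have "AE t in lborel. t \<noteq> a" "AE t in lborel. t \<noteq> b" by (rule AE_lborel_singleton)+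
    then show "AE t in lborel. (\<lambda>j. poisson_mass (1 / real (Suc j)) a b t) \<longlonglongrightarrow> pi * indicator {a..b} t"
      by eventually_elim (rule tendsto_poisson_mass[OF ab])
    fix j
    have "(\<integral>\<^sup>+t. ennreal (norm (poisson_mass (1 / real (Suc j)) a b t)) \<partial>lborel) \<le> ennreal (pi * (b - a))"
      using nn_integral_poisson_mass_lborel_le[of "1 / real (Suc j)", OF _ ab] ab by (simp add: poisson_mass_nonneg)
    also have "\<dots> = (\<integral>\<^sup>+t. ennreal pi * indicator {a..b} t \<partial>lborel)"
      using ab by (simp add: nn_integral_cmult_indicator ennreal_mult)
    also have "\<dots> = (\<integral>\<^sup>+t. ennreal (norm (pi * indicator {a..b} t)) \<partial>lborel)"
      by (intro nn_integral_cong) (auto split: split_indicator)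
    finally show "(\<integral>\<^sup>+t. ennreal (norm (poisson_mass (1 / real (Suc j)) a b t)) \<partial>lborel) \<le>
        (\<integral>\<^sup>+t. ennreal (norm (pi * indicator {a..b} t)) \<partial>lborel)" .
  next
    show "integrable lborel (\<lambda>t. pi * indicator {a..b} t)"
      by (intro integrable_mult_right integrable_real_indicator) (auto simp: emeasure_lborel_Icc_eq)
  qed auto
  then show ?thesis by simp
qed

lemma emeasure_le_lborel_if_open:
  assumes sets: "sets \<mu> = sets borel" and B: "B \<ge> 0"
    and "open": "\<And>U. open U \<Longrightarrow> emeasure \<mu> U \<le> ennreal B * emeasure lborel U"
    and A: "A \<in> sets (borel :: real measure)"
  shows "emeasure \<mu> A \<le> ennreal B * emeasure lborel A"
proof (rule ennreal_le_epsilon)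
  fix d :: real assume d: "d > 0"
  obtain U where U: "open U" "A \<subseteq> U" "emeasure lborel (U - A) < ennreal (d / (B + 1))"
    using outer_regular_lborel[OF A, of "d / (B + 1)"] d B by auto
  have "emeasure \<mu> A \<le> emeasure \<mu> U" using U sets by (intro emeasure_mono) auto
  also have "\<dots> \<le> ennreal B * emeasure lborel U" using U by (intro "open")
  also have "emeasure lborel U = emeasure lborel A + emeasure lborel (U - A)"
    using U A by (subst plus_emeasure) (auto simp: Un_absorb1)
  also have "ennreal B * \<dots> \<le> ennreal B * (emeasure lborel A + ennreal (d / (B + 1)))"
    using U by (intro mult_left_mono add_left_mono) auto
  also have "\<dots> = ennreal B * emeasure lborel A + ennreal (B * (d / (B + 1)))"
    using B d by (simp only: distrib_left) (subst ennreal_mult, auto)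
  also have "\<dots> \<le> ennreal B * emeasure lborel A + ennreal d"
    using B d by (intro add_left_mono ennreal_leI) (simp add: field_simps)
  finally show "emeasure \<mu> A \<le> ennreal B * emeasure lborel A + ennreal d" .
qed

lemma liminf_nn_integral_poisson_kernel_open_ge:
  assumes U: "open U"
  shows "ennreal pi * indicator U t \<le>
    liminf (\<lambda>j. \<integral>\<^sup>+x. ennreal (poisson_kernel (1 / real (Suc j)) x t) * indicator U x \<partial>lborel)" (is "_ \<le> liminf ?g")
proof (cases "t \<in> U")
  case True
  then obtain c where c: "c > 0" "cball t c \<subseteq> U" using U by (metis open_contains_cball)
  have "ennreal (poisson_mass (1 / real (Suc j)) (t - c) (t + c) t) \<le> ?g j" for j
    using c by (subst nn_integral_poisson_kernel_Icc[symmetric])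
      (auto intro!: nn_integral_mono mult_left_mono split: split_indicator simp: cball_eq_atLeastAtMost)
  then have "liminf (\<lambda>j. ennreal (poisson_mass (1 / real (Suc j)) (t - c) (t + c) t)) \<le> liminf ?g"
    by (intro Liminf_mono) auto
  moreover have "(\<lambda>j. ennreal (poisson_mass (1 / real (Suc j)) (t - c) (t + c) t)) \<longlonglongrightarrow> ennreal pi"
    using tendsto_ennrealI[OF tendsto_poisson_mass[of "t - c" "t + c" t]] c(1) by simp
  ultimately show ?thesis using True by (simp add: lim_imp_Liminf)
qed simp

text \<open>Inversion of the Poisson transform: integrate the bound over an open set and let \<open>y \<down> 0\<close>.\<close>
lemma emeasure_open_le_of_poisson_bound:
  assumes \<mu>: "finite_measure \<mu>" and sets [measurable_cong]: "sets \<mu> = sets borel"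
    and B: "B \<ge> 0" and U: "open U"
    and bound: "\<And>x y. y > 0 \<Longrightarrow> (\<integral>\<^sup>+t. ennreal (poisson_kernel y x t) \<partial>\<mu>) \<le> ennreal (pi * B)"
  shows "emeasure \<mu> U \<le> ennreal B * emeasure lborel U"
proof -
  interpret finite_measure \<mu> by fact
  interpret pair_sigma_finite \<mu> lborel ..
  have [measurable]: "U \<in> sets borel" using U by simp
  define y where "y j = 1 / real (Suc j)" for j
  have y: "y j > 0" for j by (simp add: y_def)
  define g where "g j t = (\<integral>\<^sup>+x. ennreal (poisson_kernel (y j) x t) * indicator U x \<partial>lborel)" for j t
  have [measurable]: "g j \<in> borel_measurable \<mu>" for j unfolding g_def by measurable
  have liminf_ge: "ennreal pi * indicator U t \<le> liminf (\<lambda>j. g j t)" for t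
    unfolding g_def y_def by (rule liminf_nn_integral_poisson_kernel_open_ge[OF U])
  have g_le: "(\<integral>\<^sup>+t. g j t \<partial>\<mu>) \<le> ennreal (pi * B) * emeasure lborel U" for j
  proof -
    have "(\<integral>\<^sup>+t. g j t \<partial>\<mu>) = (\<integral>\<^sup>+x. (\<integral>\<^sup>+t. ennreal (poisson_kernel (y j) x t) * indicator U x \<partial>\<mu>) \<partial>lborel)"
      unfolding g_def by (rule Fubini'[symmetric]) measurable
    also have "\<dots> = (\<integral>\<^sup>+x. (\<integral>\<^sup>+t. ennreal (poisson_kernel (y j) x t) \<partial>\<mu>) * indicator U x \<partial>lborel)"
      by (intro nn_integral_cong nn_integral_multc) measurable
    also have "\<dots> \<le> (\<integral>\<^sup>+x. ennreal (pi * B) * indicator U x \<partial>lborel)"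
      by (intro nn_integral_mono mult_right_mono bound y) auto
    also have "\<dots> = ennreal (pi * B) * emeasure lborel U" by (simp add: nn_integral_cmult_indicator)
    finally show ?thesis .
  qed
  have "ennreal pi * emeasure \<mu> U = (\<integral>\<^sup>+t. ennreal pi * indicator U t \<partial>\<mu>)"
    by (simp add: nn_integral_cmult_indicator)
  also have "\<dots> \<le> (\<integral>\<^sup>+t. liminf (\<lambda>j. g j t) \<partial>\<mu>)" by (intro nn_integral_mono liminf_ge)
  also have "\<dots> \<le> liminf (\<lambda>j. \<integral>\<^sup>+t. g j t \<partial>\<mu>)" by (rule nn_integral_liminf) measurable
  also have "\<dots> \<le> liminf (\<lambda>j::nat. ennreal (pi * B) * emeasure lborel U)"
    by (intro Liminf_mono) (simp add: g_le)
  also have "\<dots> = ennreal pi * (ennreal B * emeasure lborel U)"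
    using B by (simp add: Liminf_const ennreal_mult mult.assoc)
  finally show ?thesis by (simp add: ennreal_mult_le_mult_iff)
qed

corollary emeasure_le_of_poisson_bound:
  assumes \<mu>: "finite_measure \<mu>" and sets: "sets \<mu> = sets borel" and B: "B \<ge> 0" and A: "A \<in> sets borel"
    and bound: "\<And>x y. y > 0 \<Longrightarrow> (\<integral>\<^sup>+t. ennreal (poisson_kernel y x t) \<partial>\<mu>) \<le> ennreal (pi * B)"
  shows "emeasure \<mu> A \<le> ennreal B * emeasure lborel A"
  by (rule emeasure_le_lborel_if_open[OF sets B emeasure_open_le_of_poisson_bound[OF \<mu> sets B _ bound] A])

lemma nn_integral_le_of_emeasure_le:
  assumes [measurable_cong]: "sets \<nu> = sets borel"
    and "\<And>A. A \<in> sets borel \<Longrightarrow> emeasure \<nu> A \<le> ennreal B * emeasure lborel A"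
    and [measurable]: "f \<in> borel_measurable borel"
  shows "(\<integral>\<^sup>+x. f x \<partial>\<nu>) \<le> ennreal B * (\<integral>\<^sup>+x. f x \<partial>lborel)"
proof -
  have "nn_integral \<nu> f \<le> nn_integral (density lborel (\<lambda>_. ennreal B)) f"
    using assms by (intro nn_integral_mono_measure)
      (auto simp: le_measure emeasure_density nn_integral_cmult_indicator)
  then show ?thesis by (simp add: nn_integral_density nn_integral_cmult)
qed

lemma tendsto_integral_poisson_mass:
  fixes \<nu> :: "nat \<Rightarrow> real measure"
  assumes fin: "\<And>k. finite_measure (\<nu> k)" and sets [measurable_cong]: "\<And>k. sets (\<nu> k) = sets borel"
    and B: "B \<ge> 0" and h: "h \<ge> 0" and y: "y > 0" and ab: "a \<le> b"
    and bound: "\<And>k x. (\<integral>\<^sup>+t. ennreal (poisson_kernel y x t) \<partial>\<nu> k) \<le> ennreal (pi * B)"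
    and conv: "\<And>x. (\<lambda>k. \<integral>\<^sup>+t. ennreal (poisson_kernel y x t) \<partial>\<nu> k) \<longlonglongrightarrow> ennreal (pi * h)"
  shows "(\<lambda>k. \<integral>t. poisson_mass y a b t \<partial>\<nu> k) \<longlonglongrightarrow> pi * h * (b - a)"
proof -
  let ?P = "\<lambda>k x. (\<integral>\<^sup>+t. ennreal (poisson_kernel y x t) \<partial>\<nu> k) * indicator {a..b} x"
  have "(\<lambda>k. \<integral>\<^sup>+x. ?P k x \<partial>lborel) \<longlonglongrightarrow> (\<integral>\<^sup>+x. ennreal (pi * h) * indicator {a..b} x \<partial>lborel)"
  proof (rule nn_integral_dominated_convergence[where w = "\<lambda>x. ennreal (pi * B) * indicator {a..b} x"])
    show "?P k \<in> borel_measurable lborel" for k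
    proof -
      interpret finite_measure "\<nu> k" by fact
      show ?thesis by measurable
    qed
    show "(\<integral>\<^sup>+x. ennreal (pi * B) * indicator {a..b} x \<partial>lborel) < \<infinity>"
      using ab B by (simp add: nn_integral_cmult_indicator ennreal_mult_less_top)
    show "AE x in lborel. (\<lambda>k. ?P k x) \<longlonglongrightarrow> ennreal (pi * h) * indicator {a..b} x"
      using conv by (auto split: split_indicator)
  qed (use bound in \<open>auto intro!: mult_right_mono\<close>)
  then have "(\<lambda>k. \<integral>\<^sup>+t. ennreal (poisson_mass y a b t) \<partial>\<nu> k) \<longlonglongrightarrow> ennreal (pi * h * (b - a))"
    using ab h y sets fin
    by (simp add: nn_integral_poisson_mass finite_measure.sigma_finite_measure nn_integral_cmult_indicator ennreal_mult)
  then have "(\<lambda>k. enn2real (\<integral>\<^sup>+t. ennreal (poisson_mass y a b t) \<partial>\<nu> k)) \<longlonglongrightarrow> pi * h * (b - a)"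
    using h ab by (intro tendsto_enn2real) auto
  then show ?thesis
    using poisson_mass_nonneg[OF y ab] by (simp add: integral_eq_nn_integral sets cong: measurable_cong_sets)
qed

lemma interval_mass_poisson_approx:
  assumes fin: "finite_measure \<nu>" and sets [measurable_cong]: "sets \<nu> = sets borel"
    and dens: "\<And>A. A \<in> sets borel \<Longrightarrow> emeasure \<nu> A \<le> ennreal B * emeasure lborel A"
    and y: "y > 0" and ab: "a \<le> b"
  shows "ennreal \<bar>(\<integral>t. poisson_mass y a b t \<partial>\<nu>) - pi * measure \<nu> {a..b}\<bar> \<le>
    ennreal B * (\<integral>\<^sup>+t. ennreal \<bar>poisson_mass y a b t - pi * indicator {a..b} t\<bar> \<partial>lborel)"
proof -
  interpret finite_measure \<nu> by fact
  have int_mass: "integrable \<nu> (poisson_mass y a b)"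
    using poisson_mass_nonneg[OF y ab] poisson_mass_le_pi by (intro integrable_const_bound[of _ pi]) auto
  have int_indicator: "integrable \<nu> (\<lambda>t. pi * indicator {a..b} t :: real)"
    by (intro integrable_mult_right integrable_real_indicator) (auto simp: sets emeasure_eq_measure)
  have "\<bar>(\<integral>t. poisson_mass y a b t \<partial>\<nu>) - pi * measure \<nu> {a..b}\<bar> =
      \<bar>\<integral>t. poisson_mass y a b t - pi * indicator {a..b} t \<partial>\<nu>\<bar>"
    using int_mass int_indicator by (simp add: sets sets_eq_imp_space_eq[OF sets])
  also have "ennreal \<dots> \<le> (\<integral>\<^sup>+t. ennreal \<bar>poisson_mass y a b t - pi * indicator {a..b} t\<bar> \<partial>\<nu>)"
    using integral_norm_bound_ennreal[OF Bochner_Integration.integrable_diff[OF int_mass int_indicator]] by simp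
  also have "\<dots> \<le> ennreal B * (\<integral>\<^sup>+t. ennreal \<bar>poisson_mass y a b t - pi * indicator {a..b} t\<bar> \<partial>lborel)"
    by (rule nn_integral_le_of_emeasure_le[OF sets dens]) auto
  finally show ?thesis .
qed

theorem interval_mass_tendsto_of_poisson_tendsto:
  fixes \<nu> :: "nat \<Rightarrow> real measure"
  assumes fin: "\<And>k. finite_measure (\<nu> k)" and sets: "\<And>k. sets (\<nu> k) = sets borel"
    and B: "B \<ge> 0" and h: "h \<ge> 0" and ab: "a \<le> b"
    and bound: "\<And>k x y. y > 0 \<Longrightarrow> (\<integral>\<^sup>+t. ennreal (poisson_kernel y x t) \<partial>\<nu> k) \<le> ennreal (pi * B)"
    and conv: "\<And>x y. y > 0 \<Longrightarrow> (\<lambda>k. \<integral>\<^sup>+t. ennreal (poisson_kernel y x t) \<partial>\<nu> k) \<longlonglongrightarrow> ennreal (pi * h)"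
  shows "(\<lambda>k. measure (\<nu> k) {a..b}) \<longlonglongrightarrow> h * (b - a)"
proof -
  define y where "y j = 1 / real (Suc j)" for j
  have y: "y j > 0" for j by (simp add: y_def)
  define \<kappa> where "\<kappa> j = ennreal B * (\<integral>\<^sup>+t. ennreal \<bar>poisson_mass (y j) a b t - pi * indicator {a..b} t\<bar> \<partial>lborel)" for j
  define T where "T j k = (\<integral>t. poisson_mass (y j) a b t \<partial>\<nu> k)" for j k
  have dens: "emeasure (\<nu> k) A \<le> ennreal B * emeasure lborel A" if "A \<in> sets borel" for k A
    by (intro emeasure_le_of_poisson_bound fin sets B that bound)
  have "\<kappa> \<longlonglongrightarrow> ennreal B * 0"
    unfolding \<kappa>_def y_def by (intro ennreal_tendsto_cmult poisson_mass_L1_tendsto ab) simp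
  then have \<kappa>: "\<forall>\<^sub>F j in sequentially. \<kappa> j < ennreal d" if "d > 0" for d
    using that by (intro order_tendstoD) auto
  have unif: "uniform_limit UNIV T (\<lambda>k. pi * measure (\<nu> k) {a..b}) sequentially"
  proof (rule uniform_limitI)
    fix d :: real assume "d > 0"
    from \<kappa>[OF this] show "\<forall>\<^sub>F j in sequentially. \<forall>k\<in>UNIV. dist (T j k) (pi * measure (\<nu> k) {a..b}) < d"
    proof eventually_elim
      case (elim j)
      have "ennreal (dist (T j k) (pi * measure (\<nu> k) {a..b})) < ennreal d" for k
        using interval_mass_poisson_approx[OF fin[of k] sets dens y[of j] ab] elim
        unfolding T_def \<kappa>_def dist_real_def by (rule le_less_trans)
      then show ?case by (simp add: ennreal_less_iff)
    qed
  qed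
  have "\<forall>\<^sub>F j in sequentially. T j \<longlonglongrightarrow> pi * h * (b - a)"
    unfolding T_def using tendsto_integral_poisson_mass[OF fin sets B h y ab bound[OF y] conv[OF y]] by simp
  from swap_uniform_limit'[OF this tendsto_const unif _ sequentially_bot]
  have "(\<lambda>k. pi * measure (\<nu> k) {a..b}) \<longlonglongrightarrow> pi * h * (b - a)" by simp
  from tendsto_mult[OF tendsto_const[of "1 / pi"] this] show ?thesis by simp
qed

section \<open>From intervals to Borel sets\<close>

lemma borel_approx_by_Icc_union:
  fixes A :: "real set"
  assumes A: "A \<in> sets borel" "bounded A" and e: "e > 0"
  obtains D :: "(real \<times> real) set" where "finite D"
    "measure lborel (A - (\<Union>(a, b)\<in>D. {a..b})) < e" "measure lborel ((\<Union>(a, b)\<in>D. {a..b}) - A) < e"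
proof -
  obtain W where W: "open W" "A \<subseteq> W" "emeasure lborel (W - A) < e"
    using outer_regular_lborel[OF A(1) e] by blast
  have "- A \<in> sets borel" using A(1) by auto
  from outer_regular_lborel[OF this e]
  obtain V where V: "open V" "- A \<subseteq> V" "emeasure lborel (V - - A) < e" by blast
  have "bounded (- V)" using V(2) A(2) by (elim bounded_subset) auto
  then have "compact (- V)" using V(1) by (simp add: compact_eq_bounded_closed closed_Compl)
  have "\<exists>r>0. {x - r..x + r} \<subseteq> W" if "x \<in> - V" for x
  proof -
    have "x \<in> W" using that V(2) W(2) by blast
    then show ?thesis using W(1) unfolding open_contains_cball cball_eq_atLeastAtMost by blast
  qed
  then obtain r where r: "\<And>x. x \<in> - V \<Longrightarrow> r x > 0 \<and> {x - r x..x + r x} \<subseteq> W" by metis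
  then have cover: "- V \<subseteq> (\<Union>x\<in>- V. {x - r x<..<x + r x})" by force
  obtain X where X: "X \<subseteq> - V" "finite X" "- V \<subseteq> (\<Union>x\<in>X. {x - r x<..<x + r x})"
    by (rule compactE_image[OF \<open>compact (- V)\<close> _ cover]) auto
  define D where "D = (\<lambda>x. (x - r x, x + r x)) ` X"
  have D_Union: "(\<Union>(a, b)\<in>D. {a..b}) = (\<Union>x\<in>X. {x - r x..x + r x})" by (simp add: D_def)
  have "- V \<subseteq> (\<Union>x\<in>X. {x - r x..x + r x})"
    using X(3) by (rule order.trans) (intro UN_mono order.refl greaterThanLessThan_subseteq_atLeastAtMost_iff[THEN iffD2], simp)
  then have "emeasure lborel (A - (\<Union>(a, b)\<in>D. {a..b})) \<le> emeasure lborel (V - - A)"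
    unfolding D_Union using A(1) V(1) by (intro emeasure_mono) auto
  moreover have "(\<Union>x\<in>X. {x - r x..x + r x}) \<subseteq> W" using X(1) r by blast
  then have "emeasure lborel ((\<Union>(a, b)\<in>D. {a..b}) - A) \<le> emeasure lborel (W - A)"
    unfolding D_Union using A(1) W(1) by (intro emeasure_mono) auto
  moreover have "measure lborel Y < e" if "emeasure lborel Y < ennreal e" for Y :: "real set"
    using that by (cases "emeasure lborel Y") (auto simp: measure_def ennreal_less_iff)
  moreover have "finite D" using X(2) by (simp add: D_def)
  ultimately show thesis using that[of D] V(3) W(3) by (meson le_less_trans)
qed

locale vanishing_discrepancy =
  fixes F :: "nat \<Rightarrow> real set \<Rightarrow> real" and C :: real
  assumes nonneg: "F k A \<ge> 0"
    and le_lborel: "A \<in> sets borel \<Longrightarrow> bounded A \<Longrightarrow> F k A \<le> C * measure lborel A"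
    and Un_le: "A \<in> sets borel \<Longrightarrow> bounded A \<Longrightarrow> B \<in> sets borel \<Longrightarrow> bounded B \<Longrightarrow> A \<inter> B = {} \<Longrightarrow>
      F k (A \<union> B) \<le> F k A + F k B"
    and part_le: "A \<in> sets borel \<Longrightarrow> bounded A \<Longrightarrow> B \<in> sets borel \<Longrightarrow> bounded B \<Longrightarrow> A \<inter> B = {} \<Longrightarrow>
      F k A \<le> F k (A \<union> B) + F k B"
    and Icc_tendsto: "a \<le> b \<Longrightarrow> (\<lambda>k. F k {a..b}) \<longlonglongrightarrow> 0"
begin

lemma empty [simp]: "F k {} = 0"
  using le_lborel[of "{}" k] nonneg[of k "{}"] by simp

lemma Icc_Union_tendsto:
  assumes "finite D"
  shows "(\<lambda>k. F k (\<Union>(a, b)\<in>D. {a..b})) \<longlonglongrightarrow> 0"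
  using assms
proof (induction "card D" arbitrary: D rule: less_induct)
  case less
  let ?U = "\<lambda>D. \<Union>(a, b)\<in>D. {a..b}"
  have U: "?U D \<in> sets borel" "bounded (?U D)" if "finite D" for D :: "(real \<times> real) set"
    using that by (auto intro!: bounded_UN)
  show ?case
  proof (cases "D = {}")
    case False
    then obtain a b D' where D: "D = insert (a, b) D'" "(a, b) \<notin> D'" by (metis ex_in_conv mk_disjoint_insert surj_pair)
    define D'' where "D'' = (\<lambda>(c, d). (max a c, min b d)) ` D'"
    have fin: "finite D'" "finite D''" using less.prems by (auto simp: D D''_def)
    have Int: "?U D' \<inter> {a..b} = ?U D''" by (auto simp: D''_def)
    have "card D'' \<le> card D'" "card D' < card D"
      using fin D by (auto simp: D''_def intro: card_image_le)
    then have lim: "(\<lambda>k. F k (?U D')) \<longlonglongrightarrow> 0" "(\<lambda>k. F k (?U D'')) \<longlonglongrightarrow> 0"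
      using less.hyps fin by auto
    have Icc: "(\<lambda>k. F k {a..b}) \<longlonglongrightarrow> 0"
      using Icc_tendsto[of a b] by (cases "a \<le> b") auto
    have union_le: "norm (F k (?U D)) \<le> F k {a..b} + (F k (?U D') + F k (?U D''))" for k
    proof -
      have "F k (?U D) = F k ({a..b} \<union> (?U D' - {a..b}))" by (rule arg_cong) (auto simp: D)
      also have "\<dots> \<le> F k {a..b} + F k (?U D' - {a..b})"
        using U[OF fin(1)] by (intro Un_le) (auto intro: bounded_diff)
      also have "F k (?U D' - {a..b}) \<le> F k ((?U D' - {a..b}) \<union> ?U D' \<inter> {a..b}) + F k (?U D' \<inter> {a..b})"
        using U[OF fin(1)] by (intro part_le) (auto intro: bounded_diff bounded_Int)
      also have "(?U D' - {a..b}) \<union> ?U D' \<inter> {a..b} = ?U D'" by blast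
      finally show ?thesis unfolding Int by (simp add: nonneg)
    qed
    have "(\<lambda>k. F k {a..b} + (F k (?U D') + F k (?U D''))) \<longlonglongrightarrow> 0"
      using tendsto_add[OF Icc tendsto_add[OF lim]] by simp
    from Lim_null_comparison[OF always_eventually[OF allI[OF union_le]] this] show ?thesis .
  qed simp
qed

theorem tendsto_0:
  assumes A: "A \<in> sets borel" "bounded A"
  shows "(\<lambda>k. F k A) \<longlonglongrightarrow> 0"
proof (rule LIMSEQ_I)
  fix d :: real assume d: "d > 0"
  define e where "e = d / (3 * (\<bar>C\<bar> + 1))"
  have e: "e > 0" "\<bar>C\<bar> * e \<le> d / 3" using d by (auto simp: e_def field_simps)
  obtain D where D: "finite D" and small:
      "measure lborel (A - (\<Union>(a, b)\<in>D. {a..b})) < e" "measure lborel ((\<Union>(a, b)\<in>D. {a..b}) - A) < e"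
    using borel_approx_by_Icc_union[OF A e(1)] by blast
  define V where "V = (\<Union>(a, b)\<in>D. {a..b})"
  have V: "V \<in> sets borel" "bounded V" unfolding V_def using D by (auto intro!: bounded_UN)
  have F_small: "F k X \<le> d / 3" if "X \<in> sets borel" "bounded X" "measure lborel X < e" for k X
  proof -
    have "F k X \<le> \<bar>C\<bar> * measure lborel X"
      using le_lborel[OF that(1,2), of k] by (rule order.trans) (intro mult_right_mono, auto)
    also have "\<dots> \<le> \<bar>C\<bar> * e" using that by (intro mult_left_mono) auto
    finally show ?thesis using e by linarith
  qed
  have F_le: "F k A \<le> F k V + 2 * (d / 3)" for k
  proof -
    have partition: "A \<inter> V \<union> (A - V) = A" "A \<inter> V \<union> (V - A) = V" by blast+
    have "F k A \<le> F k (A \<inter> V) + F k (A - V)"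
      using Un_le[of "A \<inter> V" "A - V" k] A V unfolding partition by (auto intro: bounded_Int bounded_diff)
    moreover have "F k (A \<inter> V) \<le> F k V + F k (V - A)"
      using part_le[of "A \<inter> V" "V - A" k] A V unfolding partition by (auto intro: bounded_Int bounded_diff)
    moreover have "F k (A - V) \<le> d / 3" "F k (V - A) \<le> d / 3"
      using F_small[of "A - V" k] F_small[of "V - A" k] A V small[folded V_def] by (auto intro: bounded_diff)
    ultimately show ?thesis by linarith
  qed
  have "(\<lambda>k. F k V) \<longlonglongrightarrow> 0" unfolding V_def by (rule Icc_Union_tendsto[OF D])
  then have "\<forall>\<^sub>F k in sequentially. F k V < d / 3" using d by (intro order_tendstoD) auto
  then have "\<forall>\<^sub>F k in sequentially. norm (F k A - 0) < d"
  proof eventually_elim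
    case (elim k)
    then show ?case using F_le[of k] nonneg[of k A] by simp
  qed
  then show "\<exists>no. \<forall>k\<ge>no. norm (F k A - 0) < d" by (simp add: eventually_sequentially)
qed

end

section \<open>Wegner and Minami estimates\<close>

context matrix_kernel
begin

lemma sum_Im_green:
  assumes y: "y > 0"
  shows "(\<Sum>x<N. Im (green {..<N} a w (Complex E y) x x)) = (\<Sum>i<N. poisson_kernel y E (eigval N a w i))"
proof -
  obtain u where ue: "eigensystem {..<N} a w u (eigval N a w)" using eigensystem_eigval by blast
  have "(\<Sum>x<N. Im (green {..<N} a w (Complex E y) x x)) = Im (\<Sum>x<N. green {..<N} a w (Complex E y) x x)"
    by simp
  also have "\<dots> = (\<Sum>i<N. Im (1 / (of_real (eigval N a w i) - Complex E y)))"
    using y by (subst trace_green[OF ue]) auto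
  also have "\<dots> = (\<Sum>i<N. poisson_kernel y E (eigval N a w i))" by (simp only: Im_resolvent_kernel)
  finally show ?thesis .
qed

lemma eig_count_le_sum_Im_green:
  assumes y: "y > 0"
  shows "real (eig_count N a w {E - y..E + y}) \<le> 2 * y * (\<Sum>x<N. Im (green {..<N} a w (Complex E y) x x))"
proof -
  let ?e = "eigval N a w"
  obtain u where ue: "eigensystem {..<N} a w u ?e" using eigensystem_eigval by blast
  have "real (eig_count N a w {E - y..E + y}) = (\<Sum>i\<in>{i. i < N \<and> ?e i \<in> {E - y..E + y}}. 1)"
    unfolding eig_count_eigensystem[OF ue] by simp
  also have "\<dots> \<le> (\<Sum>i\<in>{i. i < N \<and> ?e i \<in> {E - y..E + y}}. 2 * y * poisson_kernel y E (?e i))"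
    using y by (intro sum_mono poisson_kernel_ge) (auto simp: abs_le_iff)
  also have "\<dots> \<le> (\<Sum>i<N. 2 * y * poisson_kernel y E (?e i))"
    using y by (intro sum_mono2) (auto simp: poisson_kernel_nonneg)
  also have "\<dots> = 2 * y * (\<Sum>x<N. Im (green {..<N} a w (Complex E y) x x))"
    by (simp only: sum_Im_green[OF y] sum_distrib_left)
  finally show ?thesis .
qed

end

definition empirical_spectrum :: "nat \<Rightarrow> (nat \<Rightarrow> nat \<Rightarrow> real) \<Rightarrow> (nat \<Rightarrow> real) \<Rightarrow> real measure" where
  "empirical_spectrum N a w = distr (measure_pmf (pmf_of_set {..<N})) borel (eigval N a w)"

lemma sets_empirical_spectrum [simp]: "sets (empirical_spectrum N a w) = sets borel"
  by (simp add: empirical_spectrum_def)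

lemma prob_space_empirical_spectrum: "prob_space (empirical_spectrum N a w)"
  unfolding empirical_spectrum_def by (rule prob_space.prob_space_distr) (auto intro: prob_space_measure_pmf)

lemma nn_integral_empirical_spectrum:
  assumes N: "N > 0" and [measurable]: "f \<in> borel_measurable borel"
  shows "(\<integral>\<^sup>+t. f t \<partial>empirical_spectrum N a w) = (\<Sum>i<N. f (eigval N a w i)) / ennreal (real N)"
proof -
  have "{..<N} \<noteq> {}" using N by auto
  then show ?thesis unfolding empirical_spectrum_def
    by (simp add: nn_integral_distr nn_integral_pmf_of_set ennreal_of_nat_eq_real_of_nat)
qed

lemma (in matrix_kernel) emeasure_empirical_spectrum:
  assumes N: "N > 0" and A: "A \<in> sets borel"
  shows "emeasure (empirical_spectrum N a w) A = ennreal (real (eig_count N a w A) / real N)"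
proof -
  obtain u where ue: "eigensystem {..<N} a w u (eigval N a w)" using eigensystem_eigval by blast
  have "{..<N} \<noteq> {}" using N by auto
  moreover have "{..<N} \<inter> eigval N a w -` A = {i. i < N \<and> eigval N a w i \<in> A}" by auto
  ultimately show ?thesis unfolding empirical_spectrum_def using A eig_count_eigensystem[OF ue]
    by (simp add: emeasure_distr emeasure_pmf_of_set)
qed

locale anderson =
  fixes \<gamma> :: "real \<Rightarrow> real" and \<Gamma> :: real
  assumes gamma_meas [measurable]: "\<gamma> \<in> borel_measurable borel"
    and gamma_nonneg: "\<gamma> t \<ge> 0" and gamma_le: "\<gamma> t \<le> \<Gamma>"
    and gamma_prob: "(\<integral>\<^sup>+ t. ennreal (\<gamma> t) \<partial>lborel) = 1"
begin

definition site_measure :: "real measure" where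
  "site_measure = density lborel (\<lambda>t. ennreal (\<gamma> t))"

definition M :: "(nat \<Rightarrow> real) measure" where
  "M = PiM UNIV (\<lambda>_. site_measure)"

lemma \<Gamma>_nonneg: "\<Gamma> \<ge> 0"
  using gamma_nonneg[of 0] gamma_le[of 0] by linarith

lemma sets_site_measure [measurable_cong, simp]: "sets site_measure = sets borel"
  and space_site_measure [simp]: "space site_measure = UNIV"
  by (simp_all add: site_measure_def)

lemma prob_space_site_measure: "prob_space site_measure"
  by (rule prob_spaceI) (simp add: site_measure_def emeasure_density gamma_prob)

sublocale site: prob_space site_measure by (rule prob_space_site_measure)

sublocale seq: sequence_space site_measure ..

lemma prob_space_M: "prob_space M"
  unfolding M_def by (rule prob_space_PiM) (rule prob_space_site_measure)

sublocale M: prob_space M by (rule prob_space_M)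

lemma sets_M: "sets M = sets borel"
proof -
  have "sets M = sets (PiM UNIV (\<lambda>_::nat. borel :: real measure))"
    unfolding M_def by (rule sets_PiM_cong) auto
  also have "\<dots> = sets borel" by (rule sets_PiM_equal_borel)
  finally show ?thesis .
qed

lemma space_M [simp]: "space M = UNIV"
  by (simp add: M_def space_PiM PiE_UNIV_domain)

lemma measurable_M_iff: "f \<in> measurable M N \<longleftrightarrow> f \<in> measurable borel N"
  using measurable_cong_sets[OF sets_M refl] by blast

lemma measurable_fun_upd_M:
  assumes "f \<in> measurable K M" "g \<in> measurable K borel"
  shows "(\<lambda>s. (f s)(x := g s)) \<in> measurable K M"
proof -
  have "g \<in> measurable K site_measure" using assms(2) measurable_cong_sets[OF refl sets_site_measure] by blast
  then show ?thesis using assms unfolding M_def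
    by (intro measurable_fun_upd[where J = UNIV]) auto
qed

lemma nn_integral_split_coordinate:
  fixes x :: nat
  assumes [measurable]: "F \<in> borel_measurable M"
  shows "(\<integral>\<^sup>+w. F w \<partial>M) =
    (\<integral>\<^sup>+X. (\<integral>\<^sup>+v. F (X(x := v)) \<partial>site_measure) \<partial>PiM (UNIV - {x}) (\<lambda>_. site_measure))"
proof -
  let ?M' = "PiM (UNIV - {x}) (\<lambda>_. site_measure)" and ?upd = "\<lambda>(v, X). X(x := v)"
  interpret M': prob_space ?M' by (rule prob_space_PiM) (rule prob_space_site_measure)
  interpret pair_sigma_finite site_measure ?M' ..
  have "distr (site_measure \<Otimes>\<^sub>M ?M') (PiM (insert x (UNIV - {x})) (\<lambda>_. site_measure)) ?upd =
      PiM (insert x (UNIV - {x})) (\<lambda>_. site_measure)"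
    by (rule distr_pair_PiM_eq_PiM) (rule prob_space_site_measure)+
  then have distr: "distr (site_measure \<Otimes>\<^sub>M ?M') M ?upd = M" by (simp add: M_def insert_Diff_if)
  have [measurable]: "?upd \<in> measurable (site_measure \<Otimes>\<^sub>M ?M') M"
    unfolding M_def split_beta' by (intro measurable_fun_upd[where J = "UNIV - {x}"]) auto
  have "(\<integral>\<^sup>+w. F w \<partial>M) = (\<integral>\<^sup>+w. F w \<partial>distr (site_measure \<Otimes>\<^sub>M ?M') M ?upd)" unfolding distr ..
  also have "\<dots> = (\<integral>\<^sup>+p. F (?upd p) \<partial>(site_measure \<Otimes>\<^sub>M ?M'))" by (rule nn_integral_distr) measurable
  also have "\<dots> = (\<integral>\<^sup>+X. (\<integral>\<^sup>+v. F (?upd (v, X)) \<partial>site_measure) \<partial>?M')"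
    by (rule nn_integral_snd[symmetric]) measurable
  finally show ?thesis by simp
qed

lemma measurable_resample:
  assumes [measurable]: "F \<in> borel_measurable M"
  shows "(\<lambda>w. \<integral>\<^sup>+v. F (w(x := v)) \<partial>site_measure) \<in> borel_measurable M"
proof -
  have [measurable]: "(\<lambda>p. (fst p)(x := snd p)) \<in> measurable (M \<Otimes>\<^sub>M site_measure) M"
    by (rule measurable_fun_upd_M) auto
  show ?thesis by measurable
qed

lemma nn_integral_resample:
  assumes [measurable]: "F \<in> borel_measurable M"
  shows "(\<integral>\<^sup>+w. F w \<partial>M) = (\<integral>\<^sup>+w. (\<integral>\<^sup>+v. F (w(x := v)) \<partial>site_measure) \<partial>M)"
proof -
  have "(\<integral>\<^sup>+w. (\<integral>\<^sup>+v. F (w(x := v)) \<partial>site_measure) \<partial>M) =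
     (\<integral>\<^sup>+X. (\<integral>\<^sup>+v'. (\<integral>\<^sup>+v. F ((X(x := v'))(x := v)) \<partial>site_measure) \<partial>site_measure)
       \<partial>PiM (UNIV - {x}) (\<lambda>_. site_measure))"
    by (rule nn_integral_split_coordinate[OF measurable_resample[OF assms]])
  also have "\<dots> = (\<integral>\<^sup>+X. (\<integral>\<^sup>+v. F (X(x := v)) \<partial>site_measure) \<partial>PiM (UNIV - {x}) (\<lambda>_. site_measure))"
    using site.emeasure_space_1 by simp
  also have "\<dots> = (\<integral>\<^sup>+w. F w \<partial>M)" by (rule nn_integral_split_coordinate[symmetric]) measurable
  finally show ?thesis by simp
qed

text \<open>The factor \<open>F\<close> is dominated by a quantity from which the coordinate \<open>x\<close> has been resampled, so
  that the coordinate \<open>x\<close> can be averaged in the factor \<open>G\<close> alone.\<close>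
lemma nn_integral_mult_le_decoupled:
  fixes F G H :: "(nat \<Rightarrow> real) \<Rightarrow> ennreal"
  assumes [measurable]: "G \<in> borel_measurable M" "H \<in> borel_measurable M"
    and avg: "\<And>w. (\<integral>\<^sup>+v. G (w(x := v)) \<partial>site_measure) \<le> K"
    and F_le: "\<And>w v. F w \<le> H (w(x := v))"
  shows "(\<integral>\<^sup>+w. G w * F w \<partial>M) \<le> K * (\<integral>\<^sup>+w. H w \<partial>M)"
proof -
  define R where "R w = (\<integral>\<^sup>+v. H (w(x := v)) \<partial>site_measure)" for w
  have [measurable]: "R \<in> borel_measurable M" unfolding R_def by (rule measurable_resample) measurable
  have R_upd: "R (w(x := v)) = R w" for w v by (simp add: R_def)
  have FR: "F w \<le> R w" for w
  proof -
    have "F w = (\<integral>\<^sup>+v. F w \<partial>site_measure)" using site.emeasure_space_1 by simp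
    also have "\<dots> \<le> R w" unfolding R_def by (intro nn_integral_mono F_le)
    finally show ?thesis .
  qed
  have "(\<integral>\<^sup>+w. G w * F w \<partial>M) \<le> (\<integral>\<^sup>+w. G w * R w \<partial>M)"
    by (intro nn_integral_mono mult_left_mono FR) auto
  also have "\<dots> = (\<integral>\<^sup>+w. (\<integral>\<^sup>+v. G (w(x := v)) * R (w(x := v)) \<partial>site_measure) \<partial>M)"
    by (rule nn_integral_resample) measurable
  also have "\<dots> = (\<integral>\<^sup>+w. (\<integral>\<^sup>+v. G (w(x := v)) \<partial>site_measure) * R w \<partial>M)"
  proof (rule nn_integral_cong)
    fix w
    have "(\<lambda>v. w(x := v)) \<in> measurable site_measure M" by (rule measurable_fun_upd_M) auto
    then have "(\<lambda>v. G (w(x := v))) \<in> borel_measurable site_measure"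
      by (rule measurable_compose) measurable
    then show "(\<integral>\<^sup>+v. G (w(x := v)) * R (w(x := v)) \<partial>site_measure) = (\<integral>\<^sup>+v. G (w(x := v)) \<partial>site_measure) * R w"
      unfolding R_upd by (rule nn_integral_multc)
  qed
  also have "\<dots> \<le> (\<integral>\<^sup>+w. K * R w \<partial>M)" by (intro nn_integral_mono mult_right_mono avg) auto
  also have "\<dots> = K * (\<integral>\<^sup>+w. R w \<partial>M)" by (rule nn_integral_cmult) measurable
  also have "(\<integral>\<^sup>+w. R w \<partial>M) = (\<integral>\<^sup>+w. H w \<partial>M)"
    unfolding R_def by (rule nn_integral_resample[symmetric]) measurable
  finally show ?thesis .
qed

lemma distr_reindex:
  assumes "inj f"
  shows "distr M M (\<lambda>w i. w (f i)) = M"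
  using distr_PiM_reindex[of UNIV "\<lambda>_. site_measure" f UNIV] assms prob_space_site_measure
  by (simp add: M_def restrict_UNIV)

lemma measurable_reindex: "(\<lambda>w i. w (f i)) \<in> measurable M M"
proof -
  have "(\<lambda>w i. w (f i)) \<in> measurable (PiM UNIV (\<lambda>_. site_measure)) (PiM UNIV (\<lambda>_. site_measure))"
    by (rule measurable_PiM_single') (auto simp: space_PiM)
  then show ?thesis by (simp add: M_def)
qed

lemma nn_integral_reindex:
  assumes "F \<in> borel_measurable M" "inj f"
  shows "(\<integral>\<^sup>+w. F (\<lambda>i. w (f i)) \<partial>M) = (\<integral>\<^sup>+w. F w \<partial>M)"
proof -
  have "(\<integral>\<^sup>+w. F w \<partial>M) = (\<integral>\<^sup>+w. F w \<partial>distr M M (\<lambda>w i. w (f i)))" unfolding distr_reindex[OF assms(2)] ..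
  also have "\<dots> = (\<integral>\<^sup>+w. F (\<lambda>i. w (f i)) \<partial>M)"
    by (rule nn_integral_distr[OF measurable_reindex]) (simp add: assms(1))
  finally show ?thesis by simp
qed

lemma measurable_green:
  assumes "symmetric_kernel S a" "Im z > 0" "x \<in> S" "y \<in> S"
  shows "(\<lambda>w. green S a w z x y) \<in> borel_measurable M"
  unfolding measurable_M_iff
  by (intro borel_measurable_continuous_onI symmetric_kernel.continuous_on_green assms)

text \<open>As a function of the potential at \<open>x\<close>, the imaginary part of the Green function is a Poisson kernel.\<close>
lemma spectral_averaging:
  assumes "symmetric_kernel S a" and z: "Im z > 0" and x: "x \<in> S"
  shows "(\<integral>\<^sup>+v. ennreal (Im (green S a (w(x := v)) z x x)) \<partial>site_measure) \<le> ennreal (pi * \<Gamma>)"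
proof -
  interpret symmetric_kernel S a by fact
  define g where "g = green S a (w(x := 0)) z x x"
  define y where "y = - Im (1 / g)"
  define r where "r = - Re (1 / g)"
  have "Im g > 0" unfolding g_def by (rule Im_green_pos[OF z x])
  then have y: "y > 0" unfolding y_def Im_divide by (auto simp: divide_pos_pos add_nonneg_pos)
  have "Im (green S a (w(x := v)) z x x) = poisson_kernel y r v" for v
  proof -
    have "complex_of_real v + 1 / g = of_real v - Complex r y"
      by (simp add: complex_eq_iff y_def r_def)
    then show ?thesis
      unfolding green_rank_one[OF z x, of w v] g_def[symmetric] by (simp only: Im_resolvent_kernel)
  qed
  then have "(\<integral>\<^sup>+v. ennreal (Im (green S a (w(x := v)) z x x)) \<partial>site_measure) =
     (\<integral>\<^sup>+v. ennreal (\<gamma> v) * ennreal (poisson_kernel y r v) \<partial>lborel)"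
    unfolding site_measure_def by (simp add: nn_integral_density)
  also have "\<dots> \<le> (\<integral>\<^sup>+v. ennreal \<Gamma> * ennreal (poisson_kernel y v r) \<partial>lborel)"
    using gamma_le by (intro nn_integral_mono mult_mono ennreal_leI) (auto simp: poisson_kernel_commute)
  also have "\<dots> = ennreal \<Gamma> * (\<integral>\<^sup>+v. ennreal (poisson_kernel y v r) \<partial>lborel)"
    by (rule nn_integral_cmult) measurable
  also have "\<dots> \<le> ennreal \<Gamma> * ennreal pi"
    by (intro mult_left_mono nn_integral_poisson_kernel_le y) auto
  also have "\<dots> = ennreal (pi * \<Gamma>)" using \<Gamma>_nonneg by (simp add: ennreal_mult mult.commute)
  finally show ?thesis .
qed

lemma nn_integral_Im_green_le:
  assumes "symmetric_kernel S a" and z: "Im z > 0" and x: "x \<in> S"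
  shows "(\<integral>\<^sup>+w. ennreal (Im (green S a w z x x)) \<partial>M) \<le> ennreal (pi * \<Gamma>)"
proof -
  have [measurable]: "(\<lambda>w. green S a w z x x) \<in> borel_measurable M" by (rule measurable_green) fact+
  have "(\<integral>\<^sup>+w. ennreal (Im (green S a w z x x)) \<partial>M) =
      (\<integral>\<^sup>+w. (\<integral>\<^sup>+v. ennreal (Im (green S a (w(x := v)) z x x)) \<partial>site_measure) \<partial>M)"
    by (rule nn_integral_resample) measurable
  also have "\<dots> \<le> (\<integral>\<^sup>+w. ennreal (pi * \<Gamma>) \<partial>M)"
    by (intro nn_integral_mono spectral_averaging assms)
  also have "\<dots> = ennreal (pi * \<Gamma>)" using M.emeasure_space_1 by simp
  finally show ?thesis .
qed

end

locale anderson_matrix = anderson + matrix_kernel +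
  assumes N_pos: "N > 0"
begin

lemma measurable_empirical_spectrum: "empirical_spectrum N a \<in> measurable M (prob_algebra borel)"
proof (rule measurable_prob_algebra_generated)
  show "sets borel = sigma_sets UNIV (range (\<lambda>(a, b). {a..b :: real}))"
    by (subst borel_eq_atLeastAtMost) simp
  show "Int_stable (range (\<lambda>(a, b). {a..b :: real}))" by (auto simp: Int_stable_def)
  fix A assume "A \<in> range (\<lambda>(a, b). {a..b :: real})"
  then obtain p q where A: "A = {p..q}" by auto
  have ge: "{w. m \<le> eig_count N a w {p..q}} \<in> sets M" for m
    unfolding sets_M by (intro borel_closed closed_eig_count_ge)
  have "(\<lambda>w. eig_count N a w {p..q}) -` {m} \<inter> space M \<in> sets M" for m
  proof -
    have "(\<lambda>w. eig_count N a w {p..q}) -` {m} \<inter> space M =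
        {w. m \<le> eig_count N a w {p..q}} - {w. Suc m \<le> eig_count N a w {p..q}}" by auto
    then show ?thesis using ge by auto
  qed
  then have "(\<lambda>w. eig_count N a w {p..q}) \<in> measurable M (count_space UNIV)"
    by (intro measurable_count_space_eq2_countable[THEN iffD2]) auto
  then have "(\<lambda>w. real (eig_count N a w {p..q})) \<in> borel_measurable M"
    by (rule measurable_compose) simp
  then show "(\<lambda>w. emeasure (empirical_spectrum N a w) A) \<in> borel_measurable M"
    unfolding A by (simp add: emeasure_empirical_spectrum N_pos)
qed (auto simp: prob_space_empirical_spectrum)

lemma empirical_spectrum_subprob: "empirical_spectrum N a \<in> measurable M (subprob_algebra borel)"
  by (rule measurable_prob_algebraD[OF measurable_empirical_spectrum])

lemma measurable_eig_count:
  assumes A: "A \<in> sets borel"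
  shows "(\<lambda>w. eig_count N a w A) \<in> measurable M (count_space UNIV)"
proof -
  let ?f = "\<lambda>w. ennreal (real (eig_count N a w A) / real N)"
  have meas: "?f \<in> borel_measurable M"
    using measurable_emeasure_kernel[OF empirical_spectrum_subprob A]
    unfolding emeasure_empirical_spectrum[OF N_pos A] .
  have "(\<lambda>w. eig_count N a w A) -` {m} \<inter> space M \<in> sets M" for m
  proof -
    have "(\<lambda>w. eig_count N a w A) -` {m} \<inter> space M = ?f -` {ennreal (real m / real N)} \<inter> space M"
      using N_pos by (auto simp: ennreal_inj)
    also have "\<dots> \<in> sets M" by (rule measurable_sets[OF meas]) simp
    finally show ?thesis .
  qed
  then show ?thesis by (intro measurable_count_space_eq2_countable[THEN iffD2]) auto
qed

lemma borel_measurable_eig_count [measurable]: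
  "A \<in> sets borel \<Longrightarrow> (\<lambda>w. real (eig_count N a w A)) \<in> borel_measurable M"
  by (rule measurable_compose[OF measurable_eig_count]) simp_all

lemma integrable_eig_count: "A \<in> sets borel \<Longrightarrow> integrable M (\<lambda>w. real (eig_count N a w A))"
  using eig_count_le by (intro M.integrable_const_bound[of _ "real N"]) auto

definition dos :: "real measure" where
  "dos = M \<bind> empirical_spectrum N a"

lemma sets_dos [simp]: "sets dos = sets borel"
  unfolding dos_def by (rule sets_bind) auto

lemma prob_space_dos: "prob_space dos"
  unfolding dos_def
  by (rule M.prob_space_bind[OF _ empirical_spectrum_subprob]) (simp add: prob_space_empirical_spectrum)

lemma expectation_eig_count:
  assumes A: "A \<in> sets borel"
  shows "(\<integral>w. real (eig_count N a w A) \<partial>M) = real N * measure dos A"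
proof -
  have "emeasure dos A = (\<integral>\<^sup>+w. ennreal (real (eig_count N a w A) / real N) \<partial>M)"
    unfolding dos_def using A
    by (subst emeasure_bind[OF _ empirical_spectrum_subprob]) (auto simp: emeasure_empirical_spectrum N_pos)
  also have "\<dots> = ennreal (\<integral>w. real (eig_count N a w A) / real N \<partial>M)"
    using A by (intro nn_integral_eq_integral integrable_divide integrable_eig_count) auto
  finally have "measure dos A = (\<integral>w. real (eig_count N a w A) / real N \<partial>M)"
    by (simp add: measure_def Bochner_Integration.integral_nonneg)
  then show ?thesis using N_pos by simp
qed

lemma measurable_Im_green:
  assumes "y > 0" "x < N"
  shows "(\<lambda>w. Im (green {..<N} a w (Complex E y) x x)) \<in> borel_measurable M"
proof -
  have [measurable]: "(\<lambda>w. green {..<N} a w (Complex E y) x x) \<in> borel_measurable M"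
    using assms by (intro measurable_green symmetric_kernel_axioms) auto
  show ?thesis by measurable
qed

lemma Im_green_nonneg: "y > 0 \<Longrightarrow> x < N \<Longrightarrow> Im (green {..<N} a w (Complex E y) x x) \<ge> 0"
  using Im_green_pos[of "Complex E y" x w] by simp

lemma nn_integral_poisson_kernel_dos:
  assumes y: "y > 0"
  shows "(\<integral>\<^sup>+t. ennreal (poisson_kernel y E t) \<partial>dos) =
    (\<Sum>x<N. \<integral>\<^sup>+w. ennreal (Im (green {..<N} a w (Complex E y) x x)) \<partial>M) / ennreal (real N)"
proof -
  let ?G = "\<lambda>x w. ennreal (Im (green {..<N} a w (Complex E y) x x))"
  have meas: "?G x \<in> borel_measurable M" if "x < N" for x
    by (rule measurable_compose[OF measurable_Im_green[OF y that] measurable_ennreal])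
  have "(\<integral>\<^sup>+t. ennreal (poisson_kernel y E t) \<partial>empirical_spectrum N a w) = (\<Sum>x<N. ?G x w) / ennreal (real N)" for w
  proof -
    have "(\<integral>\<^sup>+t. ennreal (poisson_kernel y E t) \<partial>empirical_spectrum N a w) =
        ennreal (\<Sum>i<N. poisson_kernel y E (eigval N a w i)) / ennreal (real N)"
      using N_pos y by (subst nn_integral_empirical_spectrum) (auto simp: poisson_kernel_nonneg sum_ennreal)
    also have "ennreal (\<Sum>i<N. poisson_kernel y E (eigval N a w i)) = (\<Sum>x<N. ?G x w)"
      unfolding sum_Im_green[OF y, symmetric] using Im_green_nonneg[OF y] by (intro sum_ennreal[symmetric]) auto
    finally show ?thesis .
  qed
  moreover have "(\<lambda>t. ennreal (poisson_kernel y E t)) \<in> borel_measurable borel" by measurable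
  ultimately have "(\<integral>\<^sup>+t. ennreal (poisson_kernel y E t) \<partial>dos) = (\<integral>\<^sup>+w. (\<Sum>x<N. ?G x w) / ennreal (real N) \<partial>M)"
    unfolding dos_def by (simp add: nn_integral_bind[OF _ empirical_spectrum_subprob])
  also have "\<dots> = (\<integral>\<^sup>+w. (\<Sum>x<N. ?G x w) \<partial>M) / ennreal (real N)"
    using meas by (intro nn_integral_divide borel_measurable_sum) auto
  also have "(\<integral>\<^sup>+w. (\<Sum>x<N. ?G x w) \<partial>M) = (\<Sum>x<N. \<integral>\<^sup>+w. ?G x w \<partial>M)"
    using meas by (intro nn_integral_sum) auto
  finally show ?thesis .
qed

lemma nn_integral_poisson_kernel_dos_le:
  assumes y: "y > 0"
  shows "(\<integral>\<^sup>+t. ennreal (poisson_kernel y E t) \<partial>dos) \<le> ennreal (pi * \<Gamma>)"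
proof -
  have "(\<integral>\<^sup>+t. ennreal (poisson_kernel y E t) \<partial>dos) \<le> (\<Sum>x<N. ennreal (pi * \<Gamma>)) / ennreal (real N)"
    unfolding nn_integral_poisson_kernel_dos[OF y]
    using y by (intro divide_right_mono_ennreal sum_mono nn_integral_Im_green_le symmetric_kernel_axioms) auto
  also have "\<dots> = ennreal (pi * \<Gamma>) * ennreal (real N) / ennreal (real N)"
    by (simp add: ennreal_of_nat_eq_real_of_nat mult.commute)
  also have "\<dots> = ennreal (pi * \<Gamma>)" using N_pos by (simp add: ennreal_mult_divide_eq)
  finally show ?thesis .
qed

theorem Wegner_estimate:
  assumes "A \<in> sets borel"
  shows "emeasure dos A \<le> ennreal \<Gamma> * emeasure lborel A"
proof (rule emeasure_le_of_poisson_bound)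
  show "finite_measure dos" using prob_space_dos by (simp add: prob_space_def)
qed (use assms nn_integral_poisson_kernel_dos_le \<Gamma>_nonneg in auto)

corollary expectation_eig_count_le:
  assumes A: "A \<in> sets borel" "emeasure lborel A < \<infinity>"
  shows "(\<integral>w. real (eig_count N a w A) \<partial>M) \<le> real N * (\<Gamma> * measure lborel A)"
proof -
  interpret prob_space dos by (rule prob_space_dos)
  have "ennreal (measure dos A) \<le> ennreal (\<Gamma> * measure lborel A)"
    using Wegner_estimate[OF A(1)] A(2) \<Gamma>_nonneg
    by (simp add: emeasure_eq_measure emeasure_eq_ennreal_measure ennreal_mult)
  then have "measure dos A \<le> \<Gamma> * measure lborel A" using \<Gamma>_nonneg by simp
  then show ?thesis unfolding expectation_eig_count[OF A(1)] by (rule mult_left_mono) simp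
qed

lemma nn_integral_Im_green_eig_count_le:
  assumes y: "y > 0" and x: "x < N"
  shows "(\<integral>\<^sup>+w. ennreal (Im (green {..<N} a w (Complex E y) x x)) * ennreal (real (eig_count N a w {E - y..E + y} - 1)) \<partial>M)
    \<le> ennreal (pi * \<Gamma>) * ennreal (real N * (\<Gamma> * (2 * y)))"
proof -
  let ?c = "\<lambda>w. eig_count N a w {E - y..E + y}"
  have "(\<integral>\<^sup>+w. ennreal (Im (green {..<N} a w (Complex E y) x x)) * ennreal (real (?c w - 1)) \<partial>M)
      \<le> ennreal (pi * \<Gamma>) * (\<integral>\<^sup>+w. ennreal (real (?c w)) \<partial>M)"
  proof (rule nn_integral_mult_le_decoupled)
    show "(\<integral>\<^sup>+v. ennreal (Im (green {..<N} a (w(x := v)) (Complex E y) x x)) \<partial>site_measure) \<le> ennreal (pi * \<Gamma>)" for w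
      using y x by (intro spectral_averaging symmetric_kernel_axioms) auto
    show "ennreal (real (?c w - 1)) \<le> ennreal (real (?c (w(x := v))))" for w v
      using eig_count_rank_one[of w "E - y" "E + y" x v] by (intro ennreal_leI of_nat_mono) simp
  qed (use measurable_Im_green[OF y x] in measurable)
  also have "(\<integral>\<^sup>+w. ennreal (real (?c w)) \<partial>M) = ennreal (\<integral>w. real (?c w) \<partial>M)"
    by (intro nn_integral_eq_integral integrable_eig_count) auto
  also have "\<dots> \<le> ennreal (real N * (\<Gamma> * (2 * y)))"
    using expectation_eig_count_le[of "{E - y..E + y}"] y by (intro ennreal_leI) simp
  finally show ?thesis by (simp add: mult_left_mono)
qed

lemma eig_count_pairs_le:
  assumes y: "y > 0"
  shows "ennreal (real (eig_count N a w {E - y..E + y} * (eig_count N a w {E - y..E + y} - 1))) \<le>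
    ennreal (2 * y) * (\<Sum>x<N. ennreal (Im (green {..<N} a w (Complex E y) x x)) *
      ennreal (real (eig_count N a w {E - y..E + y} - 1)))"
proof -
  define c where "c = eig_count N a w {E - y..E + y}"
  define G where "G x = Im (green {..<N} a w (Complex E y) x x)" for x
  have G_nonneg: "G x \<ge> 0" if "x < N" for x unfolding G_def by (rule Im_green_nonneg[OF y that])
  have "real (c * (c - 1)) \<le> (2 * y * (\<Sum>x<N. G x)) * real (c - 1)"
    unfolding of_nat_mult c_def G_def by (intro mult_right_mono eig_count_le_sum_Im_green y) simp
  then have "ennreal (real (c * (c - 1))) \<le> ennreal (2 * y * (\<Sum>x<N. G x * real (c - 1)))"
    by (intro ennreal_leI) (simp add: sum_distrib_right mult.assoc)
  also have "\<dots> = ennreal (2 * y) * (\<Sum>x<N. ennreal (G x * real (c - 1)))"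
    using y G_nonneg by (subst sum_ennreal) (auto intro!: ennreal_mult sum_nonneg)
  also have "(\<Sum>x<N. ennreal (G x * real (c - 1))) = (\<Sum>x<N. ennreal (G x) * ennreal (real (c - 1)))"
    using G_nonneg by (intro sum.cong refl ennreal_mult) auto
  finally show ?thesis unfolding c_def G_def .
qed

theorem Minami_estimate:
  assumes y: "y > 0"
  shows "(\<integral>\<^sup>+w. ennreal (real (eig_count N a w {E - y..E + y} * (eig_count N a w {E - y..E + y} - 1))) \<partial>M)
    \<le> ennreal (pi * (2 * y * \<Gamma> * real N)\<^sup>2)"
proof -
  define c where "c w = eig_count N a w {E - y..E + y}" for w
  define G where "G x w = Im (green {..<N} a w (Complex E y) x x)" for x w
  have meas: "(\<lambda>w. ennreal (G x w) * ennreal (real (c w - 1))) \<in> borel_measurable M" if "x < N" for x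
  proof -
    have [measurable]: "G x \<in> borel_measurable M" unfolding G_def by (rule measurable_Im_green[OF y that])
    have [measurable]: "c \<in> measurable M (count_space UNIV)" unfolding c_def by (rule measurable_eig_count) simp
    show ?thesis by measurable
  qed
  have "(\<integral>\<^sup>+w. ennreal (real (c w * (c w - 1))) \<partial>M) \<le>
     (\<integral>\<^sup>+w. ennreal (2 * y) * (\<Sum>x<N. ennreal (G x w) * ennreal (real (c w - 1))) \<partial>M)"
    unfolding c_def G_def by (intro nn_integral_mono eig_count_pairs_le y)
  also have "\<dots> = ennreal (2 * y) * (\<integral>\<^sup>+w. (\<Sum>x<N. ennreal (G x w) * ennreal (real (c w - 1))) \<partial>M)"
    using meas by (intro nn_integral_cmult borel_measurable_sum) auto
  also have "(\<integral>\<^sup>+w. (\<Sum>x<N. ennreal (G x w) * ennreal (real (c w - 1))) \<partial>M) =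
      (\<Sum>x<N. \<integral>\<^sup>+w. ennreal (G x w) * ennreal (real (c w - 1)) \<partial>M)"
    using meas by (intro nn_integral_sum) auto
  also have "ennreal (2 * y) * \<dots> \<le> ennreal (2 * y) * (\<Sum>x<N. ennreal (pi * \<Gamma>) * ennreal (real N * (\<Gamma> * (2 * y))))"
    unfolding G_def c_def using y by (intro mult_left_mono sum_mono nn_integral_Im_green_eig_count_le) auto
  also have "\<dots> = ennreal (pi * (2 * y * \<Gamma> * real N)\<^sup>2)"
    using y \<Gamma>_nonneg
    by (simp add: ennreal_of_nat_eq_real_of_nat power2_eq_square ac_simps flip: ennreal_mult)
  finally show ?thesis unfolding c_def .
qed

end

section \<open>The hierarchical Laplacian\<close>

definition hier_kernel :: "nat \<Rightarrow> (nat \<Rightarrow> real) \<Rightarrow> nat \<Rightarrow> nat \<Rightarrow> nat \<Rightarrow> real" where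
  "hier_kernel n p l x y = (\<Sum>s\<in>{1..l}. p s / real n ^ s * of_bool (x div n ^ s = y div n ^ s))"

lemma hier_kernel_sym: "hier_kernel n p l x y = hier_kernel n p l y x"
  by (simp only: hier_kernel_def eq_commute[of "x div _"])

lemma symmetric_kernel_hier_kernel: "finite S \<Longrightarrow> symmetric_kernel S (hier_kernel n p l)"
  by unfold_locales (auto simp: hier_kernel_sym)

lemma div_power_shift:
  assumes "s \<le> k" "n > 0"
  shows "(c * n ^ k + i) div n ^ s = c * n ^ (k - s) + i div (n::nat) ^ s"
proof -
  have "n ^ k = n ^ s * n ^ (k - s)" using assms(1) by (simp add: power_add[symmetric])
  then have regroup: "c * n ^ k + i = i + n ^ s * (c * n ^ (k - s))" by (simp only: ac_simps)
  show ?thesis unfolding regroup using assms(2) by simp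
qed

lemma hier_kernel_shift:
  "n > 0 \<Longrightarrow> l \<le> k \<Longrightarrow> hier_kernel n p l (c * n ^ k + i) (c * n ^ k + j) = hier_kernel n p l i j"
  by (simp add: hier_kernel_def div_power_shift)

lemma hHk_mat_eq_schroedinger_mat:
  assumes "n > 0"
  shows "hHk_mat n p x0 k w = schroedinger_mat (n ^ k) (hier_kernel n p k) (\<lambda>i. w (x0 div n ^ k * n ^ k + i))"
proof -
  let ?c = "x0 div n ^ k * n ^ k"
  have "(\<Sum>s\<in>{1..k}. p s / real n ^ s * (if (?c + i) div n ^ s = (?c + j) div n ^ s then 1 else 0)) =
      hier_kernel n p k i j" for i j
    unfolding hier_kernel_shift[OF assms order.refl, symmetric, of p k i j "x0 div n ^ k"]
    unfolding hier_kernel_def by (intro sum.cong) auto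
  then show ?thesis by (simp add: hHk_mat_def Let_def schroedinger_mat_def)
qed

lemma div_power_eq_mono:
  assumes "s \<le> r" "x div n ^ s = y div (n::nat) ^ s"
  shows "x div n ^ r = y div n ^ r"
proof -
  have "z div n ^ r = (z div n ^ s) div n ^ (r - s)" for z
    using assms(1) by (simp add: div_mult2_eq[symmetric] power_add[symmetric])
  then show ?thesis using assms(2) by simp
qed

lemma hball_eq_atLeastLessThan:
  assumes "n > 0"
  shows "hball n x r = {x div n ^ r * n ^ r..<x div n ^ r * n ^ r + n ^ r}"
proof -
  have "0 < n ^ r" using assms by simp
  then have "y div n ^ r = q \<longleftrightarrow> q * n ^ r \<le> y \<and> y < q * n ^ r + n ^ r" for y q
    using div_nat_eqI[of "n ^ r" q y] div_times_less_eq_dividend[of y "n ^ r"] dividend_less_div_times[of "n ^ r" y]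
    by (auto simp: mult.commute)
  then show ?thesis by (auto simp: hball_def)
qed

lemma finite_hball [simp]: "n > 0 \<Longrightarrow> finite (hball n x r)"
  by (simp add: hball_eq_atLeastLessThan)

lemma card_hball: "n > 0 \<Longrightarrow> card (hball n x r) = n ^ r"
  by (simp add: hball_eq_atLeastLessThan)

lemma hball_self [simp]: "x \<in> hball n x r"
  by (simp add: hball_def)

lemma hball_mono: "s \<le> r \<Longrightarrow> hball n x s \<subseteq> hball n x r"
  unfolding hball_def using div_power_eq_mono by blast

lemma hball_subset: "s \<le> r \<Longrightarrow> y \<in> hball n x r \<Longrightarrow> hball n y s \<subseteq> hball n x r"
  using hball_mono[of s r n y] by (auto simp: hball_def)

lemma eventually_in_hball:
  assumes "n \<ge> 2"
  shows "\<forall>\<^sub>F k in sequentially. y \<in> hball n x k"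
proof (rule eventually_sequentiallyI[of "max x y"])
  fix k assume "k \<ge> max x y"
  moreover have "k < n ^ k"
    using less_le_trans[OF less_exp power_mono[OF assms]] by simp
  ultimately have "x < n ^ k" "y < n ^ k" by auto
  then show "y \<in> hball n x k" by (simp add: hball_def)
qed

text \<open>The lowest \<open>l\<close> base-\<open>n\<close> digits are added without carry; this maps the ball of radius \<open>l\<close> around 0
  onto that around \<open>b\<close> and, unlike an ordinary translation, moves 0 to \<open>b\<close> while respecting all smaller balls.\<close>
fun digit_shift :: "nat \<Rightarrow> nat \<Rightarrow> nat \<Rightarrow> nat \<Rightarrow> nat" where
  "digit_shift n 0 b x = b + x"
| "digit_shift n (Suc l) b x = n * digit_shift n l (b div n) (x div n) + (x + b) mod n"

lemma digit_shift_0: "digit_shift n l b 0 = b"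
  by (induction l arbitrary: b) auto

lemma digit_shift_div:
  "n > 0 \<Longrightarrow> s \<le> l \<Longrightarrow> digit_shift n l b x div n ^ s = digit_shift n (l - s) (b div n ^ s) (x div n ^ s)"
proof (induction s)
  case (Suc s)
  have "digit_shift n l b x div n ^ Suc s = (digit_shift n l b x div n ^ s) div n"
    by (simp add: div_mult2_eq[symmetric] mult.commute)
  also have "\<dots> = digit_shift n (Suc (l - Suc s)) (b div n ^ s) (x div n ^ s) div n"
    using Suc by (simp add: Suc_diff_Suc)
  also have "\<dots> = digit_shift n (l - Suc s) (b div n ^ Suc s) (x div n ^ Suc s)"
    using Suc.prems(1) by (simp add: div_mult2_eq[symmetric] mult.commute)
  finally show ?case .
qed simp

lemma mod_add_right_cancel_nat:
  fixes n :: nat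
  assumes "(x + b) mod n = (y + b) mod n"
  shows "x mod n = y mod n"
proof -
  have "int (x + b) mod int n = int (y + b) mod int n" using assms by (metis of_nat_mod)
  then have "int n dvd int (x + b) - int (y + b)" by (simp only: mod_eq_dvd_iff)
  then have "int x mod int n = int y mod int n" by (simp add: mod_eq_dvd_iff)
  then show ?thesis by (metis of_nat_mod of_nat_eq_iff)
qed

lemma inj_digit_shift: "n > 0 \<Longrightarrow> inj (digit_shift n l b)"
proof (induction l arbitrary: b)
  case 0
  then show ?case by (auto simp: inj_def)
next
  case (Suc l)
  show ?case
  proof (rule injI)
    fix x y assume eq: "digit_shift n (Suc l) b x = digit_shift n (Suc l) b y"
    have "digit_shift n (Suc l) b x div n = digit_shift n (Suc l) b y div n" using eq by simp
    then have "digit_shift n l (b div n) (x div n) = digit_shift n l (b div n) (y div n)" using Suc.prems by simp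
    then have "x div n = y div n" using Suc by (simp add: inj_eq)
    moreover have "digit_shift n (Suc l) b x mod n = digit_shift n (Suc l) b y mod n" using eq by simp
    then have "(x + b) mod n = (y + b) mod n" by simp
    then have "x mod n = y mod n" by (rule mod_add_right_cancel_nat)
    ultimately show "x = y" by (metis div_mult_mod_eq)
  qed
qed

lemma digit_shift_div_eq_iff:
  "n > 0 \<Longrightarrow> s \<le> l \<Longrightarrow> digit_shift n l b x div n ^ s = digit_shift n l b y div n ^ s \<longleftrightarrow> x div n ^ s = y div n ^ s"
  using inj_digit_shift[of n "l - s" "b div n ^ s"] by (simp add: digit_shift_div inj_eq)

lemma hier_kernel_digit_shift:
  "n > 0 \<Longrightarrow> hier_kernel n p l (digit_shift n l b x) (digit_shift n l b y) = hier_kernel n p l x y"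
  by (simp add: hier_kernel_def digit_shift_div_eq_iff)

lemma bij_betw_digit_shift:
  assumes n: "n > 0"
  shows "bij_betw (digit_shift n l b) {..<n ^ l} (hball n b l)"
proof -
  have inj: "inj_on (digit_shift n l b) {..<n ^ l}" using inj_digit_shift[OF n] inj_on_subset by blast
  have "digit_shift n l b ` {..<n ^ l} = hball n b l"
  proof (rule card_subset_eq)
    show "digit_shift n l b ` {..<n ^ l} \<subseteq> hball n b l"
      using n by (auto simp: hball_def digit_shift_div)
    show "card (digit_shift n l b ` {..<n ^ l}) = card (hball n b l)"
      using n inj by (simp add: card_image card_hball)
  qed (use n in simp)
  with inj show ?thesis by (simp add: bij_betw_def)
qed

lemma eig_count_hier_kernel_blocks:
  assumes n: "n > 0"
  shows "eig_count (b * n ^ l) (hier_kernel n p l) w A =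
    (\<Sum>j<b. eig_count (n ^ l) (hier_kernel n p l) (\<lambda>i. w (j * n ^ l + i)) A)"
proof (induction b)
  case 0
  interpret matrix_kernel 0 "hier_kernel n p l" by unfold_locales auto
  show ?case using eig_count_le[of w A] by simp
next
  case (Suc b)
  have zero: "hier_kernel n p l i j = 0 \<and> hier_kernel n p l j i = 0" if "i < b * n ^ l" "b * n ^ l \<le> j" for i j
  proof -
    have "i div n ^ l < b" using that n by (simp add: div_less_iff_less_mult)
    moreover have "b \<le> j div n ^ l" using that n by (simp add: less_eq_div_iff_mult_less_eq)
    ultimately have "i div n ^ l \<noteq> j div n ^ l" by linarith
    then have "i div n ^ s \<noteq> j div n ^ s" if "s \<le> l" for s using div_power_eq_mono[OF that] by blast
    then have "hier_kernel n p l i j = 0" unfolding hier_kernel_def by (intro sum.neutral) auto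
    then show ?thesis using hier_kernel_sym by metis
  qed
  have "eig_count (Suc b * n ^ l) (hier_kernel n p l) w A = eig_count (b * n ^ l + n ^ l) (hier_kernel n p l) w A"
    by (simp add: add.commute)
  also have "\<dots> = eig_count (b * n ^ l) (hier_kernel n p l) w A + eig_count (n ^ l)
      (\<lambda>i j. hier_kernel n p l (b * n ^ l + i) (b * n ^ l + j)) (\<lambda>i. w (b * n ^ l + i)) A"
    by (rule eig_count_block) (use zero in auto)
  also have "\<dots> = eig_count (b * n ^ l) (hier_kernel n p l) w A +
      eig_count (n ^ l) (hier_kernel n p l) (\<lambda>i. w (b * n ^ l + i)) A"
    using n by (simp add: hier_kernel_shift)
  finally show ?case using Suc by simp
qed

definition L2_bounded_by :: "real \<Rightarrow> ('i \<Rightarrow> 'a::real_normed_vector) \<Rightarrow> bool" where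
  "L2_bounded_by C \<psi> \<longleftrightarrow> (\<forall>F. finite F \<longrightarrow> L2_norm F \<psi> \<le> C)"

lemma L2_bounded_byI: "(\<And>F. finite F \<Longrightarrow> L2_norm F \<psi> \<le> C) \<Longrightarrow> L2_bounded_by C \<psi>"
  by (simp add: L2_bounded_by_def)

lemma L2_bounded_byD: "L2_bounded_by C \<psi> \<Longrightarrow> finite F \<Longrightarrow> L2_norm F \<psi> \<le> C"
  by (simp add: L2_bounded_by_def)

lemma L2_bounded_by_nonneg: "L2_bounded_by C \<psi> \<Longrightarrow> C \<ge> 0"
  by (rule order.trans[OF L2_norm_nonneg L2_bounded_byD[of C \<psi> "{}"]]) auto

locale hierarchy =
  fixes n :: nat and p :: "nat \<Rightarrow> real"
  assumes n2: "n \<ge> 2" and p_pos: "s \<ge> 1 \<Longrightarrow> p s > 0" and p_sum: "(\<lambda>r. p (Suc r)) sums 1"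
begin

lemma n_pos [simp]: "n > 0" using n2 by simp

lemma p_Suc_nonneg [simp]: "p (Suc s) \<ge> 0"
  using p_pos[of "Suc s"] by simp

definition coupling_tail :: "nat \<Rightarrow> real" where
  "coupling_tail l = (\<Sum>r. p (Suc (r + l)))"

lemma coupling_tail_sums: "(\<lambda>r. p (Suc (r + l))) sums coupling_tail l"
  using sums_summable[OF sums_split_initial_segment[OF p_sum, of l]]
  unfolding coupling_tail_def by (rule summable_sums)

lemma coupling_tail_nonneg: "coupling_tail l \<ge> 0"
  by (rule sums_le[OF _ sums_zero coupling_tail_sums]) simp

lemma coupling_tail_0: "coupling_tail 0 = 1"
  using p_sum by (simp add: coupling_tail_def sums_iff)

lemma coupling_tail_tendsto: "coupling_tail \<longlonglongrightarrow> 0"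
proof -
  have "coupling_tail = (\<lambda>l. 1 - (\<Sum>r<l. p (Suc r)))"
    using sums_unique2[OF coupling_tail_sums sums_split_initial_segment[OF p_sum]] by (rule ext)
  moreover have "(\<lambda>l. 1 - (\<Sum>r<l. p (Suc r))) \<longlonglongrightarrow> 1 - 1"
    using p_sum by (intro tendsto_diff tendsto_const) (simp add: sums_def)
  ultimately show ?thesis by simp
qed

lemma sum_p_le_coupling_tail: "(\<Sum>s\<in>{l<..m}. p s) \<le> coupling_tail l"
proof -
  have "(\<Sum>s\<in>{l<..m}. p s) = (\<Sum>r<m - l. p (Suc (r + l)))"
    by (rule sum.reindex_bij_witness[of _ "\<lambda>r. Suc (r + l)" "\<lambda>s. s - Suc l"]) auto
  also have "\<dots> \<le> coupling_tail l"
    unfolding coupling_tail_def using sums_summable[OF coupling_tail_sums[of l]]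
    by (intro sum_le_suminf) auto
  finally show ?thesis .
qed

lemma sum_hball_weight_le:
  assumes "finite S" "s \<ge> 1"
  shows "(\<Sum>y\<in>S. p s / real n ^ s * of_bool (x div n ^ s = y div n ^ s)) \<le> p s"
proof -
  have "(\<Sum>y\<in>S. p s / real n ^ s * of_bool (x div n ^ s = y div n ^ s)) =
      p s / real n ^ s * (\<Sum>y\<in>S. of_bool (y \<in> hball n x s))"
    unfolding sum_distrib_left hball_def mem_Collect_eq eq_commute[of "x div _"] ..
  also have "(\<Sum>y\<in>S. of_bool (y \<in> hball n x s)) = real (card (S \<inter> hball n x s))"
    using assms(1) by (simp add: sum_of_bool_eq)
  also have "p s / real n ^ s * \<dots> \<le> p s / real n ^ s * real (card (hball n x s))"
    using p_pos[OF assms(2)] by (intro mult_left_mono of_nat_mono card_mono) auto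
  also have "p s / real n ^ s * real (card (hball n x s)) = p s" by (simp add: card_hball)
  finally show ?thesis .
qed

lemma hier_kernel_diff_row_sum_le:
  assumes "finite S" "l \<le> k"
  shows "(\<Sum>y\<in>S. \<bar>hier_kernel n p k x y - hier_kernel n p l x y\<bar>) \<le> coupling_tail l"
proof -
  let ?h = "\<lambda>s y. p s / real n ^ s * of_bool (x div n ^ s = y div n ^ s)"
  have "{1..k} = {1..l} \<union> {l<..k}" using assms(2) by auto
  then have diff: "hier_kernel n p k x y - hier_kernel n p l x y = (\<Sum>s\<in>{l<..k}. ?h s y)" for y
    unfolding hier_kernel_def by (simp only:) (subst sum.union_disjoint, auto)
  have "(\<Sum>y\<in>S. \<bar>hier_kernel n p k x y - hier_kernel n p l x y\<bar>) = (\<Sum>y\<in>S. \<Sum>s\<in>{l<..k}. ?h s y)"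
    unfolding diff using p_pos by (intro sum.cong refl abs_of_nonneg sum_nonneg) (auto intro: less_imp_le)
  also have "\<dots> = (\<Sum>s\<in>{l<..k}. \<Sum>y\<in>S. ?h s y)" by (rule sum.swap)
  also have "\<dots> \<le> (\<Sum>s\<in>{l<..k}. p s)" by (intro sum_mono sum_hball_weight_le assms) auto
  also have "\<dots> \<le> coupling_tail l" by (rule sum_p_le_coupling_tail)
  finally show ?thesis .
qed

definition cutoff :: "nat \<Rightarrow> nat \<Rightarrow> real" where
  "cutoff l s = (if s \<le> l then p s else 0)"

lemma cutoff_Suc_nonneg [simp]: "cutoff l (Suc s) \<ge> 0"
  and cutoff_Suc_le [simp]: "cutoff l (Suc s) \<le> p (Suc s)"
  by (simp_all add: cutoff_def)

lemma hH_cutoff: "hH n (cutoff l) w \<psi> x = (\<Sum>s\<in>{1..l}. of_real (p s) * hE n s \<psi> x) + of_real (w x) * \<psi> x"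
proof -
  have "(\<Sum>r. complex_of_real (cutoff l (Suc r)) * hE n (Suc r) \<psi> x) =
      (\<Sum>r<l. complex_of_real (cutoff l (Suc r)) * hE n (Suc r) \<psi> x)"
    by (rule suminf_finite) (auto simp: cutoff_def)
  also have "\<dots> = (\<Sum>s\<in>{1..l}. of_real (p s) * hE n s \<psi> x)"
    by (simp add: cutoff_def sum.atLeast1_atMost_eq)
  finally show ?thesis by (simp add: hH_def)
qed

lemma schroedinger_hball:
  assumes x: "x \<in> hball n x0 l"
  shows "schroedinger (hball n x0 l) (hier_kernel n p l) w \<psi> x = hH n (cutoff l) w \<psi> x"
proof -
  let ?S = "hball n x0 l"
  have "(\<Sum>y\<in>?S. hier_kernel n p l x y *\<^sub>R \<psi> y) =
     (\<Sum>y\<in>?S. \<Sum>s\<in>{1..l}. of_real (p s) / of_nat n ^ s * (if y \<in> hball n x s then \<psi> y else 0))"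
    unfolding hier_kernel_def scaleR_conv_of_real of_real_sum sum_distrib_right
    by (intro sum.cong refl) (auto simp: hball_def)
  also have "\<dots> = (\<Sum>s\<in>{1..l}. \<Sum>y\<in>?S. of_real (p s) / of_nat n ^ s * (if y \<in> hball n x s then \<psi> y else 0))"
    by (rule sum.swap)
  also have "\<dots> = (\<Sum>s\<in>{1..l}. of_real (p s) * hE n s \<psi> x)"
  proof (intro sum.cong refl)
    fix s assume s: "s \<in> {1..l}"
    have sub: "hball n x s \<subseteq> ?S" using s x by (intro hball_subset) auto
    have "(\<Sum>y\<in>?S. if y \<in> hball n x s then \<psi> y else 0) = (\<Sum>y\<in>hball n x s. \<psi> y)"
      using sub by (simp add: sum.If_cases Int_absorb1)
    then show "(\<Sum>y\<in>?S. of_real (p s) / of_nat n ^ s * (if y \<in> hball n x s then \<psi> y else 0)) =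
        of_real (p s) * hE n s \<psi> x"
      unfolding sum_distrib_left[symmetric] by (simp add: hE_def)
  qed
  finally show ?thesis by (simp add: schroedinger_def hH_cutoff scaleR_conv_of_real)
qed

lemma norm_hE_le:
  assumes C: "L2_bounded_by C \<psi>" and ls: "l \<le> s"
  shows "cmod (hE n s \<psi> x) \<le> C / sqrt (real n ^ l)"
proof -
  let ?S = "hball n x s"
  have "cmod (\<Sum>y\<in>?S. \<psi> y) \<le> (\<Sum>y\<in>?S. \<bar>1\<bar> * \<bar>cmod (\<psi> y)\<bar>)" by (rule order.trans[OF norm_sum]) simp
  also have "\<dots> \<le> L2_set (\<lambda>_. 1) ?S * L2_norm ?S \<psi>" unfolding L2_norm_def by (rule L2_set_mult_ineq)
  also have "L2_set (\<lambda>_. 1) ?S = sqrt (real n ^ s)" by (simp add: L2_set_def card_hball)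
  also have "sqrt (real n ^ s) * L2_norm ?S \<psi> \<le> sqrt (real n ^ s) * C"
    by (intro mult_left_mono L2_bounded_byD[OF C]) auto
  finally have "cmod (hE n s \<psi> x) \<le> sqrt (real n ^ s) * C / real n ^ s"
    by (simp add: hE_def norm_divide norm_power divide_right_mono)
  also have "\<dots> = C / sqrt (real n ^ s)"
    using real_div_sqrt[of "real n ^ s"] n_pos by (simp add: field_simps del: n_pos)
  also have "\<dots> \<le> C / sqrt (real n ^ l)"
    using L2_bounded_by_nonneg[OF C] ls n2
    by (intro divide_left_mono real_sqrt_le_mono power_increasing mult_pos_pos) auto
  finally show ?thesis .
qed

lemma norm_hE_le_bound: "L2_bounded_by C \<psi> \<Longrightarrow> cmod (hE n s \<psi> x) \<le> C"
  using norm_hE_le[of C \<psi> 0 s x] by simp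

lemma summable_hE_series:
  assumes C: "L2_bounded_by C \<psi>" and q: "\<And>r. 0 \<le> q (Suc r)" "\<And>r. q (Suc r) \<le> p (Suc r)"
  shows "summable (\<lambda>r. of_real (q (Suc r)) * hE n (Suc r) \<psi> x)"
proof (rule summable_comparison_test')
  show "summable (\<lambda>r. p (Suc r) * C)" using p_sum by (intro summable_mult2) (auto simp: sums_iff)
  show "cmod (of_real (q (Suc r)) * hE n (Suc r) \<psi> x) \<le> p (Suc r) * C" for r
    using q[of r] norm_hE_le_bound[OF C] by (simp add: norm_mult mult_mono)
qed

lemma norm_hH_minus_cutoff_le:
  assumes C: "L2_bounded_by C \<psi>" and q: "\<And>r. 0 \<le> q (Suc r)" "\<And>r. q (Suc r) \<le> p (Suc r)"
    and agree: "\<And>s. s \<le> l \<Longrightarrow> q s = p s"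
  shows "cmod (hH n q w \<psi> x - hH n (cutoff l) w \<psi> x) \<le> coupling_tail l * (C / sqrt (real n ^ l))"
proof -
  let ?c = "C / sqrt (real n ^ l)"
  let ?d = "\<lambda>r. of_real (q (Suc r)) * hE n (Suc r) \<psi> x - of_real (cutoff l (Suc r)) * hE n (Suc r) \<psi> x"
  define t where "t r = (if r < l then 0 else p (Suc r))" for r
  have "(\<lambda>r. t (r + l)) sums coupling_tail l" using coupling_tail_sums[of l] by (simp add: t_def)
  then have "t sums coupling_tail l"
    by (rule sums_zero_iff_shift[THEN iffD1, rotated]) (simp add: t_def)
  then have t_sums: "(\<lambda>r. t r * ?c) sums (coupling_tail l * ?c)" by (rule sums_mult2)
  have summand_le: "cmod (?d r) \<le> t r * ?c" for r
  proof (cases "r < l")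
    case True
    then show ?thesis using agree[of "Suc r"] by (simp add: t_def cutoff_def)
  next
    case False
    then show ?thesis
      using mult_mono[OF q(2)[of r] norm_hE_le[OF C, of l "Suc r" x]] q(1)[of r]
      by (simp add: t_def cutoff_def norm_mult)
  qed
  have "hH n q w \<psi> x - hH n (cutoff l) w \<psi> x = (\<Sum>r. ?d r)"
    unfolding hH_def using summable_hE_series[OF C q] summable_hE_series[OF C, of "cutoff l"]
    by (simp add: suminf_diff)
  also have "cmod \<dots> \<le> (\<Sum>r. t r * ?c)" by (rule norm_suminf_le[OF summand_le sums_summable[OF t_sums]])
  also have "\<dots> = coupling_tail l * ?c" using t_sums by (simp add: sums_iff)
  finally show ?thesis .
qed

definition ball_green :: "nat \<Rightarrow> (nat \<Rightarrow> real) \<Rightarrow> complex \<Rightarrow> nat \<Rightarrow> nat \<Rightarrow> complex" where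
  "ball_green x0 w z l = green (hball n x0 l) (hier_kernel n p l) w z x0"

lemma ball_green_eq:
  assumes z: "Im z > 0" and x: "x \<in> hball n x0 m"
  shows "hH n (cutoff m) w (ball_green x0 w z m) x - z * ball_green x0 w z m x = (if x = x0 then 1 else 0)"
proof -
  interpret symmetric_kernel "hball n x0 m" "hier_kernel n p m" by (rule symmetric_kernel_hier_kernel) simp
  show ?thesis using green_eq(1)[OF z hball_self x, of w] schroedinger_hball[OF x, of w "ball_green x0 w z m"]
    by (simp add: ball_green_def)
qed

lemma L2_bounded_by_ball_green:
  assumes z: "Im z > 0"
  shows "L2_bounded_by (1 / Im z) (ball_green x0 w z m)"
proof (rule L2_bounded_byI)
  fix F :: "nat set" assume F: "finite F"
  interpret symmetric_kernel "hball n x0 m" "hier_kernel n p m" by (rule symmetric_kernel_hier_kernel) simp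
  let ?g = "ball_green x0 w z m"
  have out: "?g x = 0" if "x \<notin> hball n x0 m" for x
    unfolding ball_green_def using green_eq(2)[OF z hball_self that] by simp
  have "(L2_norm F ?g)\<^sup>2 \<le> (\<Sum>x\<in>F \<union> hball n x0 m. (cmod (?g x))\<^sup>2)"
    unfolding L2_norm_power2 using F by (intro sum_mono2) auto
  also have "\<dots> = (L2_norm (hball n x0 m) ?g)\<^sup>2"
    unfolding L2_norm_power2 using F out by (intro sum.mono_neutral_right) auto
  finally have "L2_norm F ?g \<le> L2_norm (hball n x0 m) ?g" by (simp add: power2_le_iff_abs_le)
  also have "\<dots> \<le> 1 / Im z" unfolding ball_green_def by (rule L2_norm_green_le[OF z]) simp
  finally show "L2_norm F ?g \<le> 1 / Im z" .
qed

text \<open>The couplings beyond level \<open>l\<close> act on the ball of radius \<open>l\<close> as a source of size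
  \<open>coupling_tail l * C / sqrt (n ^ l)\<close> at each of its \<open>n ^ l\<close> points.\<close>
lemma ball_green_close:
  assumes z: "Im z > 0" and C: "L2_bounded_by C \<psi>"
    and q: "\<And>r. 0 \<le> q (Suc r)" "\<And>r. q (Suc r) \<le> p (Suc r)" "\<And>s. s \<le> l \<Longrightarrow> q s = p s"
    and sol: "\<And>x. x \<in> hball n x0 l \<Longrightarrow> hH n q w \<psi> x - z * \<psi> x = (if x = x0 then 1 else 0)"
    and x: "x \<in> hball n x0 l"
  shows "cmod (\<psi> x - ball_green x0 w z l x) \<le> coupling_tail l * C / Im z"
proof -
  let ?S = "hball n x0 l"
  interpret symmetric_kernel ?S "hier_kernel n p l" by (rule symmetric_kernel_hier_kernel) simp
  define r where "r x = hH n (cutoff l) w \<psi> x - hH n q w \<psi> x" for x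
  have r: "cmod (r x) \<le> coupling_tail l * (C / sqrt (real n ^ l))" for x
    unfolding r_def using norm_hH_minus_cutoff_le[OF C q, where w = w and x = x] by (simp add: norm_minus_commute)
  have "L2_norm ?S r \<le> sqrt (\<Sum>x\<in>?S. (coupling_tail l * (C / sqrt (real n ^ l)))\<^sup>2)"
    unfolding L2_norm_def L2_set_def using r by (intro real_sqrt_le_mono sum_mono power_mono) auto
  also have "\<dots> = sqrt ((coupling_tail l * C)\<^sup>2)"
    by (intro arg_cong[where f = sqrt]) (simp add: card_hball power_divide power_mult_distrib)
  also have "\<dots> = coupling_tail l * C"
    using coupling_tail_nonneg L2_bounded_by_nonneg[OF C] by simp
  finally have L2_r: "L2_norm ?S r \<le> coupling_tail l * C" .
  have "cmod (\<psi> x - ball_green x0 w z l x) \<le> L2_norm ?S (\<lambda>y. \<psi> y - ball_green x0 w z l y)"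
    using x by (intro norm_le_L2_norm) auto
  also have "\<dots> \<le> L2_norm ?S r / Im z"
    unfolding ball_green_def
  proof (rule green_stability[OF z])
    fix y assume y: "y \<in> ?S"
    show "schroedinger ?S (hier_kernel n p l) w \<psi> y - z * \<psi> y = (if y = x0 then 1 else 0) + r y"
      unfolding schroedinger_hball[OF y] using sol[OF y] by (simp add: r_def algebra_simps)
  qed simp
  also have "\<dots> \<le> coupling_tail l * C / Im z" using L2_r z by (intro divide_right_mono) auto
  finally show ?thesis .
qed

lemma ball_green_close_larger_ball:
  assumes z: "Im z > 0" and lm: "l \<le> m" and x: "x \<in> hball n x0 l"
  shows "cmod (ball_green x0 w z m x - ball_green x0 w z l x) \<le> coupling_tail l / (Im z)\<^sup>2"
proof -
  have "cmod (ball_green x0 w z m x - ball_green x0 w z l x) \<le> coupling_tail l * (1 / Im z) / Im z"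
  proof (rule ball_green_close[OF z L2_bounded_by_ball_green[OF z] cutoff_Suc_nonneg cutoff_Suc_le])
    show "hH n (cutoff m) w (ball_green x0 w z m) y - z * ball_green x0 w z m y = (if y = x0 then 1 else 0)"
      if "y \<in> hball n x0 l" for y
      using hball_mono[OF lm] that by (intro ball_green_eq[OF z]) blast
  qed (use lm x in \<open>auto simp: cutoff_def\<close>)
  then show ?thesis by (simp add: power2_eq_square)
qed

definition lattice_green :: "nat \<Rightarrow> (nat \<Rightarrow> real) \<Rightarrow> complex \<Rightarrow> nat \<Rightarrow> complex" where
  "lattice_green x0 w z x = lim (\<lambda>m. ball_green x0 w z m x)"

lemma ball_green_tendsto:
  assumes z: "Im z > 0"
  shows "(\<lambda>m. ball_green x0 w z m x) \<longlonglongrightarrow> lattice_green x0 w z x"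
proof -
  let ?g = "\<lambda>m. ball_green x0 w z m x"
  have "Cauchy ?g"
  proof (rule metric_CauchyI)
    fix e :: real assume e: "e > 0"
    have "(\<lambda>l. 2 * (coupling_tail l / (Im z)\<^sup>2)) \<longlonglongrightarrow> 2 * (0 / (Im z)\<^sup>2)"
      using z by (intro tendsto_intros coupling_tail_tendsto) auto
    then have "\<forall>\<^sub>F l in sequentially. 2 * (coupling_tail l / (Im z)\<^sup>2) < e"
      using e by (intro order_tendstoD) auto
    with eventually_in_hball[OF n2, of x x0]
    have "\<forall>\<^sub>F l in sequentially. x \<in> hball n x0 l \<and> 2 * (coupling_tail l / (Im z)\<^sup>2) < e"
      by eventually_elim auto
    from eventually_happens'[OF sequentially_bot this]
    obtain l where l: "x \<in> hball n x0 l" "2 * (coupling_tail l / (Im z)\<^sup>2) < e" by blast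
    have "dist (?g m) (?g m') < e" if "m \<ge> l" "m' \<ge> l" for m m'
    proof -
      have "dist (?g m) (?g m') \<le> dist (?g m) (?g l) + dist (?g m') (?g l)" by (rule dist_triangle2)
      also have "\<dots> \<le> 2 * (coupling_tail l / (Im z)\<^sup>2)"
        using ball_green_close_larger_ball[OF z that(1) l(1), of w]
          ball_green_close_larger_ball[OF z that(2) l(1), of w] by (simp add: dist_norm)
      finally show ?thesis using l(2) by simp
    qed
    then show "\<exists>M. \<forall>m\<ge>M. \<forall>n\<ge>M. dist (?g m) (?g n) < e" by blast
  qed
  then have "convergent ?g" by (rule Cauchy_convergent)
  then show ?thesis unfolding lattice_green_def by (rule convergent_LIMSEQ_iff[THEN iffD1])
qed

lemma hH_cutoff_tendsto:
  assumes \<psi>: "\<And>x. (\<lambda>m. g m x) \<longlonglongrightarrow> \<psi> x" and C: "\<And>m. L2_bounded_by C (g m)"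
  shows "(\<lambda>m. hH n (cutoff m) w (g m) x) \<longlonglongrightarrow> hH n p w \<psi> x"
proof -
  define a where "a r m = of_real (cutoff m (Suc r)) * hE n (Suc r) (g m) x" for r m
  have "(\<lambda>m. \<Sum>r. a r m) \<longlonglongrightarrow> (\<Sum>r. of_real (p (Suc r)) * hE n (Suc r) \<psi> x)"
  proof (rule tannerys_theorem[THEN conjunct2, THEN conjunct2])
    fix r
    have "(\<lambda>m. hE n (Suc r) (g m) x) \<longlonglongrightarrow> hE n (Suc r) \<psi> x"
      unfolding hE_def by (intro tendsto_intros \<psi>) auto
    then have "(\<lambda>m. of_real (p (Suc r)) * hE n (Suc r) (g m) x) \<longlonglongrightarrow> of_real (p (Suc r)) * hE n (Suc r) \<psi> x"
      by (intro tendsto_intros)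
    moreover have "\<forall>\<^sub>F m in sequentially. of_real (p (Suc r)) * hE n (Suc r) (g m) x = a r m"
      using eventually_gt_at_top[of r] by eventually_elim (simp add: a_def cutoff_def)
    ultimately show "(\<lambda>m. a r m) \<longlonglongrightarrow> of_real (p (Suc r)) * hE n (Suc r) \<psi> x"
      by (rule Lim_transform_eventually)
  next
    have "norm (a r m) \<le> p (Suc r) * C" for r m
      unfolding a_def using norm_hE_le_bound[OF C] by (simp add: norm_mult mult_mono)
    then show "\<forall>\<^sub>F (r, m) in at_top \<times>\<^sub>F sequentially. norm (a r m) \<le> p (Suc r) * C"
      by (intro always_eventually) auto
    show "summable (\<lambda>r. p (Suc r) * C)" using p_sum by (intro summable_mult2) (auto simp: sums_iff)
  qed simp
  then show ?thesis unfolding hH_def a_def by (intro tendsto_intros \<psi>)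
qed

lemma lattice_green_eq:
  assumes z: "Im z > 0"
  shows "hH n p w (lattice_green x0 w z) x - z * lattice_green x0 w z x = (if x = x0 then 1 else 0)"
proof -
  have "(\<lambda>m. hH n (cutoff m) w (ball_green x0 w z m) x - z * ball_green x0 w z m x)
      \<longlonglongrightarrow> hH n p w (lattice_green x0 w z) x - z * lattice_green x0 w z x"
    by (intro tendsto_intros hH_cutoff_tendsto[where C = "1 / Im z"] ball_green_tendsto L2_bounded_by_ball_green z)
  moreover have "\<forall>\<^sub>F m in sequentially.
      hH n (cutoff m) w (ball_green x0 w z m) x - z * ball_green x0 w z m x = (if x = x0 then 1 else 0)"
    using eventually_in_hball[OF n2, of x x0] by eventually_elim (rule ball_green_eq[OF z])
  ultimately have "(\<lambda>m. if x = x0 then 1 else 0 :: complex)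
      \<longlonglongrightarrow> hH n p w (lattice_green x0 w z) x - z * lattice_green x0 w z x"
    by (rule Lim_transform_eventually)
  from LIMSEQ_unique[OF this tendsto_const] show ?thesis .
qed

lemma L2_norm_hier_kernel_le:
  assumes "finite S"
  shows "L2_norm S (\<lambda>x. \<Sum>y\<in>S. hier_kernel n p l x y *\<^sub>R \<psi> y) \<le> L2_norm S \<psi>"
proof -
  have "(\<Sum>y\<in>S. \<bar>hier_kernel n p l x y\<bar>) \<le> 1" for x
    using hier_kernel_diff_row_sum_le[OF assms, of 0 l x] by (simp add: hier_kernel_def[of _ _ 0] coupling_tail_0)
  then show ?thesis using Schur_test[of S "hier_kernel n p l" 1 \<psi>] by (simp add: hier_kernel_sym)
qed

lemma L2_norm_potential_ball_green_le:
  assumes z: "Im z > 0"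
  shows "L2_norm (hball n x0 m) (\<lambda>x. w x *\<^sub>R ball_green x0 w z m x) \<le> 1 + (cmod z + 1) / Im z"
proof -
  let ?S = "hball n x0 m" and ?a = "hier_kernel n p m" and ?g = "ball_green x0 w z m"
  let ?\<delta> = "\<lambda>x. if x = x0 then 1 else 0 :: complex" and ?k = "\<lambda>x. \<Sum>y\<in>hball n x0 m. hier_kernel n p m x y *\<^sub>R ball_green x0 w z m y"
  interpret symmetric_kernel ?S ?a by (rule symmetric_kernel_hier_kernel) simp
  have g: "L2_norm ?S ?g \<le> 1 / Im z" by (rule L2_bounded_byD[OF L2_bounded_by_ball_green[OF z]]) simp
  have "L2_norm ?S (\<lambda>x. w x *\<^sub>R ?g x) = L2_norm ?S (\<lambda>x. (?\<delta> x + z * ?g x) + - ?k x)"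
    using green_eq(1)[OF z hball_self, of _ w]
    by (intro L2_norm_cong arg_cong[where f = norm])
      (auto simp: ball_green_def schroedinger_def algebra_simps split: if_splits)
  also have "\<dots> \<le> L2_norm ?S (\<lambda>x. ?\<delta> x + z * ?g x) + L2_norm ?S ?k"
    using L2_norm_triangle[of ?S "\<lambda>x. ?\<delta> x + z * ?g x" "\<lambda>x. - ?k x"] by (simp only: L2_norm_minus)
  also have "\<dots> \<le> (L2_norm ?S ?\<delta> + L2_norm ?S (\<lambda>x. z * ?g x)) + L2_norm ?S ?g"
    by (intro add_mono L2_norm_triangle L2_norm_hier_kernel_le fin)
  also have "\<dots> = 1 + (cmod z + 1) * L2_norm ?S ?g"
    using L2_norm_delta[OF fin hball_self, of "1 :: complex"] by (simp add: L2_norm_mult algebra_simps)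
  also have "\<dots> \<le> 1 + (cmod z + 1) * (1 / Im z)" using g by (intro add_left_mono mult_left_mono) auto
  finally show ?thesis by simp
qed

lemma lattice_green_in_hdom:
  assumes z: "Im z > 0"
  shows "lattice_green x0 w z \<in> hdom w"
  unfolding hdom_def
proof (rule CollectI, rule summableI_nonneg_bounded)
  let ?g = "ball_green x0 w z" and ?\<psi> = "lattice_green x0 w z"
  define K where "K = 1 + (cmod z + 1) / Im z"
  fix j
  show "(\<Sum>x<j. (cmod (?\<psi> x))\<^sup>2 * (1 + (w x)\<^sup>2)) \<le> (1 / Im z)\<^sup>2 + K\<^sup>2"
  proof (rule tendsto_upperbound[OF _ _ sequentially_bot])
    show "(\<lambda>m. \<Sum>x<j. (cmod (?g m x))\<^sup>2 * (1 + (w x)\<^sup>2)) \<longlonglongrightarrow> (\<Sum>x<j. (cmod (?\<psi> x))\<^sup>2 * (1 + (w x)\<^sup>2))"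
      by (intro tendsto_intros ball_green_tendsto z)
    have "\<forall>\<^sub>F m in sequentially. \<forall>x\<in>{..<j}. x \<in> hball n x0 m"
      by (intro eventually_ball_finite ballI eventually_in_hball n2) auto
    then show "\<forall>\<^sub>F m in sequentially. (\<Sum>x<j. (cmod (?g m x))\<^sup>2 * (1 + (w x)\<^sup>2)) \<le> (1 / Im z)\<^sup>2 + K\<^sup>2"
    proof eventually_elim
      fix m assume m: "\<forall>x\<in>{..<j}. x \<in> hball n x0 m"
      have "(\<Sum>x<j. (cmod (?g m x))\<^sup>2 * (1 + (w x)\<^sup>2)) =
          (L2_norm {..<j} (?g m))\<^sup>2 + (L2_norm {..<j} (\<lambda>x. w x *\<^sub>R ?g m x))\<^sup>2"
        unfolding L2_norm_power2 sum.distrib[symmetric] by (simp add: power_mult_distrib algebra_simps)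
      also have "\<dots> \<le> (1 / Im z)\<^sup>2 + K\<^sup>2"
      proof (intro add_mono power_mono)
        show "L2_norm {..<j} (?g m) \<le> 1 / Im z" by (rule L2_bounded_byD[OF L2_bounded_by_ball_green[OF z]]) simp
        show "L2_norm {..<j} (\<lambda>x. w x *\<^sub>R ?g m x) \<le> K"
          unfolding K_def using m by (intro order.trans[OF L2_norm_mono_set L2_norm_potential_ball_green_le[OF z]]) auto
      qed auto
      finally show "(\<Sum>x<j. (cmod (?g m x))\<^sup>2 * (1 + (w x)\<^sup>2)) \<le> (1 / Im z)\<^sup>2 + K\<^sup>2" .
    qed
  qed
qed simp

lemma hdom_L2_bounded:
  assumes "\<psi> \<in> hdom w"
  obtains C where "L2_bounded_by C \<psi>"
proof -
  have "summable (\<lambda>x. (cmod (\<psi> x))\<^sup>2)"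
  proof (rule summable_comparison_test')
    show "summable (\<lambda>x. (cmod (\<psi> x))\<^sup>2 * (1 + (w x)\<^sup>2))" using assms by (simp add: hdom_def)
  qed (auto simp: algebra_simps)
  then have "L2_bounded_by (sqrt (\<Sum>x. (cmod (\<psi> x))\<^sup>2)) \<psi>"
    by (intro L2_bounded_byI) (auto simp: L2_norm_def L2_set_def intro!: real_sqrt_le_mono sum_le_suminf)
  then show thesis by (rule that)
qed

theorem hresolvent_eq_lattice_green:
  assumes z: "Im z > 0"
  shows "hresolvent n p x0 w z = lattice_green x0 w z x0"
  unfolding hresolvent_def
proof (rule the_equality)
  fix c assume "\<exists>\<psi>\<in>hdom w. (\<forall>x. hH n p w \<psi> x - z * \<psi> x = (if x = x0 then 1 else 0)) \<and> c = \<psi> x0"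
  then obtain \<phi> where \<phi>: "\<phi> \<in> hdom w" "\<And>x. hH n p w \<phi> x - z * \<phi> x = (if x = x0 then 1 else 0)" "c = \<phi> x0" by blast
  obtain C where C: "L2_bounded_by C \<phi>" using hdom_L2_bounded[OF \<phi>(1)] .
  have "(\<lambda>l. coupling_tail l * C / Im z) \<longlonglongrightarrow> 0 * C / Im z"
    using z by (intro tendsto_intros coupling_tail_tendsto) auto
  then have lim0: "(\<lambda>l. coupling_tail l * C / Im z) \<longlonglongrightarrow> 0" by simp
  have "cmod (ball_green x0 w z l x0 - \<phi> x0) \<le> coupling_tail l * C / Im z" for l
    unfolding norm_minus_commute[of _ "\<phi> x0"] by (rule ball_green_close[OF z C _ _ _ \<phi>(2)]) auto
  then have "(\<lambda>l. ball_green x0 w z l x0 - \<phi> x0) \<longlonglongrightarrow> 0"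
    by (intro Lim_null_comparison[OF _ lim0] always_eventually allI)
  then have "(\<lambda>l. ball_green x0 w z l x0) \<longlonglongrightarrow> \<phi> x0" by (simp add: LIM_zero_iff)
  from LIMSEQ_unique[OF this ball_green_tendsto[OF z]] show "c = lattice_green x0 w z x0" using \<phi>(3) by simp
qed (use lattice_green_in_hdom[OF z] lattice_green_eq[OF z] in blast)

lemma hresolvent_close:
  assumes z: "Im z > 0"
  shows "cmod (hresolvent n p x0 w z - ball_green x0 w z l x0) \<le> coupling_tail l / (Im z)\<^sup>2"
  unfolding hresolvent_eq_lattice_green[OF z]
proof (rule LIMSEQ_le_const2)
  show "(\<lambda>m. cmod (ball_green x0 w z m x0 - ball_green x0 w z l x0))
      \<longlonglongrightarrow> cmod (lattice_green x0 w z x0 - ball_green x0 w z l x0)"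
    by (intro tendsto_intros ball_green_tendsto z)
  show "\<exists>N. \<forall>m\<ge>N. cmod (ball_green x0 w z m x0 - ball_green x0 w z l x0) \<le> coupling_tail l / (Im z)\<^sup>2"
    using ball_green_close_larger_ball[OF z _ hball_self] by blast
qed

end

section \<open>Poisson approximation of sums of independent vectors\<close>

definition count_box :: "nat \<Rightarrow> (nat \<Rightarrow> nat) \<Rightarrow> (nat \<Rightarrow> nat) set" where
  "count_box m r = PiE {..<m} (\<lambda>s. {..r s})"

definition count_diff :: "nat \<Rightarrow> (nat \<Rightarrow> nat) \<Rightarrow> (nat \<Rightarrow> nat) \<Rightarrow> nat \<Rightarrow> nat" where
  "count_diff m r q = restrict (\<lambda>s. r s - q s) {..<m}"

definition count_convolution ::
    "nat \<Rightarrow> ((nat \<Rightarrow> nat) \<Rightarrow> real) \<Rightarrow> ((nat \<Rightarrow> nat) \<Rightarrow> real) \<Rightarrow> (nat \<Rightarrow> nat) \<Rightarrow> real" where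
  "count_convolution m h k r = (\<Sum>q\<in>count_box m r. h (count_diff m r q) * k q)"

lemma finite_count_box [simp]: "finite (count_box m r)"
  unfolding count_box_def by (intro finite_PiE) auto

lemma count_box_le: "q \<in> count_box m r \<Longrightarrow> s < m \<Longrightarrow> q s \<le> r s"
  by (auto simp: count_box_def PiE_iff)

lemma count_box_ext:
  assumes "q \<in> count_box m r" "q' \<in> count_box m r" "\<And>s. s < m \<Longrightarrow> q s = q' s"
  shows "q = q'"
proof (rule PiE_ext)
  show "q \<in> PiE {..<m} (\<lambda>s. {..r s})" using assms(1) by (simp only: count_box_def)
  show "q' \<in> PiE {..<m} (\<lambda>s. {..r s})" using assms(2) by (simp only: count_box_def)
  show "q s = q' s" if "s \<in> {..<m}" for s using that assms(3) by simp
qed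

lemma count_box_trans: "q \<in> count_box m r \<Longrightarrow> r \<in> count_box m R \<Longrightarrow> q \<in> count_box m R"
  by (auto simp: count_box_def PiE_iff intro: order.trans)

lemma count_diff_in_count_box:
  assumes "r \<in> count_box m R"
  shows "count_diff m r q \<in> count_box m R"
proof -
  have "r s - q s \<le> R s" if "s < m" for s
    using count_box_le[OF assms that] by linarith
  then show ?thesis by (simp add: count_box_def count_diff_def restrict_PiE_iff)
qed

lemma inj_on_count_diff: "inj_on (\<lambda>r. count_diff m r q) {r \<in> count_box m R. q \<in> count_box m r}"
proof (rule inj_onI)
  fix r r'
  assume r: "r \<in> {r \<in> count_box m R. q \<in> count_box m r}" "r' \<in> {r \<in> count_box m R. q \<in> count_box m r}"
    and diff_eq: "count_diff m r q = count_diff m r' q"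
  show "r = r'"
  proof (rule count_box_ext)
    show "r \<in> count_box m R" "r' \<in> count_box m R" using r by auto
    fix s assume s: "s < m"
    have "q s \<le> r s" "q s \<le> r' s" using r s by (auto intro: count_box_le)
    moreover have "r s - q s = r' s - q s" using fun_cong[OF diff_eq, of s] s by (simp add: count_diff_def)
    ultimately show "r s = r' s" by linarith
  qed
qed

lemma sum_count_convolution_le:
  assumes h: "\<And>r. h r \<ge> 0" and k: "\<And>r. k r \<ge> 0"
  shows "(\<Sum>r\<in>count_box m R. count_convolution m h k r) \<le> (\<Sum>q\<in>count_box m R. k q) * (\<Sum>r\<in>count_box m R. h r)"
proof -
  let ?f = "\<lambda>r q. if q \<in> count_box m r then h (count_diff m r q) * k q else 0"
  have "count_convolution m h k r = (\<Sum>q\<in>count_box m R. ?f r q)" if r: "r \<in> count_box m R" for r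
  proof -
    have "count_box m r \<subseteq> count_box m R" using count_box_trans[OF _ r] by blast
    then show ?thesis unfolding count_convolution_def by (simp add: sum.If_cases Int_absorb1)
  qed
  then have "(\<Sum>r\<in>count_box m R. count_convolution m h k r) = (\<Sum>r\<in>count_box m R. \<Sum>q\<in>count_box m R. ?f r q)"
    by simp
  also have "\<dots> = (\<Sum>q\<in>count_box m R. \<Sum>r\<in>count_box m R. ?f r q)" by (rule sum.swap)
  also have "\<dots> \<le> (\<Sum>q\<in>count_box m R. k q * (\<Sum>r\<in>count_box m R. h r))"
  proof (rule sum_mono)
    fix q
    let ?T = "{r \<in> count_box m R. q \<in> count_box m r}"
    have "(\<Sum>r\<in>count_box m R. ?f r q) = (\<Sum>r\<in>?T. h (count_diff m r q) * k q)"
      by (rule sum.inter_filter[symmetric]) simp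
    also have "\<dots> = k q * (\<Sum>r\<in>(\<lambda>r. count_diff m r q) ` ?T. h r)"
      using inj_on_count_diff by (simp add: sum.reindex sum_distrib_left mult.commute)
    also have "\<dots> \<le> k q * (\<Sum>r\<in>count_box m R. h r)"
      using h k by (intro mult_left_mono sum_mono2) (auto intro: count_diff_in_count_box)
    finally show "(\<Sum>r\<in>count_box m R. ?f r q) \<le> k q * (\<Sum>r\<in>count_box m R. h r)" .
  qed
  also have "\<dots> = (\<Sum>q\<in>count_box m R. k q) * (\<Sum>r\<in>count_box m R. h r)" by (simp add: sum_distrib_right)
  finally show ?thesis .
qed

lemma count_convolution_diff_le:
  assumes F: "\<And>r. F r \<ge> 0" and g: "\<And>q. g q \<ge> 0"
  shows "\<bar>count_convolution m F f r - count_convolution m G g r\<bar> \<le>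
    count_convolution m F (\<lambda>q. \<bar>f q - g q\<bar>) r + count_convolution m (\<lambda>q. \<bar>F q - G q\<bar>) g r"
proof -
  let ?d = "count_diff m r"
  have "\<bar>count_convolution m F f r - count_convolution m G g r\<bar> \<le>
      (\<Sum>q\<in>count_box m r. \<bar>F (?d q) * f q - G (?d q) * g q\<bar>)"
    unfolding count_convolution_def sum_subtractf[symmetric] by (rule sum_abs)
  also have "\<dots> \<le> (\<Sum>q\<in>count_box m r. F (?d q) * \<bar>f q - g q\<bar> + \<bar>F (?d q) - G (?d q)\<bar> * g q)"
  proof (rule sum_mono)
    fix q
    have telescope: "F (?d q) * f q - G (?d q) * g q = F (?d q) * (f q - g q) + (F (?d q) - G (?d q)) * g q"
      by (simp add: algebra_simps)
    have "\<bar>F (?d q) * f q - G (?d q) * g q\<bar> \<le> \<bar>F (?d q) * (f q - g q)\<bar> + \<bar>(F (?d q) - G (?d q)) * g q\<bar>"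
      unfolding telescope by (rule abs_triangle_ineq)
    also have "\<dots> = F (?d q) * \<bar>f q - g q\<bar> + \<bar>F (?d q) - G (?d q)\<bar> * g q"
      by (simp add: abs_mult F g)
    finally show "\<bar>F (?d q) * f q - G (?d q) * g q\<bar> \<le> F (?d q) * \<bar>f q - g q\<bar> + \<bar>F (?d q) - G (?d q)\<bar> * g q" .
  qed
  finally show ?thesis by (simp add: count_convolution_def sum.distrib)
qed

text \<open>Le Cam's argument: replacing the summands one at a time costs at most the distance of their laws.\<close>
lemma Le_Cam:
  fixes F G :: "nat \<Rightarrow> (nat \<Rightarrow> nat) \<Rightarrow> real" and f g :: "(nat \<Rightarrow> nat) \<Rightarrow> real"
  assumes F: "\<And>b r. F (Suc b) r = count_convolution m (F b) f r"
    and G: "\<And>b r. G (Suc b) r = count_convolution m (G b) g r"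
    and init: "\<And>r. F 0 r = G 0 r"
    and F_nonneg: "\<And>b r. F b r \<ge> 0" and g_nonneg: "\<And>q. g q \<ge> 0"
    and F_mass: "\<And>b. (\<Sum>r\<in>count_box m R. F b r) \<le> 1" and g_mass: "(\<Sum>q\<in>count_box m R. g q) \<le> 1"
  shows "(\<Sum>r\<in>count_box m R. \<bar>F b r - G b r\<bar>) \<le> real b * (\<Sum>q\<in>count_box m R. \<bar>f q - g q\<bar>)"
proof (induction b)
  case 0
  then show ?case by (simp add: init)
next
  case (Suc b)
  let ?d = "\<Sum>q\<in>count_box m R. \<bar>f q - g q\<bar>" and ?D = "\<Sum>r\<in>count_box m R. \<bar>F b r - G b r\<bar>"
  have "(\<Sum>r\<in>count_box m R. \<bar>F (Suc b) r - G (Suc b) r\<bar>) \<le>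
      (\<Sum>r\<in>count_box m R. count_convolution m (F b) (\<lambda>q. \<bar>f q - g q\<bar>) r) +
      (\<Sum>r\<in>count_box m R. count_convolution m (\<lambda>q. \<bar>F b q - G b q\<bar>) g r)"
    unfolding F G sum.distrib[symmetric] by (intro sum_mono count_convolution_diff_le F_nonneg g_nonneg)
  also have "\<dots> \<le> ?d * (\<Sum>r\<in>count_box m R. F b r) + (\<Sum>q\<in>count_box m R. g q) * ?D"
    by (intro add_mono sum_count_convolution_le) (auto simp: F_nonneg g_nonneg)
  also have "\<dots> \<le> ?d * 1 + 1 * ?D"
    using F_mass[of b] g_mass by (intro add_mono mult_left_mono mult_right_mono) (auto intro: sum_nonneg)
  also have "\<dots> \<le> real (Suc b) * ?d" using Suc by (simp add: algebra_simps)
  finally show ?case .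
qed

definition poisson_weight :: "real \<Rightarrow> nat \<Rightarrow> real" where
  "poisson_weight t j = exp (- t) * t ^ j / fact j"

definition poisson_vec :: "nat \<Rightarrow> (nat \<Rightarrow> real) \<Rightarrow> real \<Rightarrow> (nat \<Rightarrow> nat) \<Rightarrow> real" where
  "poisson_vec m \<Lambda> t r = (\<Prod>s<m. poisson_weight (t * \<Lambda> s) (r s))"

lemma poisson_weight_add: "poisson_weight (t + u) j = (\<Sum>i\<le>j. poisson_weight t (j - i) * poisson_weight u i)"
proof -
  let ?c = "exp (- (t + u)) / fact j"
  have "(\<Sum>i\<le>j. poisson_weight t (j - i) * poisson_weight u i) = (\<Sum>i\<le>j. ?c * (of_nat (j choose i) * u ^ i * t ^ (j - i)))"
  proof (intro sum.cong refl)
    fix i assume "i \<in> {..j}"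
    then have "real (j choose i) = fact j / (fact i * fact (j - i))" by (simp add: binomial_fact)
    moreover have "exp (- (t + u)) = exp (- t) * exp (- u)" by (simp flip: exp_add)
    ultimately show "poisson_weight t (j - i) * poisson_weight u i = ?c * (of_nat (j choose i) * u ^ i * t ^ (j - i))"
      by (simp add: poisson_weight_def ac_simps)
  qed
  also have "\<dots> = ?c * (u + t) ^ j"
    unfolding sum_distrib_left[symmetric] binomial_ring[of u t j] ..
  finally show ?thesis by (simp add: poisson_weight_def add.commute)
qed

lemma poisson_weight_nonneg: "t \<ge> 0 \<Longrightarrow> poisson_weight t j \<ge> 0"
  by (simp add: poisson_weight_def)

lemma sum_poisson_weight_le:
  assumes t: "t \<ge> 0"
  shows "(\<Sum>j\<le>N. poisson_weight t j) \<le> 1"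
proof -
  have "(\<Sum>j\<le>N. t ^ j / fact j) \<le> (\<Sum>j. t ^ j / fact j)"
    using t summable_exp[of t] by (intro sum_le_suminf) (auto simp: divide_inverse mult.commute)
  also have "\<dots> = exp t" by (simp add: exp_def divide_inverse mult.commute scaleR_conv_of_real)
  finally have "exp (- t) * (\<Sum>j\<le>N. t ^ j / fact j) \<le> exp (- t) * exp t" by (intro mult_left_mono) auto
  then show ?thesis by (simp add: poisson_weight_def sum_distrib_left exp_minus)
qed

lemma poisson_vec_add:
  "poisson_vec m \<Lambda> (t + u) r = count_convolution m (poisson_vec m \<Lambda> t) (poisson_vec m \<Lambda> u) r"
proof -
  have "poisson_vec m \<Lambda> (t + u) r =
      (\<Prod>s<m. \<Sum>i\<le>r s. poisson_weight (t * \<Lambda> s) (r s - i) * poisson_weight (u * \<Lambda> s) i)"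
    unfolding poisson_vec_def by (simp add: distrib_right poisson_weight_add)
  also have "\<dots> = (\<Sum>q\<in>count_box m r. \<Prod>s<m. poisson_weight (t * \<Lambda> s) (r s - q s) * poisson_weight (u * \<Lambda> s) (q s))"
    unfolding count_box_def by (subst prod_sum_PiE) auto
  also have "\<dots> = count_convolution m (poisson_vec m \<Lambda> t) (poisson_vec m \<Lambda> u) r"
    unfolding count_convolution_def poisson_vec_def prod.distrib[symmetric]
    by (intro sum.cong refl prod.cong) (auto simp: count_diff_def)
  finally show ?thesis .
qed

lemma poisson_vec_nonneg: "(\<And>s. \<Lambda> s \<ge> 0) \<Longrightarrow> t \<ge> 0 \<Longrightarrow> poisson_vec m \<Lambda> t r \<ge> 0"
  unfolding poisson_vec_def by (intro prod_nonneg) (auto intro!: poisson_weight_nonneg)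

lemma sum_poisson_vec_le:
  assumes "\<And>s. \<Lambda> s \<ge> 0" "t \<ge> 0"
  shows "(\<Sum>q\<in>count_box m R. poisson_vec m \<Lambda> t q) \<le> 1"
proof -
  have "(\<Sum>q\<in>count_box m R. poisson_vec m \<Lambda> t q) = (\<Prod>s<m. \<Sum>i\<le>R s. poisson_weight (t * \<Lambda> s) i)"
    unfolding count_box_def poisson_vec_def by (subst prod_sum_PiE) auto
  also have "\<dots> \<le> 1"
    using assms by (intro prod_le_1) (auto intro!: sum_nonneg poisson_weight_nonneg sum_poisson_weight_le)
  finally show ?thesis .
qed

definition poisson_slope :: "nat \<Rightarrow> (nat \<Rightarrow> nat) \<Rightarrow> (nat \<Rightarrow> real) \<Rightarrow> real" where
  "poisson_slope m q v = (if (\<Sum>s<m. q s) = 0 then - (\<Sum>s<m. v s)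
    else if (\<Sum>s<m. q s) = 1 then (\<Sum>s<m. real (q s) * v s) else 0)"

lemma sum_eq_1_obtain_unit:
  fixes q :: "nat \<Rightarrow> nat"
  assumes "(\<Sum>s<m. q s) = 1"
  obtains c where "c < m" "\<And>s. s < m \<Longrightarrow> q s = of_bool (s = c)"
proof -
  obtain c where "c < m" "q c = 1" "\<forall>s<m. c \<noteq> s \<longrightarrow> q s = 0"
    using assms sum_eq_1_iff[of "{..<m}" q] by (metis finite_lessThan lessThan_iff)
  then show thesis using that[of c] by auto
qed

lemma poisson_slope_unit:
  assumes "c < m" "\<And>s. s < m \<Longrightarrow> q s = of_bool (s = c)"
  shows "poisson_slope m q v = v c"
proof -
  have "(\<Sum>s<m. q s) = (\<Sum>s<m. if s = c then 1 else 0)" using assms(2) by (intro sum.cong) auto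
  then have "(\<Sum>s<m. q s) = 1" using assms(1) by simp
  moreover have "(\<Sum>s<m. real (q s) * v s) = (\<Sum>s<m. if s = c then v s else 0)"
    using assms(2) by (intro sum.cong) auto
  ultimately show ?thesis using assms(1) by (simp add: poisson_slope_def)
qed

lemma poisson_slope_scale: "c * poisson_slope m q v = poisson_slope m q (\<lambda>s. c * v s)"
  by (simp add: poisson_slope_def sum_distrib_left ac_simps)

lemma poisson_slope_tendsto:
  assumes "\<And>s. s < m \<Longrightarrow> (\<lambda>k. v k s) \<longlonglongrightarrow> V s"
  shows "(\<lambda>k. poisson_slope m q (v k)) \<longlonglongrightarrow> poisson_slope m q V"
proof -
  define j where "j = (\<Sum>s<m. q s)"
  show ?thesis unfolding poisson_slope_def j_def[symmetric] using assms by (auto intro!: tendsto_intros)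
qed

lemma indicator_eq_affine:
  fixes q v :: "nat \<Rightarrow> nat"
  assumes "(\<Sum>s<m. v s) \<le> 1"
  shows "of_bool (\<forall>s<m. v s = q s) = of_bool ((\<Sum>s<m. q s) = 0) + poisson_slope m q (\<lambda>s. real (v s))"
proof -
  consider "(\<Sum>s<m. v s) = 0" | "(\<Sum>s<m. v s) = 1" using assms by linarith
  then show ?thesis
  proof cases
    case 1
    then show ?thesis by (auto simp: poisson_slope_def)
  next
    case 2
    obtain c where c: "c < m" "\<And>s. s < m \<Longrightarrow> v s = of_bool (s = c)" by (rule sum_eq_1_obtain_unit[OF 2]) blast
    show ?thesis
    proof (cases "(\<Sum>s<m. q s) = 1")
      case True
      obtain d where d: "d < m" "\<And>s. s < m \<Longrightarrow> q s = of_bool (s = d)" by (rule sum_eq_1_obtain_unit[OF True]) blast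
      have "(\<forall>s<m. v s = q s) \<longleftrightarrow> c = d" using c d by auto
      then show ?thesis using True c d by (simp add: poisson_slope_unit[OF d])
    next
      case False
      define S where "S = (\<Sum>s<m. q s)"
      have "\<not> (\<forall>s<m. v s = q s)" using False 2 by (metis (no_types, lifting) lessThan_iff sum.cong)
      moreover have "(\<Sum>s<m. real (v s)) = 1" using 2 by (simp flip: of_nat_sum)
      ultimately show ?thesis using False unfolding poisson_slope_def S_def[symmetric] by auto
    qed
  qed
qed

text \<open>Up to the Minami term, the indicator of a vector of counts is affine in the counts.\<close>
lemma indicator_near_affine:
  fixes q v :: "nat \<Rightarrow> nat"
  assumes TZ: "(\<Sum>s<m. v s) \<le> Z"
  shows "\<bar>of_bool (\<forall>s<m. v s = q s) - of_bool ((\<Sum>s<m. q s) = 0) - poisson_slope m q (\<lambda>s. real (v s))\<bar>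
    \<le> real (Z * (Z - 1))"
proof (cases "(\<Sum>s<m. v s) \<le> 1")
  case True
  then show ?thesis using indicator_eq_affine[OF True, of q] by simp
next
  case False
  define T where "T = (\<Sum>s<m. v s)"
  have T: "2 \<le> T" "T \<le> Z" using False TZ by (auto simp: T_def)
  have neq: "\<not> (\<forall>s<m. v s = q s)" if "(\<Sum>s<m. q s) \<noteq> T"
    using that unfolding T_def by (metis (no_types, lifting) lessThan_iff sum.cong)
  have "\<bar>of_bool (\<forall>s<m. v s = q s) - of_bool ((\<Sum>s<m. q s) = 0) - poisson_slope m q (\<lambda>s. real (v s))\<bar> \<le> real T"
  proof (cases "(\<Sum>s<m. q s) = 1")
    case True
    obtain d where d: "d < m" "\<And>s. s < m \<Longrightarrow> q s = of_bool (s = d)" by (rule sum_eq_1_obtain_unit[OF True]) blast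
    have "v d \<le> T" unfolding T_def using d(1) by (intro member_le_sum) auto
    moreover have "\<not> (\<forall>s<m. v s = q s)" using True T neq by simp
    ultimately show ?thesis using True by (auto simp: poisson_slope_unit[OF d])
  next
    case False
    then show ?thesis using T neq unfolding poisson_slope_def by (auto simp: T_def[symmetric] simp flip: of_nat_sum)
  qed
  also have "T * 1 \<le> Z * (Z - 1)" using T by (intro mult_le_mono) auto
  then have "real T \<le> real (Z * (Z - 1))" by (simp only: mult_1_right of_nat_le_iff)
  finally show ?thesis .
qed

lemma poisson_vec_expand:
  "poisson_vec m \<Lambda> t q = exp (- (t * (\<Sum>s<m. \<Lambda> s))) * t ^ (\<Sum>s<m. q s) * (\<Prod>s<m. \<Lambda> s ^ q s / fact (q s))"
proof -
  have "poisson_vec m \<Lambda> t q = (\<Prod>s<m. exp (- (t * \<Lambda> s)) * t ^ q s * (\<Lambda> s ^ q s / fact (q s)))"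
    unfolding poisson_vec_def poisson_weight_def by (simp add: power_mult_distrib mult.assoc)
  also have "\<dots> = (\<Prod>s<m. exp (- (t * \<Lambda> s))) * (\<Prod>s<m. t ^ q s) * (\<Prod>s<m. \<Lambda> s ^ q s / fact (q s))"
    by (simp only: prod.distrib)
  also have "(\<Prod>s<m. exp (- (t * \<Lambda> s))) = exp (- (t * (\<Sum>s<m. \<Lambda> s)))"
    by (simp add: exp_sum[symmetric] sum_negf sum_distrib_left)
  also have "(\<Prod>s<m. t ^ q s) = t ^ (\<Sum>s<m. q s)" by (rule power_sum[symmetric])
  finally show ?thesis .
qed

lemma poisson_vec_0: "poisson_vec m \<Lambda> 0 q = of_bool ((\<Sum>s<m. q s) = 0)"
  unfolding poisson_vec_expand by (auto simp: power_0_left)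

lemma has_real_derivative_poisson_vec_0:
  "((\<lambda>t. poisson_vec m \<Lambda> t q) has_real_derivative poisson_slope m q \<Lambda>) (at 0)"
proof -
  define S where "S = (\<Sum>s<m. \<Lambda> s)"
  define c where "c = (\<Prod>s<m. \<Lambda> s ^ q s / fact (q s))"
  define j where "j = (\<Sum>s<m. q s)"
  have deriv: "((\<lambda>t. exp (- (t * S)) * t ^ j * c) has_real_derivative (real j * 0 ^ (j - 1) - S * 0 ^ j) * c) (at 0)"
    by (auto intro!: derivative_eq_intros simp: algebra_simps)
  have "(real j * 0 ^ (j - 1) - S * 0 ^ j) * c = poisson_slope m q \<Lambda>"
  proof -
    consider "j = 0" | "j = 1" | "j \<ge> 2" by linarith
    then show ?thesis
    proof cases
      case 1
      then have "c = 1" by (simp add: c_def j_def)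
      then show ?thesis using 1 by (simp add: poisson_slope_def j_def[symmetric] S_def)
    next
      case 2
      obtain d where d: "d < m" "\<And>s. s < m \<Longrightarrow> q s = of_bool (s = d)"
        by (rule sum_eq_1_obtain_unit[OF 2[unfolded j_def]]) blast
      have "c = (\<Prod>s<m. if s = d then \<Lambda> d else 1)" unfolding c_def using d by (intro prod.cong refl) auto
      then show ?thesis using 2 d(1) by (simp add: poisson_slope_unit[OF d])
    next
      case 3
      then show ?thesis by (simp add: power_0_left poisson_slope_def j_def[symmetric])
    qed
  qed
  then show ?thesis
    using deriv unfolding poisson_vec_expand S_def[symmetric] c_def[symmetric] j_def[symmetric] by simp
qed

lemma poisson_vec_rate:
  assumes "filterlim b at_top sequentially"
  shows "(\<lambda>k. b k * (poisson_vec m \<Lambda> (1 / b k) q - of_bool ((\<Sum>s<m. q s) = 0))) \<longlonglongrightarrow> poisson_slope m q \<Lambda>"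
proof -
  have "(\<lambda>k. inverse (b k)) \<longlonglongrightarrow> 0" by (rule tendsto_inverse_0_at_top[OF assms])
  moreover have "\<forall>\<^sub>F k in sequentially. inverse (b k) \<noteq> 0"
    using filterlim_at_top_dense[THEN iffD1, OF assms, rule_format, of 0] by eventually_elim auto
  ultimately have to_0: "filterlim (\<lambda>k. inverse (b k)) (at 0) sequentially" by (simp add: filterlim_at)
  have "((\<lambda>h. (poisson_vec m \<Lambda> (0 + h) q - poisson_vec m \<Lambda> 0 q) / h) \<longlongrightarrow> poisson_slope m q \<Lambda>) (at 0)"
    using has_real_derivative_poisson_vec_0 unfolding DERIV_def .
  from filterlim_compose[OF this to_0] show ?thesis
    unfolding poisson_vec_0 by (simp add: divide_inverse mult.commute)
qed

context anderson
begin

definition vector_law :: "nat \<Rightarrow> ((nat \<Rightarrow> real) \<Rightarrow> nat \<Rightarrow> nat) \<Rightarrow> (nat \<Rightarrow> nat) \<Rightarrow> real" where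
  "vector_law m X r = measure M {w. \<forall>s<m. X w s = r s}"

lemma vector_law_nonneg [simp]: "vector_law m X r \<ge> 0"
  by (simp add: vector_law_def)

lemma sets_vector_event:
  fixes m :: nat and X :: "(nat \<Rightarrow> real) \<Rightarrow> nat \<Rightarrow> nat"
  assumes "\<And>s. s < m \<Longrightarrow> (\<lambda>w. X w s) \<in> measurable M (count_space UNIV)"
  shows "{w. \<forall>s<m. X w s = r s} \<in> sets M"
proof -
  have "{w. \<forall>s<m. X w s = r s} = {w \<in> space M. \<forall>s\<in>{..<m}. X w s = r s}" by auto
  also have "\<dots> \<in> sets M"
  proof (rule sets.sets_Collect_finite_All)
    fix s assume "s \<in> {..<m}"
    then have "(\<lambda>w. X w s) -` {r s} \<inter> space M \<in> sets M" using assms by (intro measurable_sets) auto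
    also have "(\<lambda>w. X w s) -` {r s} \<inter> space M = {w \<in> space M. X w s = r s}" by auto
    finally show "{w \<in> space M. X w s = r s} \<in> sets M" .
  qed simp
  finally show ?thesis .
qed

lemma disjoint_vector_events: "disjoint_family_on (\<lambda>r. {w. \<forall>s<m. X w s = r s}) (count_box m R)"
unfolding disjoint_family_on_def
proof (intro ballI impI)
  fix q q' assume q: "q \<in> count_box m R" "q' \<in> count_box m R" "q \<noteq> q'"
  then obtain s where "s < m" "q s \<noteq> q' s" using count_box_ext[OF q(1,2)] by blast
  then show "{w. \<forall>s<m. X w s = q s} \<inter> {w. \<forall>s<m. X w s = q' s} = {}" by auto
qed

lemma sum_vector_law_le:
  assumes "\<And>s. s < m \<Longrightarrow> (\<lambda>w. X w s) \<in> measurable M (count_space UNIV)"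
  shows "(\<Sum>r\<in>count_box m R. vector_law m X r) \<le> 1"
proof -
  have "(\<Sum>r\<in>count_box m R. vector_law m X r) = measure M (\<Union>r\<in>count_box m R. {w. \<forall>s<m. X w s = r s})"
    unfolding vector_law_def using sets_vector_event[OF assms]
    by (intro M.finite_measure_finite_Union[symmetric] disjoint_vector_events) auto
  also have "\<dots> \<le> 1" by (rule M.prob_le_1)
  finally show ?thesis .
qed

end

locale block_vector = anderson +
  fixes L m :: nat and Y :: "(nat \<Rightarrow> real) \<Rightarrow> nat \<Rightarrow> nat"
  assumes Y_meas: "s < m \<Longrightarrow> (\<lambda>w. Y w s) \<in> measurable M (count_space UNIV)"
    and Y_local: "(\<And>i. i < L \<Longrightarrow> w i = w' i) \<Longrightarrow> Y w = Y w'"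
begin

definition block_sum :: "nat \<Rightarrow> (nat \<Rightarrow> real) \<Rightarrow> nat \<Rightarrow> nat" where
  "block_sum b w s = (\<Sum>j<b. Y (\<lambda>i. w (j * L + i)) s)"

lemma measurable_block_sum:
  assumes "s < m"
  shows "(\<lambda>w. block_sum b w s) \<in> measurable M (count_space UNIV)"
proof -
  have [measurable]: "(\<lambda>w. Y (\<lambda>i. w (j * L + i)) s) \<in> measurable M (count_space UNIV)" for j
    by (rule measurable_compose[OF measurable_reindex Y_meas[OF assms]])
  show ?thesis unfolding block_sum_def by (induction b) (simp_all, measurable)
qed

lemma block_sum_comb_seq: "block_sum (Suc b) (comb_seq (b * L) w w') s = block_sum b w s + Y w' s"
proof -
  have "Y (\<lambda>i. comb_seq (b * L) w w' (j * L + i)) = Y (\<lambda>i. w (j * L + i))" if "j < b" for j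
  proof (rule Y_local)
    fix i assume i: "i < L"
    have "j * L + i < Suc j * L" using i by simp
    also have "\<dots> \<le> b * L" using that by (intro mult_le_mono1) auto
    finally show "comb_seq (b * L) w w' (j * L + i) = w (j * L + i)" by (simp add: comb_seq_def)
  qed
  moreover have "(\<lambda>i. comb_seq (b * L) w w' (b * L + i)) = w'" by (auto simp: comb_seq_def)
  ultimately show ?thesis by (simp add: block_sum_def)
qed

lemma vimage_block_sum_Suc_event:
  "(\<lambda>(w, w'). comb_seq (b * L) w w') -` {w. \<forall>s<m. block_sum (Suc b) w s = r s} =
    (\<Union>q\<in>count_box m r. {w. \<forall>s<m. block_sum b w s = count_diff m r q s} \<times> {w. \<forall>s<m. Y w s = q s})"
    (is "?A = (\<Union>q\<in>_. ?E q)")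
proof (intro equalityI subsetI)
  fix pair assume pair: "pair \<in> ?A"
  obtain w w' where ww: "pair = (w, w')" by (cases pair)
  have sum_eq: "block_sum b w s + Y w' s = r s" if "s < m" for s
    using pair that by (simp add: ww block_sum_comb_seq)
  have "restrict (Y w') {..<m} \<in> count_box m r"
    using sum_eq by (auto simp: count_box_def PiE_iff intro: order.trans[OF le_add2 eq_refl])
  moreover have "pair \<in> ?E (restrict (Y w') {..<m})" using sum_eq by (auto simp: ww count_diff_def simp flip: sum_eq)
  ultimately show "pair \<in> (\<Union>q\<in>count_box m r. ?E q)" by blast
next
  fix pair assume "pair \<in> (\<Union>q\<in>count_box m r. ?E q)"
  then show "pair \<in> ?A" by (auto simp: block_sum_comb_seq count_diff_def dest: count_box_le)
qed

lemma vector_law_block_sum_Suc: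
  "vector_law m (block_sum (Suc b)) r = count_convolution m (vector_law m (block_sum b)) (vector_law m Y) r"
proof -
  interpret MM: pair_prob_space M M ..
  let ?comb = "\<lambda>(w, w'). comb_seq (b * L) w w'"
  let ?E = "\<lambda>q. {w. \<forall>s<m. block_sum b w s = count_diff m r q s} \<times> {w. \<forall>s<m. Y w s = q s}"
  have sets: "{w. \<forall>s<m. block_sum b w s = q s} \<in> sets M" "{w. \<forall>s<m. Y w s = q s} \<in> sets M" for b q
    by (auto intro!: sets_vector_event measurable_block_sum Y_meas)
  have comb: "?comb \<in> measurable (M \<Otimes>\<^sub>M M) M" "distr (M \<Otimes>\<^sub>M M) M ?comb = M"
    unfolding M_def by (rule measurable_comb_seq, rule seq.PiM_comb_seq)
  have "vector_law m (block_sum (Suc b)) r = measure (distr (M \<Otimes>\<^sub>M M) M ?comb) {w. \<forall>s<m. block_sum (Suc b) w s = r s}"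
    unfolding vector_law_def comb(2) ..
  also have "\<dots> = measure (M \<Otimes>\<^sub>M M) (\<Union>q\<in>count_box m r. ?E q)"
    unfolding measure_distr[OF comb(1) sets(1)] vimage_block_sum_Suc_event by (simp add: space_pair_measure)
  also have "\<dots> = (\<Sum>q\<in>count_box m r. measure (M \<Otimes>\<^sub>M M) (?E q))"
  proof (rule MM.finite_measure_finite_Union)
    show "disjoint_family_on ?E (count_box m r)"
      using disjoint_vector_events[of m Y r] unfolding disjoint_family_on_def by blast
  qed (use sets in auto)
  also have "\<dots> = (\<Sum>q\<in>count_box m r. vector_law m (block_sum b) (count_diff m r q) * vector_law m Y q)"
    unfolding vector_law_def using sets
    by (intro sum.cong refl) (simp add: measure_def M.emeasure_pair_measure_Times enn2real_mult)
  finally show ?thesis unfolding count_convolution_def .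
qed

lemma vector_law_block_sum_0: "vector_law m (block_sum 0) r = poisson_vec m \<Lambda> 0 r"
proof (cases "\<forall>s<m. r s = 0")
  case True
  then have "{w :: nat \<Rightarrow> real. \<forall>s<m. block_sum 0 w s = r s} = space M" by (auto simp: block_sum_def)
  then show ?thesis using True by (simp add: vector_law_def poisson_vec_0 M.prob_space[unfolded space_M])
next
  case False
  then have empty: "{w. \<forall>s<m. block_sum 0 w s = r s} = {}" by (auto simp: block_sum_def)
  show ?thesis unfolding vector_law_def empty poisson_vec_0 using False by auto
qed

theorem vector_law_block_sum_poisson_bound:
  assumes b: "b > 0" and \<Lambda>: "\<And>s. \<Lambda> s \<ge> 0"
  shows "\<bar>vector_law m (block_sum b) r - poisson_vec m \<Lambda> 1 r\<bar> \<le>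
    real b * (\<Sum>q\<in>count_box m r. \<bar>vector_law m Y q - poisson_vec m \<Lambda> (1 / real b) q\<bar>)"
proof -
  let ?t = "1 / real b"
  let ?F = "\<lambda>c. vector_law m (block_sum c)" and ?G = "\<lambda>c. poisson_vec m \<Lambda> (real c * (1 / real b))"
  define r' where "r' = restrict r {..<m}"
  have r': "r' \<in> count_box m r" by (auto simp: r'_def count_box_def)
  have "\<bar>?F b r - ?G b r\<bar> = \<bar>?F b r' - ?G b r'\<bar>"
    by (simp add: vector_law_def poisson_vec_def r'_def cong: prod.cong_simp)
  also have "\<dots> \<le> (\<Sum>q\<in>count_box m r. \<bar>?F b q - ?G b q\<bar>)"
    using r' by (intro member_le_sum) auto
  also have "\<dots> \<le> real b * (\<Sum>q\<in>count_box m r. \<bar>vector_law m Y q - poisson_vec m \<Lambda> ?t q\<bar>)"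
  proof (rule Le_Cam[where F = ?F and G = ?G])
    show "?G (Suc c) q = count_convolution m (?G c) (poisson_vec m \<Lambda> ?t) q" for c q
      unfolding poisson_vec_add[symmetric] by (simp add: add_divide_distrib add.commute)
    show "poisson_vec m \<Lambda> ?t q \<ge> 0" for q using \<Lambda> by (intro poisson_vec_nonneg) auto
    show "?F 0 q = ?G 0 q" for q using vector_law_block_sum_0[of q \<Lambda>] by simp
    show "(\<Sum>q\<in>count_box m r. poisson_vec m \<Lambda> ?t q) \<le> 1" using \<Lambda> by (intro sum_poisson_vec_le) auto
  qed (auto intro!: vector_law_block_sum_Suc sum_vector_law_le measurable_block_sum)
  finally show ?thesis using b by simp
qed

end

lemma has_bochner_integral_poisson_slope:
  assumes v: "\<And>s. s < m \<Longrightarrow> has_bochner_integral M (\<lambda>w. v w s) (V s)"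
  shows "has_bochner_integral M (\<lambda>w. poisson_slope m q (v w)) (poisson_slope m q V)"
proof -
  define j where "j = (\<Sum>s<m. q s)"
  have "has_bochner_integral M (\<lambda>w. \<Sum>s<m. c s * v w s) (\<Sum>s<m. c s * V s)" for c :: "nat \<Rightarrow> real"
    using v by (intro has_bochner_integral_sum has_bochner_integral_mult_right) auto
  from this[of "\<lambda>s. real (q s)"] has_bochner_integral_minus[OF this[of "\<lambda>_. 1"]] show ?thesis
    unfolding poisson_slope_def j_def[symmetric] by (cases "j = 0"; cases "j = 1") auto
qed

context anderson
begin

lemma has_bochner_integral_vector_event:
  fixes m :: nat
  assumes "\<And>s. s < m \<Longrightarrow> (\<lambda>w. X w s) \<in> measurable M (count_space UNIV)"
  shows "has_bochner_integral M (\<lambda>w. of_bool (\<forall>s<m. X w s = r s)) (vector_law m X r)"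
proof -
  let ?E = "{w. \<forall>s<m. X w s = r s}"
  have "has_bochner_integral M (indicator ?E) (measure M ?E)"
    using sets_vector_event[OF assms] by (intro has_bochner_integral_real_indicator) (auto simp: less_top[symmetric])
  moreover have "(\<lambda>w. of_bool (\<forall>s<m. X w s = r s) :: real) = indicator ?E" by (auto simp: indicator_def)
  ultimately show ?thesis by (simp add: vector_law_def)
qed

lemma abs_vector_law_diff_le:
  fixes m :: nat
  assumes X: "\<And>s. s < m \<Longrightarrow> (\<lambda>w. X w s) \<in> measurable M (count_space UNIV)"
    and Y: "\<And>s. s < m \<Longrightarrow> (\<lambda>w. Y w s) \<in> measurable M (count_space UNIV)"
    and int: "\<And>s. s < m \<Longrightarrow> integrable M (\<lambda>w. \<bar>real (X w s) - real (Y w s)\<bar>)"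
  shows "\<bar>vector_law m X r - vector_law m Y r\<bar> \<le> (\<Sum>s<m. \<integral>w. \<bar>real (X w s) - real (Y w s)\<bar> \<partial>M)"
proof -
  let ?d = "\<lambda>w. of_bool (\<forall>s<m. X w s = r s) - of_bool (\<forall>s<m. Y w s = r s) :: real"
  have d: "has_bochner_integral M ?d (vector_law m X r - vector_law m Y r)"
    by (intro has_bochner_integral_diff has_bochner_integral_vector_event X Y)
  have d_le: "\<bar>?d w\<bar> \<le> (\<Sum>s<m. \<bar>real (X w s) - real (Y w s)\<bar>)" for w
  proof (cases "\<forall>s<m. X w s = Y w s")
    case True
    then show ?thesis by simp
  next
    case False
    then obtain s where s: "s < m" "X w s \<noteq> Y w s" by blast
    have "\<bar>?d w\<bar> \<le> 1" by simp
    also have "\<dots> \<le> \<bar>real (X w s) - real (Y w s)\<bar>" using s(2) by linarith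
    also have "\<dots> \<le> (\<Sum>s<m. \<bar>real (X w s) - real (Y w s)\<bar>)" using s(1) by (intro member_le_sum) auto
    finally show ?thesis .
  qed
  have "\<bar>vector_law m X r - vector_law m Y r\<bar> \<le> (\<integral>w. \<bar>?d w\<bar> \<partial>M)"
    using integral_abs_bound[of M ?d] unfolding has_bochner_integral_integral_eq[OF d] .
  also have "\<dots> \<le> (\<integral>w. (\<Sum>s<m. \<bar>real (X w s) - real (Y w s)\<bar>) \<partial>M)"
    using d int d_le by (intro integral_mono Bochner_Integration.integrable_sum) (auto simp: has_bochner_integral_iff)
  also have "\<dots> = (\<Sum>s<m. \<integral>w. \<bar>real (X w s) - real (Y w s)\<bar> \<partial>M)"
    using int by (intro Bochner_Integration.integral_sum) auto
  finally show ?thesis .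
qed

lemma vector_law_near_affine:
  fixes m :: nat
  assumes X: "\<And>s. s < m \<Longrightarrow> (\<lambda>w. X w s) \<in> measurable M (count_space UNIV)"
    and int: "\<And>s. s < m \<Longrightarrow> integrable M (\<lambda>w. real (X w s))"
    and Z: "integrable M (\<lambda>w. real (Z w * (Z w - 1)))" "\<And>w. (\<Sum>s<m. X w s) \<le> Z w"
  shows "\<bar>vector_law m X q - of_bool ((\<Sum>s<m. q s) = 0) - poisson_slope m q (\<lambda>s. \<integral>w. real (X w s) \<partial>M)\<bar>
    \<le> (\<integral>w. real (Z w * (Z w - 1)) \<partial>M)"
proof -
  let ?f = "\<lambda>w. of_bool (\<forall>s<m. X w s = q s) - of_bool ((\<Sum>s<m. q s) = 0) - poisson_slope m q (\<lambda>s. real (X w s))"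
  let ?c = "vector_law m X q - of_bool ((\<Sum>s<m. q s) = 0) - poisson_slope m q (\<lambda>s. \<integral>w. real (X w s) \<partial>M)"
  have "has_bochner_integral M (\<lambda>w. of_bool ((\<Sum>s<m. q s) = 0) :: real) (of_bool ((\<Sum>s<m. q s) = 0))"
    using M.prob_space by (simp add: has_bochner_integral_iff)
  then have f: "has_bochner_integral M ?f ?c"
    using int by (intro has_bochner_integral_diff has_bochner_integral_vector_event X
        has_bochner_integral_poisson_slope has_bochner_integral_integrable)
  have "\<bar>?c\<bar> \<le> (\<integral>w. \<bar>?f w\<bar> \<partial>M)"
    using integral_abs_bound[of M ?f] unfolding has_bochner_integral_integral_eq[OF f] .
  also have "\<dots> \<le> (\<integral>w. real (Z w * (Z w - 1)) \<partial>M)"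
    using f Z(1) by (intro integral_mono indicator_near_affine Z(2)) (auto simp: has_bochner_integral_iff)
  finally show ?thesis .
qed

end

section \<open>The hierarchical Anderson model\<close>

locale hierarchical_anderson = anderson \<gamma> \<Gamma> + hierarchy n p for \<gamma> \<Gamma> n p
begin

sublocale level: anderson_matrix \<gamma> \<Gamma> "n ^ i" "hier_kernel n p j" for i j
  by unfold_locales (auto simp: hier_kernel_sym)

definition level_dos :: "nat \<Rightarrow> real measure" where
  "level_dos j = anderson_matrix.dos \<gamma> (n ^ j) (hier_kernel n p j)"

lemma sets_level_dos [measurable_cong, simp]: "sets (level_dos j) = sets borel"
  unfolding level_dos_def by (rule level.sets_dos)

lemma space_level_dos [simp]: "space (level_dos j) = UNIV"
  using sets_eq_imp_space_eq[OF sets_level_dos] by simp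

lemma prob_space_level_dos: "prob_space (level_dos j)"
  unfolding level_dos_def by (rule level.prob_space_dos)

lemma ball_green_digit_shift:
  assumes "Im z > 0"
  shows "ball_green b w z j b = green {..<n ^ j} (hier_kernel n p j) (\<lambda>i. w (digit_shift n j b i)) z 0 0"
proof -
  have "green (hball n b j) (hier_kernel n p j) w z (digit_shift n j b 0) (digit_shift n j b 0) =
      green {..<n ^ j} (hier_kernel n p j) (\<lambda>i. w (digit_shift n j b i)) z 0 0"
    by (rule green_equivariant)
      (auto simp: assms symmetric_kernel_hier_kernel bij_betw_digit_shift hier_kernel_digit_shift)
  then show ?thesis by (simp add: ball_green_def digit_shift_0)
qed

lemma nn_integral_Im_ball_green:
  assumes z: "Im z > 0"
  shows "(\<integral>\<^sup>+w. ennreal (Im (ball_green b w z j b)) \<partial>M) =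
    (\<integral>\<^sup>+w. ennreal (Im (green {..<n ^ j} (hier_kernel n p j) w z 0 0)) \<partial>M)"
proof -
  have [measurable]: "(\<lambda>w. green {..<n ^ j} (hier_kernel n p j) w z 0 0) \<in> borel_measurable M"
    by (rule measurable_green[OF symmetric_kernel_hier_kernel z]) auto
  have "(\<lambda>w. ennreal (Im (green {..<n ^ j} (hier_kernel n p j) w z 0 0))) \<in> borel_measurable M" by measurable
  then show ?thesis unfolding ball_green_digit_shift[OF z]
    by (rule nn_integral_reindex[OF _ inj_digit_shift[OF n_pos]])
qed

lemma measurable_ball_green:
  assumes "Im z > 0"
  shows "(\<lambda>w. ball_green x0 w z j x0) \<in> borel_measurable M"
  unfolding ball_green_def using assms by (intro measurable_green symmetric_kernel_hier_kernel) auto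

lemma norm_ball_green_le:
  assumes z: "Im z > 0"
  shows "cmod (ball_green x0 w z j x0) \<le> 1 / Im z"
proof -
  interpret symmetric_kernel "hball n x0 j" "hier_kernel n p j" by (rule symmetric_kernel_hier_kernel) simp
  show ?thesis unfolding ball_green_def by (rule norm_green_le[OF z]) simp
qed

lemma integrable_ball_green:
  assumes "Im z > 0"
  shows "integrable M (\<lambda>w. ball_green x0 w z j x0)"
  using norm_ball_green_le[OF assms] measurable_ball_green[OF assms]
  by (intro M.integrable_const_bound[of _ "1 / Im z"]) auto

lemma integrable_hresolvent:
  assumes z: "Im z > 0"
  shows "integrable M (\<lambda>w. hresolvent n p x0 w z)"
proof (rule M.integrable_const_bound[of _ "1 / Im z"])
  have lim: "(\<lambda>j. ball_green x0 w z j x0) \<longlonglongrightarrow> hresolvent n p x0 w z" for w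
    unfolding hresolvent_eq_lattice_green[OF z] by (rule ball_green_tendsto[OF z])
  show "(\<lambda>w. hresolvent n p x0 w z) \<in> borel_measurable M"
    by (rule borel_measurable_LIMSEQ_metric[OF measurable_ball_green[OF z] lim])
  have "cmod (hresolvent n p x0 w z) \<le> 1 / Im z" for w
    by (rule LIMSEQ_le_const2[OF tendsto_norm[OF lim]]) (use norm_ball_green_le[OF z] in blast)
  then show "AE w in M. cmod (hresolvent n p x0 w z) \<le> 1 / Im z" by simp
qed

lemma nn_integral_poisson_kernel_level_dos:
  assumes y: "y > 0"
  shows "(\<integral>\<^sup>+t. ennreal (poisson_kernel y E t) \<partial>level_dos j) =
    ennreal (Im (\<integral>w. ball_green x0 w (Complex E y) j x0 \<partial>M))"
proof -
  let ?z = "Complex E y" and ?g = "\<lambda>x. \<integral>\<^sup>+w. ennreal (Im (green {..<n ^ j} (hier_kernel n p j) w (Complex E y) x x)) \<partial>M"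
  have z: "Im ?z > 0" using y by simp
  have site_eq: "?g x = ?g 0" if "x < n ^ j" for x
  proof -
    have "hball n x j = {..<n ^ j}" using that by (auto simp: hball_eq_atLeastLessThan)
    then show ?thesis using nn_integral_Im_ball_green[OF z, of x j] by (simp add: ball_green_def)
  qed
  have "(\<Sum>x<n ^ j. ?g x) = (\<Sum>x<n ^ j. ?g 0)" by (intro sum.cong refl site_eq) simp
  also have "\<dots> = ?g 0 * ennreal (real (n ^ j))" by (simp add: ennreal_of_nat_eq_real_of_nat mult.commute)
  finally have "(\<integral>\<^sup>+t. ennreal (poisson_kernel y E t) \<partial>level_dos j) = ?g 0 * ennreal (real (n ^ j)) / ennreal (real (n ^ j))"
    unfolding level_dos_def level.nn_integral_poisson_kernel_dos[OF y] by simp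
  also have "\<dots> = ?g 0" by (simp add: ennreal_mult_divide_eq)
  also have "\<dots> = (\<integral>\<^sup>+w. ennreal (Im (ball_green x0 w ?z j x0)) \<partial>M)" by (rule nn_integral_Im_ball_green[OF z, symmetric])
  also have "\<dots> = ennreal (\<integral>w. Im (ball_green x0 w ?z j x0) \<partial>M)"
  proof (rule nn_integral_eq_integral)
    interpret symmetric_kernel "hball n x0 j" "hier_kernel n p j" by (rule symmetric_kernel_hier_kernel) simp
    show "AE w in M. 0 \<le> Im (ball_green x0 w ?z j x0)"
      unfolding ball_green_def using Im_green_pos[OF z hball_self] by (intro AE_I2 less_imp_le)
  qed (use integrable_ball_green[OF z] in simp)
  also have "(\<integral>w. Im (ball_green x0 w ?z j x0) \<partial>M) = Im (\<integral>w. ball_green x0 w ?z j x0 \<partial>M)"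
    by (rule integral_Im[OF integrable_ball_green[OF z]])
  finally show ?thesis .
qed

lemma integral_ball_green_close:
  assumes z: "Im z > 0"
  shows "cmod ((\<integral>w. ball_green x0 w z j x0 \<partial>M) - (\<integral>w. hresolvent n p x0 w z \<partial>M)) \<le> coupling_tail j / (Im z)\<^sup>2"
proof -
  let ?d = "\<lambda>w. ball_green x0 w z j x0 - hresolvent n p x0 w z"
  have "(\<integral>w. ball_green x0 w z j x0 \<partial>M) - (\<integral>w. hresolvent n p x0 w z \<partial>M) = (\<integral>w. ?d w \<partial>M)"
    by (rule Bochner_Integration.integral_diff[symmetric, OF integrable_ball_green[OF z] integrable_hresolvent[OF z]])
  also have "cmod \<dots> \<le> (\<integral>w. cmod (?d w) \<partial>M)" by (rule integral_norm_bound)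
  also have "\<dots> \<le> (\<integral>w. coupling_tail j / (Im z)\<^sup>2 \<partial>M)"
    using hresolvent_close[OF z, of x0 _ j]
    by (intro integral_mono integrable_norm Bochner_Integration.integrable_diff integrable_ball_green
        integrable_hresolvent z) (auto simp: norm_minus_commute)
  also have "\<dots> = coupling_tail j / (Im z)\<^sup>2" using M.prob_space by simp
  finally show ?thesis .
qed

end

section \<open>Decoupling\<close>

locale decoupled_anderson = hierarchical_anderson +
  fixes e :: real and l :: "nat \<Rightarrow> nat"
  assumes l_le: "l k \<le> k"
    and l_gap: "filterlim (\<lambda>k. k - l k) at_top sequentially"
    and l_tail: "(\<lambda>k. (real n ^ k)\<^sup>2 * coupling_tail (l k)) \<longlonglongrightarrow> 0"
begin

definition window :: "nat \<Rightarrow> real set \<Rightarrow> real set" where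
  "window k A = {t. real n ^ k * (t - e) \<in> A}"

lemma window_Un: "window k (A \<union> B) = window k A \<union> window k B"
  and window_Int: "window k (A \<inter> B) = window k A \<inter> window k B"
  and window_UN: "window k (\<Union>s\<in>T. f s) = (\<Union>s\<in>T. window k (f s))"
  and window_empty: "window k {} = {}"
  by (auto simp: window_def)

lemma window_mono: "A \<subseteq> B \<Longrightarrow> window k A \<subseteq> window k B"
  by (auto simp: window_def)

lemma window_Icc: "window k {a..b} = {e + a / real n ^ k..e + b / real n ^ k}"
  by (auto simp: window_def field_simps)

lemma sets_window [measurable]:
  assumes "A \<in> sets borel"
  shows "window k A \<in> sets borel"
proof -
  have "(\<lambda>t. real n ^ k * (t - e)) -` A \<inter> space borel \<in> sets borel" using assms by (intro measurable_sets) auto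
  then show ?thesis by (simp add: window_def vimage_def)
qed

lemma emeasure_window:
  assumes "A \<in> sets borel"
  shows "emeasure lborel A = ennreal (real n ^ k) * emeasure lborel (window k A)"
proof -
  let ?f = "\<lambda>t. - (real n ^ k * e) + real n ^ k * t"
  have "emeasure lborel A = emeasure (density (distr lborel borel ?f) (\<lambda>_. ennreal \<bar>real n ^ k\<bar>)) A"
    by (subst lborel_real_affine[of "real n ^ k" "- (real n ^ k * e)"]) auto
  also have "\<dots> = ennreal (real n ^ k) * emeasure (distr lborel borel ?f) A"
    using assms by (simp add: emeasure_density nn_integral_cmult_indicator)
  also have "emeasure (distr lborel borel ?f) A = emeasure lborel (?f -` A \<inter> space lborel)"
    using assms by (intro emeasure_distr) auto
  also have "?f -` A \<inter> space lborel = window k A" by (auto simp: window_def algebra_simps)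
  finally show ?thesis .
qed

definition scaled_count :: "nat \<Rightarrow> nat \<Rightarrow> nat \<Rightarrow> (nat \<Rightarrow> real) \<Rightarrow> real set \<Rightarrow> nat" where
  "scaled_count i j k w A = eig_count (n ^ i) (hier_kernel n p j) w (window k A)"

abbreviation "full_count k \<equiv> scaled_count k k k"

abbreviation "decoupled_count k \<equiv> scaled_count k (l k) k"

abbreviation "block_count k \<equiv> scaled_count (l k) (l k) k"

lemma measurable_scaled_count:
  "A \<in> sets borel \<Longrightarrow> (\<lambda>w. scaled_count i j k w A) \<in> measurable M (count_space UNIV)"
  unfolding scaled_count_def by (intro level.measurable_eig_count sets_window)

lemma integrable_scaled_count: "A \<in> sets borel \<Longrightarrow> integrable M (\<lambda>w. real (scaled_count i j k w A))"
  unfolding scaled_count_def by (intro level.integrable_eig_count sets_window)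

lemma scaled_count_Un:
  "A \<inter> B = {} \<Longrightarrow> scaled_count i j k w (A \<union> B) = scaled_count i j k w A + scaled_count i j k w B"
  unfolding scaled_count_def window_Un by (intro eig_count_Un) (simp add: window_empty flip: window_Int)

lemma sum_scaled_count:
  assumes "disjoint_family_on A {..<m::nat}"
  shows "(\<Sum>s<m. scaled_count i j k w (A s)) = scaled_count i j k w (\<Union>s<m. A s)"
proof -
  have "disjoint_family_on (\<lambda>s. window k (A s)) {..<m}"
    using assms by (auto simp: disjoint_family_on_def window_def)
  then show ?thesis unfolding scaled_count_def window_UN by (intro eig_count_UN[symmetric]) auto
qed

lemma scaled_count_mono: "A \<subseteq> B \<Longrightarrow> scaled_count i j k w A \<le> scaled_count i j k w B"
  unfolding scaled_count_def by (intro eig_count_mono window_mono)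

lemma expectation_scaled_count_le:
  assumes A: "A \<in> sets borel" "emeasure lborel A < \<infinity>"
  shows "(\<integral>w. real (scaled_count k j k w A) \<partial>M) \<le> \<Gamma> * measure lborel A"
proof -
  have "emeasure lborel (window k A) < \<infinity>"
    using A emeasure_window[OF A(1), of k] n_pos by (auto simp: ennreal_mult_less_top)
  then have "(\<integral>w. real (scaled_count k j k w A) \<partial>M) \<le> real (n ^ k) * (\<Gamma> * measure lborel (window k A))"
    unfolding scaled_count_def using A by (intro level.expectation_eig_count_le sets_window)
  also have "\<dots> = \<Gamma> * measure lborel A"
    unfolding measure_def emeasure_window[OF A(1), of k] by (simp add: enn2real_mult)
  finally show ?thesis .
qed

lemma scaled_count_Weyl:
  assumes "\<delta> \<ge> 0" "\<And>x. (\<Sum>y<n ^ i. \<bar>hier_kernel n p j' x y - hier_kernel n p j x y\<bar>) \<le> \<delta>"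
  shows "scaled_count i j k w {u..v} \<le> scaled_count i j' k w {u - real n ^ k * \<delta>..v + real n ^ k * \<delta>}"
proof -
  have "eig_count (n ^ i) (hier_kernel n p j) w {e + u / real n ^ k..e + v / real n ^ k} \<le>
      eig_count (n ^ i) (hier_kernel n p j') w {e + u / real n ^ k - \<delta>..e + v / real n ^ k + \<delta>}"
    using assms by (intro level.eig_count_Weyl level.matrix_kernel_axioms) auto
  then show ?thesis unfolding scaled_count_def window_Icc by (simp add: diff_divide_distrib add_divide_distrib add_diff_eq add.assoc)
qed

definition count_gap :: "nat \<Rightarrow> real set \<Rightarrow> (nat \<Rightarrow> real) \<Rightarrow> real" where
  "count_gap k A w = \<bar>real (full_count k w A) - real (decoupled_count k w A)\<bar>"

definition count_distance :: "nat \<Rightarrow> real set \<Rightarrow> real" where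
  "count_distance k A = (\<integral>w. count_gap k A w \<partial>M)"

lemma integrable_count_gap: "A \<in> sets borel \<Longrightarrow> integrable M (count_gap k A)"
  unfolding count_gap_def
  by (intro integrable_abs Bochner_Integration.integrable_diff integrable_scaled_count)

lemma count_distance_nonneg: "count_distance k A \<ge> 0"
  unfolding count_distance_def by (intro Bochner_Integration.integral_nonneg) (simp add: count_gap_def)

lemma count_distance_add_le:
  assumes "A \<in> sets borel" "B \<in> sets borel" "C \<in> sets borel"
    and "\<And>w. count_gap k A w \<le> count_gap k B w + count_gap k C w"
  shows "count_distance k A \<le> count_distance k B + count_distance k C"
  unfolding count_distance_def Bochner_Integration.integral_add[OF assms(2,3)[THEN integrable_count_gap], symmetric]
  using assms by (intro integral_mono Bochner_Integration.integrable_add integrable_count_gap)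

lemma count_distance_le_lborel:
  assumes A: "A \<in> sets borel" and W: "W \<in> sets borel" "emeasure lborel W < \<infinity>"
    and gap_le: "\<And>w. count_gap k A w \<le> real (full_count k w W) + real (decoupled_count k w W)"
  shows "count_distance k A \<le> 2 * \<Gamma> * measure lborel W"
proof -
  have "count_distance k A \<le> (\<integral>w. real (full_count k w W) + real (decoupled_count k w W) \<partial>M)"
    unfolding count_distance_def
    using A W by (intro integral_mono gap_le integrable_count_gap Bochner_Integration.integrable_add integrable_scaled_count)
  also have "\<dots> = (\<integral>w. real (full_count k w W) \<partial>M) + (\<integral>w. real (decoupled_count k w W) \<partial>M)"
    using W by (intro Bochner_Integration.integral_add integrable_scaled_count)
  also have "\<dots> \<le> \<Gamma> * measure lborel W + \<Gamma> * measure lborel W"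
    by (intro add_mono expectation_scaled_count_le W)
  finally show ?thesis by simp
qed

text \<open>By Weyl's inequality the two counts differ only by eigenvalues near the end points of the interval,
  which are few by the Wegner estimate.\<close>
lemma count_distance_Icc_le:
  assumes uv: "u \<le> v"
  shows "count_distance k {u..v} \<le> 4 * \<Gamma> * (real n ^ k * coupling_tail (l k))"
proof -
  define d where "d = real n ^ k * coupling_tail (l k)"
  let ?W = "{u - d..<u} \<union> {v<..v + d}"
  have d: "d \<ge> 0" unfolding d_def using coupling_tail_nonneg by simp
  have "{u - d..v + d} = {u..v} \<union> ?W" "{u..v} \<inter> ?W = {}" using uv d by auto
  then have split: "scaled_count k j k w {u - d..v + d} = scaled_count k j k w {u..v} + scaled_count k j k w ?W" for j w
    by (simp only: scaled_count_Un)
  have row: "(\<Sum>y<n ^ k. \<bar>hier_kernel n p k x y - hier_kernel n p (l k) x y\<bar>) \<le> coupling_tail (l k)" for x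
    by (rule hier_kernel_diff_row_sum_le[OF _ l_le]) simp
  then have row': "(\<Sum>y<n ^ k. \<bar>hier_kernel n p (l k) x y - hier_kernel n p k x y\<bar>) \<le> coupling_tail (l k)" for x
    by (simp add: abs_minus_commute)
  have "count_gap k {u..v} w \<le> real (full_count k w ?W) + real (decoupled_count k w ?W)" for w
    using scaled_count_Weyl[OF coupling_tail_nonneg row', of k w u v]
      scaled_count_Weyl[OF coupling_tail_nonneg row, of k w u v]
    unfolding d_def[symmetric] split count_gap_def by linarith
  moreover have "emeasure lborel ?W < \<infinity>" by (intro emeasure_bounded_finite) auto
  ultimately have "count_distance k {u..v} \<le> 2 * \<Gamma> * measure lborel ?W"
    by (intro count_distance_le_lborel) auto
  also have "\<dots> \<le> 2 * \<Gamma> * (measure lborel {u - d..<u} + measure lborel {v<..v + d})"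
    using \<Gamma>_nonneg by (intro mult_left_mono measure_Un_le) auto
  also have "\<dots> = 4 * \<Gamma> * d" using d by simp
  finally show ?thesis unfolding d_def .
qed

lemma scaled_coupling_tail_tendsto: "(\<lambda>k. real n ^ k * coupling_tail (l k)) \<longlonglongrightarrow> 0"
proof (rule Lim_null_comparison[OF _ l_tail], intro always_eventually allI)
  fix k
  have "1 * (real n ^ k * coupling_tail (l k)) \<le> real n ^ k * (real n ^ k * coupling_tail (l k))"
    using n2 coupling_tail_nonneg by (intro mult_right_mono) auto
  then show "norm (real n ^ k * coupling_tail (l k)) \<le> (real n ^ k)\<^sup>2 * coupling_tail (l k)"
    using coupling_tail_nonneg[of "l k"] by (simp add: power2_eq_square ac_simps)
qed

theorem count_distance_tendsto:
  assumes "A \<in> sets borel" "bounded A"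
  shows "(\<lambda>k. count_distance k A) \<longlonglongrightarrow> 0"
proof -
  interpret vanishing_discrepancy count_distance "2 * \<Gamma>"
  proof
    fix k :: nat and A :: "real set" assume A: "A \<in> sets borel" "bounded A"
    show "count_distance k A \<le> 2 * \<Gamma> * measure lborel A"
      using A by (intro count_distance_le_lborel emeasure_bounded_finite) (auto simp: count_gap_def)
    fix B :: "real set" assume B: "B \<in> sets borel" "A \<inter> B = {}"
    show "count_distance k (A \<union> B) \<le> count_distance k A + count_distance k B"
      using A B by (intro count_distance_add_le) (auto simp: count_gap_def scaled_count_Un)
    show "count_distance k A \<le> count_distance k (A \<union> B) + count_distance k B"
      using A B by (intro count_distance_add_le) (auto simp: count_gap_def scaled_count_Un)
  next
    fix u v :: real assume "u \<le> v"
    then have "\<forall>k. norm (count_distance k {u..v}) \<le> 4 * \<Gamma> * (real n ^ k * coupling_tail (l k))"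
      using count_distance_Icc_le count_distance_nonneg by simp
    then show "(\<lambda>k. count_distance k {u..v}) \<longlonglongrightarrow> 0"
      by (rule Lim_null_comparison[OF always_eventually tendsto_mult_right_zero[OF scaled_coupling_tail_tendsto]])
  qed (rule count_distance_nonneg)
  show ?thesis by (rule tendsto_0[OF assms])
qed

lemma vector_law_full_count_close:
  assumes "\<And>s. s < m \<Longrightarrow> A s \<in> sets borel"
  shows "\<bar>vector_law m (\<lambda>w s. full_count k w (A s)) r - vector_law m (\<lambda>w s. decoupled_count k w (A s)) r\<bar>
    \<le> (\<Sum>s<m. count_distance k (A s))"
  unfolding count_distance_def count_gap_def
  by (intro abs_vector_law_diff_le measurable_scaled_count integrable_count_gap[unfolded count_gap_def] assms)

definition num_blocks :: "nat \<Rightarrow> nat" where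
  "num_blocks k = n ^ (k - l k)"

lemma num_blocks_mult: "num_blocks k * n ^ l k = n ^ k"
  unfolding num_blocks_def using l_le[of k] by (simp flip: power_add)

lemma num_blocks_pos: "num_blocks k > 0"
  by (simp add: num_blocks_def)

lemma num_blocks_at_top: "filterlim (\<lambda>k. real (num_blocks k)) at_top sequentially"
proof -
  have gap_le: "real (k - l k) \<le> real (num_blocks k)" for k
  proof -
    have "k - l k < 2 ^ (k - l k)" by (rule less_exp)
    also have "\<dots> \<le> n ^ (k - l k)" using n2 by (intro power_mono) auto
    finally show ?thesis by (simp add: num_blocks_def)
  qed
  have "filterlim (\<lambda>k. real (k - l k)) at_top sequentially"
    by (rule filterlim_compose[OF filterlim_real_sequentially l_gap])
  then show ?thesis by (rule filterlim_at_top_mono) (intro always_eventually allI gap_le)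
qed

lemma decoupled_count_blocks:
  "decoupled_count k w A = (\<Sum>j<num_blocks k. block_count k (\<lambda>i. w (j * n ^ l k + i)) A)"
  unfolding scaled_count_def num_blocks_mult[of k, symmetric] by (rule eig_count_hier_kernel_blocks) simp

theorem vector_law_decoupled_count_poisson_bound:
  assumes A: "\<And>s. s < m \<Longrightarrow> A s \<in> sets borel" and \<Lambda>: "\<And>s. \<Lambda> s \<ge> 0"
  shows "\<bar>vector_law m (\<lambda>w s. decoupled_count k w (A s)) r - poisson_vec m \<Lambda> 1 r\<bar> \<le>
    real (num_blocks k) * (\<Sum>q\<in>count_box m r.
      \<bar>vector_law m (\<lambda>w s. block_count k w (A s)) q - poisson_vec m \<Lambda> (1 / real (num_blocks k)) q\<bar>)"
proof -
  interpret block_vector \<gamma> \<Gamma> "n ^ l k" m "\<lambda>w s. block_count k w (A s)"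
  proof
    show "(\<lambda>w. block_count k w (A s)) \<in> measurable M (count_space UNIV)" if "s < m" for s
      by (rule measurable_scaled_count[OF A[OF that]])
    show "(\<lambda>s. block_count k w (A s)) = (\<lambda>s. block_count k w' (A s))" if "\<And>i. i < n ^ l k \<Longrightarrow> w i = w' i" for w w'
      unfolding scaled_count_def using that by (intro ext eig_count_cong) auto
  qed
  have "(\<lambda>w s. decoupled_count k w (A s)) = block_sum (num_blocks k)"
    unfolding block_sum_def decoupled_count_blocks ..
  then show ?thesis using vector_law_block_sum_poisson_bound[OF num_blocks_pos \<Lambda>, of k r] by simp
qed

definition rescaled_dos :: "nat \<Rightarrow> real measure" where
  "rescaled_dos k = scale_measure (ennreal (real n ^ k)) (distr (level_dos (l k)) borel (\<lambda>t. real n ^ k * (t - e)))"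

lemma sets_rescaled_dos [simp]: "sets (rescaled_dos k) = sets borel"
  by (simp add: rescaled_dos_def)

lemma emeasure_rescaled_dos:
  assumes "A \<in> sets borel"
  shows "emeasure (rescaled_dos k) A = ennreal (real n ^ k) * emeasure (level_dos (l k)) (window k A)"
  unfolding rescaled_dos_def emeasure_scale_measure using assms
  by (subst emeasure_distr) (auto simp: window_def vimage_def)

lemma finite_rescaled_dos: "finite_measure (rescaled_dos k)"
proof
  interpret prob_space "level_dos (l k)" by (rule prob_space_level_dos)
  have "emeasure (rescaled_dos k) UNIV < \<infinity>"
    by (simp add: emeasure_rescaled_dos emeasure_eq_measure ennreal_mult_less_top)
  then show "emeasure (rescaled_dos k) (space (rescaled_dos k)) \<noteq> \<infinity>"
    using sets_eq_imp_space_eq[OF sets_rescaled_dos] by simp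
qed

lemma nn_integral_poisson_kernel_rescaled_dos:
  "(\<integral>\<^sup>+s. ennreal (poisson_kernel y x s) \<partial>rescaled_dos k) =
    (\<integral>\<^sup>+t. ennreal (poisson_kernel (y / real n ^ k) (e + x / real n ^ k) t) \<partial>level_dos (l k))"
proof -
  have "(\<integral>\<^sup>+s. ennreal (poisson_kernel y x s) \<partial>rescaled_dos k) =
      ennreal (real n ^ k) * (\<integral>\<^sup>+t. ennreal (poisson_kernel y x (real n ^ k * (t - e))) \<partial>level_dos (l k))"
    unfolding rescaled_dos_def by (simp add: nn_integral_scale_measure nn_integral_distr)
  also have "\<dots> = (\<integral>\<^sup>+t. ennreal (real n ^ k) * ennreal (poisson_kernel y x (real n ^ k * (t - e))) \<partial>level_dos (l k))"
    by (rule nn_integral_cmult[symmetric]) measurable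
  also have "\<dots> = (\<integral>\<^sup>+t. ennreal (poisson_kernel (y / real n ^ k) (e + x / real n ^ k) t) \<partial>level_dos (l k))"
    by (intro nn_integral_cong) (simp add: poisson_kernel_scale ennreal_mult')
  finally show ?thesis .
qed

lemma nn_integral_poisson_kernel_rescaled_dos_le:
  "y > 0 \<Longrightarrow> (\<integral>\<^sup>+s. ennreal (poisson_kernel y x s) \<partial>rescaled_dos k) \<le> ennreal (pi * \<Gamma>)"
  unfolding nn_integral_poisson_kernel_rescaled_dos level_dos_def
  by (intro level.nn_integral_poisson_kernel_dos_le) simp

lemma measure_rescaled_dos_le:
  assumes A: "A \<in> sets borel" "bounded A"
  shows "measure (rescaled_dos k) A \<le> \<Gamma> * measure lborel A"
proof -
  interpret finite_measure "rescaled_dos k" by (rule finite_rescaled_dos)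
  have "emeasure (rescaled_dos k) A \<le> ennreal \<Gamma> * emeasure lborel A"
    using A by (intro emeasure_le_of_poisson_bound finite_rescaled_dos nn_integral_poisson_kernel_rescaled_dos_le \<Gamma>_nonneg) auto
  also have "emeasure lborel A = ennreal (measure lborel A)"
    using emeasure_bounded_finite[OF A(2)] by (intro emeasure_eq_ennreal_measure) auto
  finally show ?thesis using \<Gamma>_nonneg by (simp add: emeasure_eq_measure flip: ennreal_mult)
qed

lemma expectation_block_count:
  assumes A: "A \<in> sets borel"
  shows "(\<integral>w. real (block_count k w A) \<partial>M) = measure (rescaled_dos k) A / real (num_blocks k)"
proof -
  have "real (num_blocks k) * (\<integral>w. real (block_count k w A) \<partial>M) =
      real (num_blocks k) * (real (n ^ l k) * measure (level_dos (l k)) (window k A))"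
    unfolding scaled_count_def level_dos_def using level.expectation_eig_count[OF sets_window[OF A]] by simp
  also have "\<dots> = real n ^ k * measure (level_dos (l k)) (window k A)"
    by (simp add: num_blocks_mult flip: of_nat_mult of_nat_power mult.assoc)
  also have "\<dots> = measure (rescaled_dos k) A"
    by (simp add: measure_def emeasure_rescaled_dos[OF A] enn2real_mult)
  finally show ?thesis using num_blocks_pos[of k] by (simp add: field_simps)
qed

lemma block_count_Minami:
  assumes R: "R > 0"
  shows "(\<integral>w. real (block_count k w {- R..R} * (block_count k w {- R..R} - 1)) \<partial>M) \<le>
      pi * (2 * R * \<Gamma>)\<^sup>2 / (real (num_blocks k))\<^sup>2"
    and "integrable M (\<lambda>w. real (block_count k w {- R..R} * (block_count k w {- R..R} - 1)))"
proof -
  let ?Z = "\<lambda>w. block_count k w {- R..R}" and ?b = "real (num_blocks k)"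
  have window: "window k {- R..R} = {e - R / real n ^ k..e + R / real n ^ k}" by (simp add: window_Icc)
  have [measurable]: "?Z \<in> measurable M (count_space UNIV)" by (rule measurable_scaled_count) simp
  have "real (?Z w * (?Z w - 1)) \<le> real (n ^ l k * n ^ l k)" for w
    unfolding scaled_count_def by (intro of_nat_mono mult_le_mono order.trans[OF diff_le_self] level.eig_count_le)
  then show int: "integrable M (\<lambda>w. real (?Z w * (?Z w - 1)))"
    by (intro M.integrable_const_bound[of _ "real (n ^ l k * n ^ l k)"]) auto
  have "ennreal (\<integral>w. real (?Z w * (?Z w - 1)) \<partial>M) = (\<integral>\<^sup>+w. ennreal (real (?Z w * (?Z w - 1))) \<partial>M)"
    using int by (intro nn_integral_eq_integral[symmetric]) auto
  also have "\<dots> \<le> ennreal (pi * (2 * (R / real n ^ k) * \<Gamma> * real (n ^ l k))\<^sup>2)"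
    unfolding scaled_count_def window using R by (intro level.Minami_estimate) simp
  also have "2 * (R / real n ^ k) * \<Gamma> * real (n ^ l k) = 2 * R * \<Gamma> / ?b"
  proof -
    have "real n ^ k = ?b * real (n ^ l k)" using num_blocks_mult[of k] by (metis of_nat_mult of_nat_power)
    then show ?thesis by simp
  qed
  finally show "(\<integral>w. real (?Z w * (?Z w - 1)) \<partial>M) \<le> pi * (2 * R * \<Gamma>)\<^sup>2 / ?b\<^sup>2"
    by (simp add: power_divide)
qed

theorem vector_law_block_count_near_affine:
  assumes A: "\<And>s. s < m \<Longrightarrow> A s \<in> sets borel" "\<And>s. s < m \<Longrightarrow> A s \<subseteq> {- R..R}" and R: "R > 0"
    and dis: "disjoint_family_on A {..<m}"
  shows "\<bar>vector_law m (\<lambda>w s. block_count k w (A s)) q - of_bool ((\<Sum>s<m. q s) = 0)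
      - poisson_slope m q (\<lambda>s. measure (rescaled_dos k) (A s) / real (num_blocks k))\<bar>
    \<le> pi * (2 * R * \<Gamma>)\<^sup>2 / (real (num_blocks k))\<^sup>2"
proof -
  have sum_le: "(\<Sum>s<m. block_count k w (A s)) \<le> block_count k w {- R..R}" for w
    unfolding sum_scaled_count[OF dis] using A(2) by (intro scaled_count_mono) blast
  have "\<bar>vector_law m (\<lambda>w s. block_count k w (A s)) q - of_bool ((\<Sum>s<m. q s) = 0)
      - poisson_slope m q (\<lambda>s. \<integral>w. real (block_count k w (A s)) \<partial>M)\<bar>
    \<le> (\<integral>w. real (block_count k w {- R..R} * (block_count k w {- R..R} - 1)) \<partial>M)"
    using A(1) by (intro vector_law_near_affine measurable_scaled_count integrable_scaled_count block_count_Minami(2) R sum_le)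
  also note block_count_Minami(1)[OF R]
  also have "poisson_slope m q (\<lambda>s. \<integral>w. real (block_count k w (A s)) \<partial>M) =
      poisson_slope m q (\<lambda>s. measure (rescaled_dos k) (A s) / real (num_blocks k))"
    using A(1) by (simp add: poisson_slope_def expectation_block_count cong: sum.cong_simp)
  finally show ?thesis .
qed

end

section \<open>Poisson statistics\<close>

lemma bounded_UN_subset_Icc:
  fixes A :: "nat \<Rightarrow> real set"
  assumes "\<And>s. s < m \<Longrightarrow> bounded (A s)"
  shows "\<exists>R>0. \<forall>s<m. A s \<subseteq> {- R..R}"
proof -
  have "bounded (\<Union>s\<in>{..<m}. A s)" using assms by (intro bounded_UN) auto
  then obtain R where "R > 0" "\<And>s x. s < m \<Longrightarrow> x \<in> A s \<Longrightarrow> \<bar>x\<bar> \<le> R" unfolding bounded_pos by auto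
  then show ?thesis by (intro exI[of _ R]) (fastforce simp: abs_le_iff)
qed

locale regular_energy = decoupled_anderson +
  fixes x0 :: nat and \<eta> :: "real \<Rightarrow> real"
  assumes eta_meas [measurable]: "\<eta> \<in> borel_measurable borel"
    and eta_nonneg: "\<eta> t \<ge> 0"
    and eta_prob: "(\<integral>\<^sup>+ t. ennreal (\<eta> t) \<partial>lborel) = 1"
    and eta_density: "Im z > 0 \<Longrightarrow>
      (\<integral> t. complex_of_real (\<eta> t) / (complex_of_real t - z) \<partial>lborel) = (\<integral> w. hresolvent n p x0 w z \<partial>M)"
    and eta_limit: "Im z > 0 \<Longrightarrow>
      ((\<lambda>\<epsilon>. \<integral> t. Im (1 / (complex_of_real (t - e) - complex_of_real \<epsilon> * z)) * \<eta> t \<partial>lborel)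
        \<longlongrightarrow> pi * \<eta> e) (at_right 0)"
begin

lemma Im_integral_hresolvent:
  assumes y: "y > 0"
  shows "Im (\<integral>w. hresolvent n p x0 w (Complex E y) \<partial>M) = (\<integral>t. poisson_kernel y E t * \<eta> t \<partial>lborel)"
proof -
  have "integrable lborel \<eta>" using eta_prob eta_nonneg by (intro integrableI_nonneg) auto
  then show ?thesis using Im_cauchy_transform[OF _ y, of \<eta> E] eta_density[of "Complex E y"] y by simp
qed

lemma poisson_transform_level_dos_close:
  assumes y: "y > 0"
  shows "\<bar>Im (\<integral>w. ball_green x0 w (Complex E y) j x0 \<partial>M) - (\<integral>t. poisson_kernel y E t * \<eta> t \<partial>lborel)\<bar>
    \<le> coupling_tail j / y\<^sup>2"
proof -
  let ?d = "(\<integral>w. ball_green x0 w (Complex E y) j x0 \<partial>M) - (\<integral>w. hresolvent n p x0 w (Complex E y) \<partial>M)"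
  have "\<bar>Im ?d\<bar> \<le> coupling_tail j / y\<^sup>2"
    using abs_Im_le_cmod[of ?d] integral_ball_green_close[of "Complex E y" x0 j] y by simp
  then show ?thesis by (simp add: Im_integral_hresolvent[OF y])
qed

lemma poisson_transform_eta_tendsto:
  assumes y: "y > 0"
  shows "(\<lambda>k. \<integral>t. poisson_kernel (y / real n ^ k) (e + x / real n ^ k) t * \<eta> t \<partial>lborel) \<longlonglongrightarrow> pi * \<eta> e"
proof -
  have "(\<lambda>k. (1 / real n) ^ k) \<longlonglongrightarrow> 0" using n2 by (intro LIMSEQ_realpow_zero) auto
  then have "filterlim (\<lambda>k. 1 / real n ^ k) (at_right 0) sequentially"
    by (auto simp: filterlim_at power_divide intro!: always_eventually)
  from filterlim_compose[OF eta_limit[of "Complex x y"] this] y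
  have "(\<lambda>k. \<integral>t. Im (1 / (complex_of_real (t - e) - complex_of_real (1 / real n ^ k) * Complex x y)) * \<eta> t \<partial>lborel)
      \<longlonglongrightarrow> pi * \<eta> e" by simp
  moreover have "Im (1 / (complex_of_real (t - e) - complex_of_real (1 / real n ^ k) * Complex x y)) =
      poisson_kernel (y / real n ^ k) (e + x / real n ^ k) t" for t k
  proof -
    have "complex_of_real (t - e) - complex_of_real (1 / real n ^ k) * Complex x y =
        complex_of_real t - Complex (e + x / real n ^ k) (y / real n ^ k)" by (simp add: complex_eq_iff)
    then show ?thesis by (simp only: Im_resolvent_kernel)
  qed
  ultimately show ?thesis by simp
qed

lemma nn_integral_poisson_kernel_rescaled_dos_tendsto:
  assumes y: "y > 0"
  shows "(\<lambda>k. \<integral>\<^sup>+s. ennreal (poisson_kernel y x s) \<partial>rescaled_dos k) \<longlonglongrightarrow> ennreal (pi * \<eta> e)"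
proof -
  define I where "I k = Im (\<integral>w. ball_green x0 w (Complex (e + x / real n ^ k) (y / real n ^ k)) (l k) x0 \<partial>M)" for k
  define J where "J k = (\<integral>t. poisson_kernel (y / real n ^ k) (e + x / real n ^ k) t * \<eta> t \<partial>lborel)" for k
  have close: "\<forall>k. norm (I k - J k) \<le> (real n ^ k)\<^sup>2 * coupling_tail (l k) / y\<^sup>2"
  proof
    fix k
    have "\<bar>I k - J k\<bar> \<le> coupling_tail (l k) / (y / real n ^ k)\<^sup>2"
      unfolding I_def J_def using y by (intro poisson_transform_level_dos_close) simp
    then show "norm (I k - J k) \<le> (real n ^ k)\<^sup>2 * coupling_tail (l k) / y\<^sup>2" by (simp add: power_divide mult.commute)
  qed
  have "(\<lambda>k. I k - J k) \<longlonglongrightarrow> 0"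
    by (rule Lim_null_comparison[OF always_eventually[OF close] tendsto_divide_zero[OF l_tail]])
  moreover have "J \<longlonglongrightarrow> pi * \<eta> e" unfolding J_def by (rule poisson_transform_eta_tendsto[OF y])
  ultimately have "(\<lambda>k. (I k - J k) + J k) \<longlonglongrightarrow> 0 + pi * \<eta> e" by (rule tendsto_add)
  then have "(\<lambda>k. ennreal (I k)) \<longlonglongrightarrow> ennreal (pi * \<eta> e)" by (intro tendsto_ennrealI) simp
  moreover have "(\<integral>\<^sup>+s. ennreal (poisson_kernel y x s) \<partial>rescaled_dos k) = ennreal (I k)" for k
    unfolding nn_integral_poisson_kernel_rescaled_dos I_def
    using y by (intro nn_integral_poisson_kernel_level_dos) simp
  ultimately show ?thesis by simp
qed

theorem measure_rescaled_dos_tendsto: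
  assumes A: "A \<in> sets borel" "bounded A"
  shows "(\<lambda>k. measure (rescaled_dos k) A) \<longlonglongrightarrow> \<eta> e * measure lborel A"
proof -
  interpret vanishing_discrepancy "\<lambda>k A. \<bar>measure (rescaled_dos k) A - \<eta> e * measure lborel A\<bar>" "\<Gamma> + \<eta> e"
  proof
    fix k :: nat and A :: "real set" assume A: "A \<in> sets borel" "bounded A"
    have "0 \<le> measure (rescaled_dos k) A" "0 \<le> \<eta> e * measure lborel A" using eta_nonneg by auto
    then show "\<bar>measure (rescaled_dos k) A - \<eta> e * measure lborel A\<bar> \<le> (\<Gamma> + \<eta> e) * measure lborel A"
      using measure_rescaled_dos_le[OF A, of k] unfolding distrib_right by linarith
    fix B :: "real set" assume B: "B \<in> sets borel" "bounded B" "A \<inter> B = {}"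
    interpret finite_measure "rescaled_dos k" by (rule finite_rescaled_dos)
    have Un: "measure (rescaled_dos k) (A \<union> B) = measure (rescaled_dos k) A + measure (rescaled_dos k) B"
      "measure lborel (A \<union> B) = measure lborel A + measure lborel B"
      using A B emeasure_bounded_finite[of A] emeasure_bounded_finite[of B]
      by (auto intro!: finite_measure_Union measure_Union)
    show "\<bar>measure (rescaled_dos k) (A \<union> B) - \<eta> e * measure lborel (A \<union> B)\<bar> \<le>
        \<bar>measure (rescaled_dos k) A - \<eta> e * measure lborel A\<bar> + \<bar>measure (rescaled_dos k) B - \<eta> e * measure lborel B\<bar>"
      "\<bar>measure (rescaled_dos k) A - \<eta> e * measure lborel A\<bar> \<le>
        \<bar>measure (rescaled_dos k) (A \<union> B) - \<eta> e * measure lborel (A \<union> B)\<bar> + \<bar>measure (rescaled_dos k) B - \<eta> e * measure lborel B\<bar>"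
      unfolding Un distrib_left by linarith+
  next
    fix a b :: real assume ab: "a \<le> b"
    have "(\<lambda>k. measure (rescaled_dos k) {a..b}) \<longlonglongrightarrow> \<eta> e * (b - a)"
      using \<Gamma>_nonneg eta_nonneg ab
      by (intro interval_mass_tendsto_of_poisson_tendsto[where B = \<Gamma>] finite_rescaled_dos sets_rescaled_dos
          nn_integral_poisson_kernel_rescaled_dos_le nn_integral_poisson_kernel_rescaled_dos_tendsto)
    then show "(\<lambda>k. \<bar>measure (rescaled_dos k) {a..b} - \<eta> e * measure lborel {a..b}\<bar>) \<longlonglongrightarrow> 0"
      using ab by (intro tendsto_rabs_zero) (simp add: LIM_zero)
  qed simp
  show ?thesis using tendsto_0[OF A] by (simp add: tendsto_rabs_zero_iff LIM_zero_iff)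
qed

lemma block_law_rate:
  fixes m :: nat
  assumes A: "\<And>s. s < m \<Longrightarrow> A s \<in> sets borel" "\<And>s. s < m \<Longrightarrow> bounded (A s)"
    and dis: "disjoint_family_on A {..<m}"
  shows "(\<lambda>k. real (num_blocks k) * (vector_law m (\<lambda>w s. block_count k w (A s)) q - of_bool ((\<Sum>s<m. q s) = 0)))
    \<longlonglongrightarrow> poisson_slope m q (\<lambda>s. \<eta> e * measure lborel (A s))"
proof -
  obtain R where R: "R > 0" "\<And>s. s < m \<Longrightarrow> A s \<subseteq> {- R..R}"
    using bounded_UN_subset_Icc[of m A] A(2) by metis
  define C where "C = pi * (2 * R * \<Gamma>)\<^sup>2"
  define c where "c k = real (num_blocks k) * (vector_law m (\<lambda>w s. block_count k w (A s)) q - of_bool ((\<Sum>s<m. q s) = 0))" for k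
  define v where "v k = poisson_slope m q (\<lambda>s. measure (rescaled_dos k) (A s))" for k
  have close: "\<forall>k. norm (c k - v k) \<le> C * inverse (real (num_blocks k))"
  proof
    fix k
    let ?b = "real (num_blocks k)"
    let ?d = "vector_law m (\<lambda>w s. block_count k w (A s)) q - of_bool ((\<Sum>s<m. q s) = 0)
      - poisson_slope m q (\<lambda>s. measure (rescaled_dos k) (A s) / ?b)"
    have b: "?b > 0" using num_blocks_pos by simp
    have "v k = ?b * poisson_slope m q (\<lambda>s. measure (rescaled_dos k) (A s) / ?b)"
      unfolding v_def poisson_slope_scale using b by simp
    then have "c k - v k = ?b * ?d" by (simp add: c_def algebra_simps)
    then have "norm (c k - v k) = ?b * \<bar>?d\<bar>" using b by (simp add: abs_mult)
    also have "\<dots> \<le> ?b * (C / ?b\<^sup>2)"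
      unfolding C_def by (intro mult_left_mono vector_law_block_count_near_affine A R dis) auto
    also have "\<dots> = C * inverse ?b" using b by (simp add: power2_eq_square field_simps)
    finally show "norm (c k - v k) \<le> C * inverse ?b" .
  qed
  have "(\<lambda>k. c k - v k) \<longlonglongrightarrow> 0"
    by (rule Lim_null_comparison[OF always_eventually[OF close]
          tendsto_mult_right_zero[OF tendsto_inverse_0_at_top[OF num_blocks_at_top]]])
  moreover have "v \<longlonglongrightarrow> poisson_slope m q (\<lambda>s. \<eta> e * measure lborel (A s))"
    unfolding v_def by (intro poisson_slope_tendsto measure_rescaled_dos_tendsto A)
  ultimately have "(\<lambda>k. (c k - v k) + v k) \<longlonglongrightarrow> 0 + poisson_slope m q (\<lambda>s. \<eta> e * measure lborel (A s))"
    by (rule tendsto_add)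
  then show ?thesis by (simp add: c_def)
qed

lemma decoupled_law_tendsto:
  fixes m :: nat
  assumes A: "\<And>s. s < m \<Longrightarrow> A s \<in> sets borel" "\<And>s. s < m \<Longrightarrow> bounded (A s)"
    and dis: "disjoint_family_on A {..<m}"
  shows "(\<lambda>k. vector_law m (\<lambda>w s. decoupled_count k w (A s)) r)
    \<longlonglongrightarrow> poisson_vec m (\<lambda>s. \<eta> e * measure lborel (A s)) 1 r"
proof -
  let ?\<Lambda> = "\<lambda>s. \<eta> e * measure lborel (A s)"
  let ?d = "\<lambda>k q. vector_law m (\<lambda>w s. block_count k w (A s)) q - poisson_vec m ?\<Lambda> (1 / real (num_blocks k)) q"
  have d: "(\<lambda>k. real (num_blocks k) * ?d k q) \<longlonglongrightarrow> 0" for q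
  proof -
    let ?o = "of_bool ((\<Sum>s<m. q s) = 0)"
    have "(\<lambda>k. real (num_blocks k) * (vector_law m (\<lambda>w s. block_count k w (A s)) q - ?o)
        - real (num_blocks k) * (poisson_vec m ?\<Lambda> (1 / real (num_blocks k)) q - ?o))
        \<longlonglongrightarrow> poisson_slope m q ?\<Lambda> - poisson_slope m q ?\<Lambda>"
      by (intro tendsto_diff block_law_rate A dis poisson_vec_rate num_blocks_at_top)
    then show ?thesis by (simp add: algebra_simps)
  qed
  have "(\<lambda>k. \<Sum>q\<in>count_box m r. \<bar>real (num_blocks k) * ?d k q\<bar>) \<longlonglongrightarrow> 0"
    by (intro tendsto_null_sum tendsto_rabs_zero d)
  then have lim: "(\<lambda>k. real (num_blocks k) * (\<Sum>q\<in>count_box m r. \<bar>?d k q\<bar>)) \<longlonglongrightarrow> 0"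
    by (simp add: abs_mult sum_distrib_left)
  have "\<forall>k. norm (vector_law m (\<lambda>w s. decoupled_count k w (A s)) r - poisson_vec m ?\<Lambda> 1 r) \<le>
      real (num_blocks k) * (\<Sum>q\<in>count_box m r. \<bar>?d k q\<bar>)"
    unfolding real_norm_def using eta_nonneg by (intro allI vector_law_decoupled_count_poisson_bound A) auto
  then have "(\<lambda>k. vector_law m (\<lambda>w s. decoupled_count k w (A s)) r - poisson_vec m ?\<Lambda> 1 r) \<longlonglongrightarrow> 0"
    by (rule Lim_null_comparison[OF always_eventually lim])
  then show ?thesis by (rule LIM_zero_cancel)
qed

lemma full_law_tendsto:
  fixes m :: nat
  assumes A: "\<And>s. s < m \<Longrightarrow> A s \<in> sets borel" "\<And>s. s < m \<Longrightarrow> bounded (A s)"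
    and dis: "disjoint_family_on A {..<m}"
  shows "(\<lambda>k. vector_law m (\<lambda>w s. full_count k w (A s)) r)
    \<longlonglongrightarrow> poisson_vec m (\<lambda>s. \<eta> e * measure lborel (A s)) 1 r"
proof -
  let ?full = "\<lambda>k. vector_law m (\<lambda>w s. full_count k w (A s)) r"
  let ?dec = "\<lambda>k. vector_law m (\<lambda>w s. decoupled_count k w (A s)) r"
  have close: "\<forall>k. norm (?full k - ?dec k) \<le> (\<Sum>s<m. count_distance k (A s))"
    using vector_law_full_count_close[OF A(1)] by simp
  have "(\<lambda>k. \<Sum>s<m. count_distance k (A s)) \<longlonglongrightarrow> 0"
    using A by (intro tendsto_null_sum count_distance_tendsto) auto
  then have "(\<lambda>k. ?full k - ?dec k) \<longlonglongrightarrow> 0" by (rule Lim_null_comparison[OF always_eventually[OF close]])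
  from tendsto_add[OF this decoupled_law_tendsto[OF A dis, of r]] show ?thesis by simp
qed

text \<open>The ball \<open>B\<^sub>k\<close> around \<open>x\<^sub>0\<close> is a translate of \<open>{..<n ^ k}\<close>, and the potential is stationary.\<close>
lemma measure_hxi_event:
  fixes m :: nat
  assumes A: "\<And>s. s < m \<Longrightarrow> A s \<in> sets borel"
  shows "measure M {w. \<forall>s<m. hxi n p x0 e k w (A s) = r s} = vector_law m (\<lambda>w s. full_count k w (A s)) r"
proof -
  let ?E = "{w. \<forall>s<m. full_count k w (A s) = r s}" and ?f = "\<lambda>i. x0 div n ^ k * n ^ k + i"
  have hxi: "hxi n p x0 e k w B = full_count k (\<lambda>i. w (?f i)) B" for w B
    unfolding hxi_def scaled_count_def eig_count_def hHk_mat_eq_schroedinger_mat[OF n_pos] by (simp add: window_def)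
  have E: "?E \<in> sets M" by (intro sets_vector_event measurable_scaled_count A)
  have "measure M ?E = measure (distr M M (\<lambda>w i. w (?f i))) ?E" by (subst distr_reindex) (auto simp: inj_def)
  also have "\<dots> = measure M ((\<lambda>w i. w (?f i)) -` ?E \<inter> space M)" by (rule measure_distr[OF measurable_reindex E])
  also have "(\<lambda>w i. w (?f i)) -` ?E \<inter> space M = {w. \<forall>s<m. hxi n p x0 e k w (A s) = r s}" by (auto simp: hxi)
  finally show ?thesis by (simp add: vector_law_def)
qed

theorem hxi_tendsto_poisson:
  fixes m :: nat
  assumes A: "\<And>s. s < m \<Longrightarrow> A s \<in> sets borel" "\<And>s. s < m \<Longrightarrow> bounded (A s)"
    and dis: "disjoint_family_on A {..<m}"
  shows "(\<lambda>k. measure M {w \<in> space M. \<forall>s<m. hxi n p x0 e k w (A s) = r s}) \<longlonglongrightarrow>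
    (\<Prod>s<m. exp (- \<eta> e * measure lborel (A s)) * (\<eta> e * measure lborel (A s)) ^ r s / fact (r s))"
  using full_law_tendsto[OF A dis, of r]
  by (simp add: measure_hxi_event[OF A(1)] poisson_vec_def poisson_weight_def)

end

lemma nat_ceiling_mult_le:
  assumes "\<alpha> \<le> 1"
  shows "nat \<lceil>\<alpha> * real k\<rceil> \<le> k"
proof -
  have "\<alpha> * real k \<le> 1 * real k" using assms by (intro mult_right_mono) auto
  then show ?thesis by (simp add: nat_le_iff ceiling_le_iff)
qed

lemma filterlim_diff_nat_ceiling_mult:
  assumes "0 \<le> \<alpha>" "\<alpha> < 1"
  shows "filterlim (\<lambda>k. k - nat \<lceil>\<alpha> * real k\<rceil>) at_top sequentially"
  unfolding filterlim_at_top
proof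
  fix Z :: nat
  have "\<forall>\<^sub>F k in sequentially. (real Z + 1) / (1 - \<alpha>) \<le> real k"
    using filterlim_real_sequentially by (simp add: filterlim_at_top)
  then show "\<forall>\<^sub>F k in sequentially. Z \<le> k - nat \<lceil>\<alpha> * real k\<rceil>"
  proof eventually_elim
    case (elim k)
    then have "real Z + 1 \<le> (1 - \<alpha>) * real k" using assms by (simp add: field_simps)
    moreover have "real (nat \<lceil>\<alpha> * real k\<rceil>) \<le> \<alpha> * real k + 1"
      using assms by (simp add: of_nat_nat ceiling_mono[of 0, simplified])
    ultimately have "real Z \<le> real k - real (nat \<lceil>\<alpha> * real k\<rceil>)" by (simp add: algebra_simps)
    then show ?case by linarith
  qed
qed

context hierarchy
begin

lemma coupling_tail_le_geometric:
  assumes rho: "\<rho> > 1" and p: "\<And>s. s \<ge> 1 \<Longrightarrow> p s \<le> C * \<rho> powr (- real s)"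
  shows "coupling_tail j \<le> C / (\<rho> - 1) * \<rho> powr (- real j)"
proof (rule sums_le[OF _ coupling_tail_sums])
  show "p (Suc (r + j)) \<le> C * \<rho> powr (- real (Suc j)) * (1 / \<rho>) ^ r" for r
  proof -
    have "\<rho> powr (- real (Suc (r + j))) = \<rho> powr (- real (Suc j)) * \<rho> powr (- real r)"
      by (simp add: algebra_simps flip: powr_add)
    also have "\<rho> powr (- real r) = (1 / \<rho>) ^ r"
      using rho by (simp add: powr_minus powr_realpow power_one_over inverse_eq_divide)
    finally show ?thesis using p[of "Suc (r + j)"] by (simp add: mult.assoc)
  qed
  have "(\<lambda>r. (1 / \<rho>) ^ r) sums (1 / (1 - 1 / \<rho>))" using rho by (intro geometric_sums) auto
  from sums_mult[OF this, of "C * \<rho> powr (- real (Suc j))"]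
  have "(\<lambda>r. C * \<rho> powr (- real (Suc j)) * (1 / \<rho>) ^ r) sums (C * \<rho> powr (- real (Suc j)) * (1 / (1 - 1 / \<rho>)))" .
  moreover have "\<rho> powr (- real (Suc j)) = \<rho> powr (- real j) / \<rho>" using rho by (simp add: powr_diff powr_minus divide_inverse)
  then have "C * \<rho> powr (- real (Suc j)) * (1 / (1 - 1 / \<rho>)) = C / (\<rho> - 1) * \<rho> powr (- real j)"
    using rho by (simp add: field_simps)
  ultimately show "(\<lambda>r. C * \<rho> powr (- real (Suc j)) * (1 / \<rho>) ^ r) sums (C / (\<rho> - 1) * \<rho> powr (- real j))" by simp
qed

lemma scaled_coupling_tail_null:
  assumes rho: "\<rho> > 1" and p: "\<And>s. s \<ge> 1 \<Longrightarrow> p s \<le> C * \<rho> powr (- real s)"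
    and \<alpha>: "2 * ln (real n) / ln \<rho> < \<alpha>" and l: "\<And>k. \<alpha> * real k \<le> real (l k)"
  shows "(\<lambda>k. (real n ^ k)\<^sup>2 * coupling_tail (l k)) \<longlonglongrightarrow> 0"
proof -
  define K where "K = C / (\<rho> - 1)"
  define x where "x = (real n)\<^sup>2 * \<rho> powr (- \<alpha>)"
  have "0 < C * \<rho> powr (- real 1)" using p_pos[of 1] p[of 1] by (simp del: of_nat_1)
  then have "C > 0" by (rule zero_less_mult_pos2) (use rho in simp)
  then have K: "K \<ge> 0" unfolding K_def using rho by simp
  have "\<rho> powr (2 * ln (real n) / ln \<rho>) = (real n)\<^sup>2"
    using rho n2 by (simp add: powr_def exp_of_nat_mult[of 2, simplified])
  then have "(real n)\<^sup>2 < \<rho> powr \<alpha>" using \<alpha> rho powr_less_mono by metis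
  then have x: "0 \<le> x" "x < 1" unfolding x_def using rho by (auto simp: powr_minus field_simps)
  have close: "\<forall>k. norm ((real n ^ k)\<^sup>2 * coupling_tail (l k)) \<le> K * x ^ k"
  proof
    fix k
    have "coupling_tail (l k) \<le> K * \<rho> powr (- real (l k))"
      unfolding K_def by (rule coupling_tail_le_geometric[OF rho p])
    also have "\<dots> \<le> K * \<rho> powr (- \<alpha> * real k)" using K rho l[of k] by (intro mult_left_mono powr_mono) auto
    also have "\<rho> powr (- \<alpha> * real k) = (\<rho> powr (- \<alpha>)) ^ k" using rho by (simp add: powr_powr flip: powr_realpow)
    finally have "(real n ^ k)\<^sup>2 * coupling_tail (l k) \<le> (real n ^ k)\<^sup>2 * (K * (\<rho> powr (- \<alpha>)) ^ k)"
      by (rule mult_left_mono) simp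
    also have "\<dots> = K * x ^ k" by (simp add: x_def power_mult_distrib power_mult[symmetric] mult.commute)
    finally show "norm ((real n ^ k)\<^sup>2 * coupling_tail (l k)) \<le> K * x ^ k" using coupling_tail_nonneg by simp
  qed
  have "(\<lambda>k. K * x ^ k) \<longlonglongrightarrow> 0" using x by (intro tendsto_mult_right_zero LIMSEQ_realpow_zero) auto
  then show ?thesis by (rule Lim_null_comparison[OF always_eventually[OF close]])
qed

text \<open>The spectral dimension being less than one means \<open>n\<^sup>2 < \<rho>\<close>, which leaves room for a decoupling
  scale \<open>\<lceil>\<alpha> k\<rceil>\<close> with \<open>\<alpha> < 1\<close> such that \<open>n\<^sup>2\<^sup>k \<rho>\<^sup>-\<^sup>\<alpha>\<^sup>k\<close> still tends to zero.\<close>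
lemma decoupling_scale:
  assumes rho: "\<rho> > 1" and p: "\<And>s. s \<ge> 1 \<Longrightarrow> p s \<le> C * \<rho> powr (- real s)"
    and dim: "2 * ln (real n) / ln \<rho> < 1"
  obtains l where "\<And>k. l k \<le> k" "filterlim (\<lambda>k. k - l k) at_top sequentially"
    "(\<lambda>k. (real n ^ k)\<^sup>2 * coupling_tail (l k)) \<longlonglongrightarrow> 0"
proof -
  obtain \<alpha> where \<alpha>: "2 * ln (real n) / ln \<rho> < \<alpha>" "\<alpha> < 1" using dim dense by blast
  moreover have "0 \<le> 2 * ln (real n) / ln \<rho>" using n2 rho by simp
  ultimately have \<alpha>_nonneg: "0 \<le> \<alpha>" by linarith
  show thesis
  proof (rule that)
    show "nat \<lceil>\<alpha> * real k\<rceil> \<le> k" for k using \<alpha>(2) by (intro nat_ceiling_mult_le) simp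
    show "filterlim (\<lambda>k. k - nat \<lceil>\<alpha> * real k\<rceil>) at_top sequentially"
      by (rule filterlim_diff_nat_ceiling_mult[OF \<alpha>_nonneg \<alpha>(2)])
    show "(\<lambda>k. (real n ^ k)\<^sup>2 * coupling_tail (nat \<lceil>\<alpha> * real k\<rceil>)) \<longlonglongrightarrow> 0"
      by (rule scaled_coupling_tail_null[OF rho p \<alpha>(1)]) (simp_all add: real_nat_ceiling_ge)
  qed
qed

end

theorem theorem3p7:
  fixes n :: nat and \<rho> C1 C2 e :: real and p :: "nat \<Rightarrow> real" and x0 :: nat
    and \<gamma> \<eta> :: "real \<Rightarrow> real"
  defines "M \<equiv> PiM (UNIV :: nat set) (\<lambda>_. density lborel (\<lambda>t. ennreal (\<gamma> t)))"
  assumes n2: "n \<ge> 2" and rho: "\<rho> > 1"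
    and p_pos: "\<forall>r\<ge>1. p r > 0"
    and p_sum: "(\<lambda>r. p (Suc r)) sums 1"
    and C_pos: "C1 > 0" "C2 > 0"
    and p_bounds: "\<forall>r\<ge>1. C1 * \<rho> powr (- real r) \<le> p r \<and> p r \<le> C2 * \<rho> powr (- real r)"
    and dim: "2 * ln (real n) / ln \<rho> < 1"
    and gamma_meas: "\<gamma> \<in> borel_measurable borel"
    and gamma_nonneg: "\<forall>t. \<gamma> t \<ge> 0"
    and gamma_bdd: "\<exists>B. \<forall>t. \<gamma> t \<le> B"
    and gamma_prob: "(\<integral>\<^sup>+ t. ennreal (\<gamma> t) \<partial>lborel) = 1"
    and eta_meas: "\<eta> \<in> borel_measurable borel"
    and eta_nonneg: "\<forall>t. \<eta> t \<ge> 0"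
    and eta_prob: "(\<integral>\<^sup>+ t. ennreal (\<eta> t) \<partial>lborel) = 1"
    and eta_density: "\<forall>z. Im z > 0 \<longrightarrow>
        (\<integral> t. complex_of_real (\<eta> t) / (complex_of_real t - z) \<partial>lborel)
          = (\<integral> \<omega>. hresolvent n p x0 \<omega> z \<partial>M)"
    and eta_pos: "\<eta> e > 0"
    and eta_limit: "\<forall>z. Im z > 0 \<longrightarrow>
        ((\<lambda>\<epsilon>. \<integral> t. Im (1 / (complex_of_real (t - e) - complex_of_real \<epsilon> * z)) * \<eta> t \<partial>lborel)
          \<longlongrightarrow> pi * \<eta> e) (at_right 0)"
  shows "\<forall>(m :: nat) (A :: nat \<Rightarrow> real set) (r :: nat \<Rightarrow> nat).
     (\<forall>s<m. A s \<in> sets borel \<and> bounded (A s)) \<and> disjoint_family_on A {..<m} \<longrightarrow>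
     ((\<lambda>k. measure M {\<omega> \<in> space M. \<forall>s<m. hxi n p x0 e k \<omega> (A s) = r s})
       \<longlonglongrightarrow> (\<Prod>s<m. exp (- \<eta> e * measure lborel (A s)) *
                      (\<eta> e * measure lborel (A s)) ^ r s / fact (r s)))"
proof -
  obtain B where B: "\<forall>t. \<gamma> t \<le> B" using gamma_bdd by blast
  interpret anderson \<gamma> B using gamma_meas gamma_nonneg gamma_prob B by unfold_locales auto
  interpret hierarchy n p using n2 p_pos p_sum by unfold_locales auto
  have M: "M = anderson.M \<gamma>" unfolding assms(1) M_def site_measure_def ..
  obtain l where "\<And>k. l k \<le> k" "filterlim (\<lambda>k. k - l k) at_top sequentially"
    "(\<lambda>k. (real n ^ k)\<^sup>2 * coupling_tail (l k)) \<longlonglongrightarrow> 0"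
    using decoupling_scale[OF rho _ dim] p_bounds by blast
  then interpret regular_energy \<gamma> B n p e l x0 \<eta>
    using eta_meas eta_nonneg eta_prob eta_density eta_limit unfolding M by unfold_locales auto
  show ?thesis unfolding M by (intro allI impI hxi_tendsto_poisson) auto
qed

end
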